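(* Let $D<-4$ be the discriminant of an imaginary quadratic field with $D\equiv1\pmod4$, and assume $3$ does not divide $D$. Let $N=|D|$, $\chi=\chi_D$, $h=h(D)$, and $$E_0(6)=\sum_{0<x<\frac N6}\chi(x),\qquad E_1(6)=\sum_{\frac N6<x<\frac{2N}6}\chi(x),\qquad E_2(6)=\sum_{\frac{2N}6<x<\frac{3N}6}\chi(x).$$ Then: - if $N\equiv23\pmod{24}$: $E_0(6)=h$, $E_1(6)=0$, $E_2(6)=0$; - if $N\equiv11\pmod{24}$: $E_0(6)=h$, $E_1(6)=0$, $E_2(6)=2h$; - if $N\equiv7\pmod{24}$: $E_0(6)=h$, $E_1(6)=h$, $E_2(6)=-h$; - if $N\equiv19\pmod{24}$: $E_0(6)=-h$, $E_1(6)=3h$, $E_2(6)=h$.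
   Context: Here $D\equiv 1\pmod 4$ is a negative square-free integer, the discriminant of $K=\mathbb{Q}(\sqrt D)$; $h(D)$ is the order of the ideal class group of $K$; and $\chi_D(x)=\left(\frac{x}{N}\right)$ is the Jacobi symbol (equal to $0$ when $\gcd(x,N)>1$). Sums are over integers $x$ with $1\le x\le N$ and $\gcd(x,N)=1$ in the indicated open intervals. *)

theory Defs
  imports
    "HOL-Algebra.Coset"
    "HOL-Computational_Algebra.Computational_Algebra"
    "HOL-Number_Theory.Number_Theory"
begin

text \<open>Number fields are taken as subsets of \<^typ>\<open>complex\<close>; for \<^prop>\<open>D < 0\<close>,
  \<^term>\<open>csqrt (of_int D)\<close> is \<open>\<i>\<close> times the positive root of \<open>\<bar>D\<bar>\<close>.\<close>

definition quad_field :: "int \<Rightarrow> complex set" where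
  "quad_field D = {of_rat a + of_rat b * csqrt (of_int D) | a b. True}"

definition quad_integers :: "int \<Rightarrow> complex set" where
  "quad_integers D = {x \<in> quad_field D. algebraic_int x}"

definition fractional_ideal :: "int \<Rightarrow> complex set \<Rightarrow> bool" where
  "fractional_ideal D I \<longleftrightarrow>
     I \<subseteq> quad_field D \<and> 0 \<in> I \<and> I \<noteq> {0} \<and>
     (\<forall>x\<in>I. \<forall>y\<in>I. x + y \<in> I) \<and>
     (\<forall>r\<in>quad_integers D. \<forall>x\<in>I. r * x \<in> I) \<and>
     (\<exists>d\<in>quad_integers D - {0}. \<forall>x\<in>I. d * x \<in> quad_integers D)"

definition ideal_times :: "complex set \<Rightarrow> complex set \<Rightarrow> complex set" where
  "ideal_times I J =
     {\<Sum>i<n. a i * b i | (n::nat) a b. (\<forall>i<n. a i \<in> I \<and> b i \<in> J)}"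

definition fractional_ideal_group :: "int \<Rightarrow> complex set monoid" where
  "fractional_ideal_group D =
     \<lparr>carrier = {I. fractional_ideal D I}, mult = ideal_times, one = quad_integers D\<rparr>"

definition principal_fractional_ideals :: "int \<Rightarrow> complex set set" where
  "principal_fractional_ideals D = {(*) a ` quad_integers D | a. a \<in> quad_field D - {0}}"

definition ideal_class_group :: "int \<Rightarrow> complex set set monoid" where
  "ideal_class_group D = fractional_ideal_group D Mod principal_fractional_ideals D"

definition class_number :: "int \<Rightarrow> nat" where
  "class_number D = order (ideal_class_group D)"

text \<open>The Jacobi symbol is only meant for odd positive \<open>n\<close>; prime factors are taken with
  multiplicity.\<close>

definition Jacobi :: "int \<Rightarrow> int \<Rightarrow> int" where
  "Jacobi a n = (\<Prod>p\<in>#prime_factorization n. Legendre a p)"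

definition chi :: "int \<Rightarrow> int \<Rightarrow> int" where
  "chi D x = Jacobi x \<bar>D\<bar>"

text \<open>\<open>E D r k\<close> is \<open>E\<^sub>k(r)\<close>, the sum over the open interval from \<open>k N / r\<close> to
  \<open>(k + 1) N / r\<close>, where \<open>N = \<bar>D\<bar>\<close>.\<close>

definition E :: "int \<Rightarrow> nat \<Rightarrow> nat \<Rightarrow> int" where
  "E D r k =
     (\<Sum>x | 1 \<le> x \<and> x \<le> \<bar>D\<bar> \<and> coprime x \<bar>D\<bar> \<and>
           real k * of_int \<bar>D\<bar> / real r < of_int x \<and>
           of_int x < real (k + 1) * of_int \<bar>D\<bar> / real r. chi D x)"

end

theory Submission
  imports Defs "HOL-Analysis.Analysis"
begin

text \<open>Write \<open>\<chi>\<close> for the Jacobi symbol modulo \<open>N\<close>.  Everything rests on Dirichlet's class number formula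
\<open>\<Sum>x<N. x \<chi>(x) = - N h\<close>.

The sums over sixths follow from this formula.  For \<open>r\<close> coprime to \<open>N\<close>, substituting \<open>r x mod N\<close> for \<open>x\<close> in
\<open>\<Sum>x<N. x \<chi>(x)\<close> yields \<open>\<Sum>x<N. \<lfloor>r x / N\<rfloor> \<chi>(x) = - (r - \<chi>(r)) h\<close> (\<open>floor_sum\<close>).  For \<open>r = 2, 3, 6\<close>
the floor is constant on each sixth of the interval, and \<open>\<chi>(-1) = -1\<close> makes the six partial
sums antisymmetric, so these are three linear equations for the three unknowns \<open>E\<^sub>0, E\<^sub>1, E\<^sub>2\<close>
(\<open>sixth_sums\<close>).  Their coefficients involve only \<open>\<chi>(2)\<close> and \<open>\<chi>(3)\<close>, which depend on \<open>N\<close> modulo 24.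

For the class number formula itself, let \<open>F(t) = \<Sum>J. exp(- t Norm J)\<close>, summed over the nonzero ideals of the
ring of integers.  The combination \<open>F(t) - 4 F(4t)\<close> cancels the pole of \<open>F\<close> at \<open>t = 0\<close> and
retains the constant term; its limit is computed in two ways.  (In analytic terms this is
the value of the Dedekind zeta function at \<open>s = 0\<close>.)

On the one hand, the ideals in the class of a fixed ideal \<open>L\<close> are the \<open>\<alpha> L\<close> with \<open>\<alpha>\<close> a
nonzero element of the planar lattice of all \<open>\<alpha>\<close> with \<open>\<alpha> L \<subseteq> \<O>\<close>, and every ideal arises from exactly two such
\<open>\<alpha>\<close> because the units are \<open>\<plusminus>1\<close> for \<open>D < -4\<close>.  For any planar lattice, the theta series \<open>\<theta>\<close> over the
nonzero vectors satisfies \<open>\<theta>(t) - 4 \<theta>(4t) \<rightarrow> 3\<close>: up to alternating sums that tend to 0, the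
only surviving contribution comes from the missing zero vector (\<open>theta_constant_term\<close>).  Hence
the limit is \<open>3 h / 2\<close>.

On the other hand, the number of ideals of norm \<open>n\<close> is \<open>\<Sum>d dvd n. \<chi>(d)\<close> (\<open>card_triples\<close>), so \<open>F\<close> is a
Lambert series and \<open>F(t) - 2 F(2t) = \<Sum>d. \<chi>(d) / (exp(t d) + 1)\<close>.  As \<open>\<chi>\<close> is periodic with mean value 0,
this tends to half of \<open>L(0,\<chi>) = - (1/N) (\<Sum>x<N. x \<chi>(x))\<close>, and the limit of \<open>F(t) - 4 F(4t)\<close> is
\<open>3 L(0,\<chi>) / 2\<close> (\<open>ideal_sum_constant_term\<close>).  Comparison gives \<open>h = L(0,\<chi>)\<close>.\<close>

section \<open>Legendre and Jacobi symbols\<close>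

lemma Legendre_cong:
  assumes "[a = b] (mod p)"
  shows "Legendre a p = Legendre b p"
  using assms by (simp add: Legendre_def QuadRes_def Cong.cong_def)

lemma Legendre_range: "Legendre a p \<in> {-1, 0, 1}"
  by (auto simp: Legendre_def)

lemma Legendre_one: "1 < p \<Longrightarrow> Legendre 1 p = 1"
  by (auto simp: Legendre_def QuadRes_def cong_0_iff intro: exI[of _ 1] dest: zdvd_imp_le)

text \<open>Euler's criterion determines the symbol only modulo \<open>p\<close>; two numbers in \<open>{-1, 0, 1}\<close> that are
congruent modulo \<open>p > 2\<close> are equal.\<close>

lemma Legendre_eqI:
  assumes "prime p" "2 < p" "[x = Legendre a (int p)] (mod (int p))" "x \<in> {-1, 0, 1}"
  shows "Legendre a (int p) = x"
proof -
  have "int p dvd x - Legendre a (int p)"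
    using assms(3) by (simp add: cong_iff_dvd_diff)
  moreover have "\<bar>x - Legendre a (int p)\<bar> < int p"
    using assms(2,4) Legendre_range[of a "int p"] by auto
  ultimately show ?thesis
    by (metis dvd_imp_le_int eq_iff_diff_eq_0 linorder_not_le abs_of_nat)
qed

lemma Legendre_mult:
  assumes "prime p" "2 < p"
  shows "Legendre (a * b) (int p) = Legendre a (int p) * Legendre b (int p)"
proof (rule Legendre_eqI[OF assms])
  let ?e = "(p - 1) div 2"
  have "[Legendre a p * Legendre b p = a ^ ?e * b ^ ?e] (mod p)"
    by (intro cong_mult euler_criterion assms)
  also have "a ^ ?e * b ^ ?e = (a * b) ^ ?e" by (simp add: power_mult_distrib)
  also have "[(a * b) ^ ?e = Legendre (a * b) p] (mod p)"
    by (rule cong_sym[OF euler_criterion[OF assms]])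
  finally show "[Legendre a (int p) * Legendre b (int p) = Legendre (a * b) (int p)] (mod int p)" .
  show "Legendre a (int p) * Legendre b (int p) \<in> {-1, 0, 1}"
    using Legendre_range[of a "int p"] Legendre_range[of b "int p"] by auto
qed

text \<open>On odd numbers, \<open>chi4\<close> and \<open>chi8\<close> are the characters that tell modulo which primes \<open>-1\<close> and \<open>2\<close>,
respectively, are squares.\<close>

definition chi4 :: "int \<Rightarrow> int" where
  "chi4 n = (if n mod 4 = 1 then 1 else -1)"

definition chi8 :: "int \<Rightarrow> int" where
  "chi8 n = (if n mod 8 \<in> {1, 7} then 1 else -1)"

lemma odd_mod_4: "odd (a::int) \<Longrightarrow> a mod 4 \<in> {1, 3}"
  by (simp, presburger)

lemma odd_mod_8: "odd (a::int) \<Longrightarrow> a mod 8 \<in> {1, 3, 5, 7}"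
  by (simp, presburger)

lemma chi4_mult:
  assumes "odd a" "odd b"
  shows "chi4 (a * b) = chi4 a * chi4 b"
proof -
  have *: "(a * b) mod 4 = (r * s) mod 4" if "a mod 4 = r" "b mod 4 = s" for r s
    using that mod_mult_eq[of a 4 b] by simp
  show ?thesis using odd_mod_4[OF assms(1)] odd_mod_4[OF assms(2)]
    unfolding chi4_def insert_iff empty_iff by (elim disjE) (simp_all add: *)
qed

lemma chi8_mult:
  assumes "odd a" "odd b"
  shows "chi8 (a * b) = chi8 a * chi8 b"
proof -
  have *: "(a * b) mod 8 = (r * s) mod 8" if "a mod 8 = r" "b mod 8 = s" for r s
    using that mod_mult_eq[of a 8 b] by simp
  show ?thesis using odd_mod_8[OF assms(1)] odd_mod_8[OF assms(2)]
    unfolding chi8_def insert_iff empty_iff by (elim disjE) (simp_all add: *)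
qed

lemma Legendre_minus_one:
  assumes "prime p" "2 < p"
  shows "Legendre (-1) (int p) = chi4 (int p)"
proof (rule Legendre_eqI[OF assms])
  have "odd p" using assms prime_odd_nat by blast
  then have "(-1::int) ^ ((p - 1) div 2) = chi4 (int p)"
    unfolding chi4_def minus_one_power_iff by (auto; presburger)
  then show "[chi4 (int p) = Legendre (-1) (int p)] (mod int p)"
    using cong_sym[OF euler_criterion[OF assms, of "-1"]] by simp
qed (auto simp: chi4_def)

lemma card_even_Ioc:
  fixes u v :: nat
  shows "card {x. u < x \<and> x \<le> v \<and> even x} = v div 2 - u div 2"
proof -
  have "{x. u < x \<and> x \<le> v \<and> even x} = (\<lambda>i. 2 * i) ` {u div 2<..v div 2}"
    by (auto elim!: evenE intro!: imageI)
  then show ?thesis by (simp add: card_image inj_on_def)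
qed

text \<open>By Gauss's lemma the symbol is the parity of the number of even integers in
\<open>((p-1)/2, p-1]\<close>.\<close>

lemma Legendre_two:
  assumes "prime p" "2 < p"
  shows "Legendre 2 (int p) = chi8 (int p)"
proof -
  have p: "odd p" using assms prime_odd_nat by blast
  have G: "GAUSS p 2"
  proof (rule GAUSS.intro)
    show "\<not> [2 = 0] (mod int p)"
      using assms zdvd_imp_le[of "int p" 2] unfolding cong_0_iff by linarith
  qed (rule assms, rule assms, rule zero_less_numeral)
  note G_defs = GAUSS.E_def[OF G] GAUSS.C_def[OF G] GAUSS.B_def[OF G] GAUSS.A_def[OF G]
  have "GAUSS.E p 2 = int ` {x. (p - 1) div 2 < x \<and> x \<le> p - 1 \<and> even x}"
  proof (intro subset_antisym subsetI)
    fix y assume "y \<in> GAUSS.E p 2"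
    then obtain x where x: "0 < x" "x \<le> (int p - 1) div 2" "y = (x * 2) mod int p" "(int p - 1) div 2 < y"
      by (auto simp: G_defs)
    have "y = x * 2" using x p by auto
    then have "y = int (nat y)" "even (nat y)" "(p - 1) div 2 < nat y" "nat y \<le> p - 1"
      using x p by (auto simp: even_nat_iff)
    then show "y \<in> int ` {x. (p - 1) div 2 < x \<and> x \<le> p - 1 \<and> even x}" by blast
  next
    fix y assume "y \<in> int ` {x. (p - 1) div 2 < x \<and> x \<le> p - 1 \<and> even x}"
    then obtain x where x: "y = int x" "(p - 1) div 2 < x" "x \<le> p - 1" "even x" by auto
    then obtain z where z: "x = 2 * z" by auto
    have "int z \<in> GAUSS.A p" using x z p by (auto simp: G_defs)
    moreover have "y = (int z * 2) mod int p" using x z p assms by (auto simp: zmod_int)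
    ultimately show "y \<in> GAUSS.E p 2" using x p by (auto simp: G_defs)
  qed
  then have "card (GAUSS.E p 2) = card {x. (p - 1) div 2 < x \<and> x \<le> p - 1 \<and> even x}"
    by (simp only: card_image[OF inj_on_of_nat])
  also have "\<dots> = (p - 1) div 2 - (p - 1) div 2 div 2"
    by (rule card_even_Ioc)
  finally have "card (GAUSS.E p 2) = (p - 1) div 2 - (p - 1) div 2 div 2" .
  moreover have "Legendre 2 (int p) = (-1) ^ card (GAUSS.E p 2)" by (rule GAUSS.gauss_lemma[OF G])
  ultimately have L: "Legendre 2 (int p) = (-1) ^ ((p - 1) div 2 - (p - 1) div 2 div 2)" by simp
  define r k where "r = p mod 8" and "k = p div 8"
  have pk: "p = 8 * k + r" by (simp add: r_def k_def)
  have "r < 8" "odd r" using p by (auto simp: r_def dvd_mod_iff)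
  then have "r = 1 \<or> r = 3 \<or> r = 5 \<or> r = 7" by presburger
  moreover have "int p mod 8 = int r" by (simp add: r_def zmod_int)
  ultimately have "even ((p - 1) div 2 - (p - 1) div 2 div 2) \<longleftrightarrow> int p mod 8 \<in> {1, 7}"
    by (elim disjE) (simp_all add: pk, presburger+)
  then show ?thesis unfolding L chi8_def by auto
qed

text \<open>Passing from \<open>q\<close> to \<open>\<plusminus>q\<close> congruent to 1 modulo 4 absorbs the sign of the reciprocity law.  In this
form both sides are multiplicative in \<open>q\<close>, so the law extends to composite moduli, and it
also holds for \<open>p = q\<close>, where both sides vanish.\<close>

lemma Legendre_reciprocity:
  assumes "prime p" "2 < p" "prime q" "2 < q"
  shows "Legendre (chi4 (int q) * int q) (int p) = Legendre (int p) (int q)"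
proof (cases "p = q")
  case True
  then show ?thesis by (simp add: Legendre_def cong_0_iff)
next
  case False
  have op: "odd p" and oq: "odd q" using assms prime_odd_nat by blast+
  have nz: "Legendre (int q) (int p) \<noteq> 0"
    using False assms by (auto simp: Legendre_def cong_0_iff primes_dvd_imp_eq)
  have sq: "Legendre (int q) (int p) * Legendre (int q) (int p) = 1"
    using nz Legendre_range[of "int q" "int p"] by auto
  have QR: "Legendre (int p) (int q) * Legendre (int q) (int p) = (-1) ^ ((p - 1) div 2 * ((q - 1) div 2))"
    by (rule Quadratic_Reciprocity) (use assms False in auto)
  have "Legendre (chi4 (int q)) (int p) = (-1) ^ ((p - 1) div 2 * ((q - 1) div 2))"
  proof (cases "int q mod 4 = 1")
    case True
    then have "even ((q - 1) div 2)" using oq by presburger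
    moreover have "Legendre 1 (int p) = 1"
      using assms by (simp add: Legendre_one)
    ultimately show ?thesis using True by (simp add: chi4_def)
  next
    case False
    then have "odd ((q - 1) div 2)" using oq by presburger
    moreover have "even ((p - 1) div 2) \<longleftrightarrow> int p mod 4 = 1" using op by presburger
    ultimately show ?thesis using False Legendre_minus_one[OF assms(1,2)]
      by (auto simp: chi4_def minus_one_power_iff)
  qed
  then have "Legendre (chi4 (int q) * int q) (int p)
      = Legendre (int p) (int q) * (Legendre (int q) (int p) * Legendre (int q) (int p))"
    using QR Legendre_mult[OF assms(1,2)] by (simp add: ac_simps)
  then show ?thesis by (simp add: sq)
qed

text \<open>The step from the prime factors of an odd modulus to the modulus itself.\<close>

lemma prod_mset_mult_odd:
  fixes s :: "int \<Rightarrow> int"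
  assumes "\<And>a b. odd a \<Longrightarrow> odd b \<Longrightarrow> s (a * b) = s a * s b" "s 1 = 1"
    and "\<forall>q\<in>#M. odd q"
  shows "(\<Prod>q\<in>#M. s q) = s (\<Prod>\<^sub># M)"
proof -
  have "odd (\<Prod>\<^sub># M) \<and> (\<Prod>q\<in>#M. s q) = s (\<Prod>\<^sub># M)"
    using assms(3) by (induction M) (auto simp: assms(1,2))
  then show ?thesis ..
qed

lemma odd_prime_factors:
  fixes N :: int
  assumes "q \<in># prime_factorization N" "odd N"
  obtains p where "q = int p" "prime p" "2 < p"
proof -
  have "prime q" "q dvd N" using assms by auto
  then have "odd q" using assms(2) dvd_trans by blast
  then have "q \<noteq> 2" by auto
  then have "2 < q" using prime_ge_2_int[OF \<open>prime q\<close>] by linarith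
  then have "q = int (nat q)" "2 < nat q" by linarith+
  moreover have "prime (nat q)" using \<open>prime q\<close> prime_int_nat_transfer[of q] by blast
  ultimately show ?thesis using that by blast
qed

lemma Jacobi_conv_prod:
  assumes "odd N" and "\<And>p. prime p \<Longrightarrow> 2 < p \<Longrightarrow> Legendre a (int p) = s (int p)"
  shows "Jacobi a N = (\<Prod>q\<in>#prime_factorization N. s q)"
  unfolding Jacobi_def
  by (intro arg_cong[of _ _ prod_mset] image_mset_cong)
     (erule odd_prime_factors[OF _ assms(1)], simp add: assms(2))

context
  fixes N :: int
  assumes N_odd: "odd N" and N_pos: "0 < N"
begin

lemma Jacobi_mult: "Jacobi (a * b) N = Jacobi a N * Jacobi b N"
proof -
  have "Jacobi (a * b) N = (\<Prod>q\<in>#prime_factorization N. Legendre a q * Legendre b q)"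
    by (rule Jacobi_conv_prod[OF N_odd]) (rule Legendre_mult)
  then show ?thesis by (simp add: Jacobi_def prod_mset.distrib)
qed

lemma Jacobi_cong:
  assumes "[a = b] (mod N)"
  shows "Jacobi a N = Jacobi b N"
  unfolding Jacobi_def
  by (intro arg_cong[of _ _ prod_mset] image_mset_cong Legendre_cong)
     (use assms in \<open>auto intro: cong_dvd_modulus\<close>)

lemma Jacobi_one: "Jacobi 1 N = 1"
proof -
  have "Jacobi 1 N = (\<Prod>q\<in>#prime_factorization N. 1)"
    by (rule Jacobi_conv_prod[OF N_odd]) (rule Legendre_one, simp)
  then show ?thesis by simp
qed

lemma Jacobi_range: "Jacobi a N \<in> {-1, 0, 1}"
proof -
  have "(\<Prod>q\<in>#M. Legendre a q) \<in> {-1, 0, 1}" for M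
  proof (induction M)
    case (add x M)
    then show ?case using Legendre_range[of a x] by auto
  qed auto
  then show ?thesis by (simp add: Jacobi_def)
qed

lemma Jacobi_eq_0_iff: "Jacobi a N = 0 \<longleftrightarrow> \<not> coprime a N"
proof -
  have "Jacobi a N = 0 \<longleftrightarrow> (\<exists>q\<in>prime_factors N. q dvd a)"
    by (auto simp: Jacobi_def prod_mset_zero_iff Legendre_def cong_0_iff)
  also have "\<dots> \<longleftrightarrow> \<not> coprime a N"
  proof
    assume "\<exists>q\<in>prime_factors N. q dvd a"
    then obtain q where "prime q" "q dvd N" "q dvd a" by auto
    then show "\<not> coprime a N" by (meson coprime_common_divisor not_prime_unit)
  next
    assume "\<not> coprime a N"
    then have "\<not> is_unit (gcd a N)" by (simp add: coprime_iff_gcd_eq_1)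
    moreover have "gcd a N \<noteq> 0" using N_pos by simp
    ultimately obtain q where "prime q" "q dvd gcd a N"
      using prime_divisor_exists by blast
    then show "\<exists>q\<in>prime_factors N. q dvd a"
      using N_pos by (auto simp: prime_factors_dvd)
  qed
  finally show ?thesis .
qed

lemma Jacobi_sgn:
  assumes "\<And>p. prime p \<Longrightarrow> 2 < p \<Longrightarrow> Legendre a (int p) = s (int p)"
    and "\<And>a b. odd a \<Longrightarrow> odd b \<Longrightarrow> s (a * b) = s a * s b" "s 1 = 1"
  shows "Jacobi a N = s N"
proof -
  have odd: "\<forall>q\<in>#prime_factorization N. odd q"
    by (auto elim!: odd_prime_factors[OF _ N_odd] dest: prime_odd_nat)
  have "Jacobi a N = (\<Prod>q\<in>#prime_factorization N. s q)"
    by (rule Jacobi_conv_prod[OF N_odd assms(1)])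
  also have "\<dots> = s (\<Prod>\<^sub># (prime_factorization N))"
    by (rule prod_mset_mult_odd[OF assms(2,3) odd])
  also have "\<Prod>\<^sub># (prime_factorization N) = N"
    using N_pos by (simp add: prod_mset_prime_factorization)
  finally show ?thesis .
qed

lemma Jacobi_minus_one: "Jacobi (-1) N = chi4 N"
  by (rule Jacobi_sgn) (auto simp: Legendre_minus_one chi4_mult, simp add: chi4_def)

lemma Jacobi_two: "Jacobi 2 N = chi8 N"
  by (rule Jacobi_sgn) (auto simp: Legendre_two chi8_mult, simp add: chi8_def)

lemma Jacobi_reciprocity:
  assumes "prime p" "2 < p"
  shows "Jacobi (int p) N = Legendre (chi4 N * N) (int p)"
proof -
  define s where "s q = Legendre (chi4 q * q) (int p)" for q
  have mult: "s (a * b) = s a * s b" if "odd a" "odd b" for a b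
  proof -
    have "chi4 (a * b) * (a * b) = (chi4 a * a) * (chi4 b * b)"
      using that by (simp add: chi4_mult)
    then show ?thesis unfolding s_def using Legendre_mult[OF assms] by metis
  qed
  have one: "s 1 = 1"
    using assms by (simp add: s_def chi4_def Legendre_one)
  have "Jacobi (int p) N = s N"
    by (rule Jacobi_sgn[OF _ mult one]) (use assms in \<open>simp add: s_def Legendre_reciprocity\<close>)
  then show ?thesis by (simp add: s_def)
qed

end

section \<open>Counting ideals by norm\<close>

text \<open>The polynomial \<open>b\<^sup>2 + b + m\<close> is the norm of \<open>b + \<omega>\<close> in the quadratic order of discriminant
\<open>1 - 4 m\<close>.  Its roots modulo \<open>a\<close> correspond to the ideals of norm \<open>a\<close> that are not divisible by an
integer greater than 1.\<close>

definition quad_roots :: "nat \<Rightarrow> nat \<Rightarrow> nat set" where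
  "quad_roots m a = {b. b < a \<and> a dvd b\<^sup>2 + b + m}"

definition rho :: "nat \<Rightarrow> nat \<Rightarrow> int" where
  "rho m a = int (card (quad_roots m a))"

definition dirichlet :: "(nat \<Rightarrow> int) \<Rightarrow> (nat \<Rightarrow> int) \<Rightarrow> nat \<Rightarrow> int" where
  "dirichlet f g n = (\<Sum>d | d dvd n. f d * g (n div d))"

definition multiplicative :: "(nat \<Rightarrow> int) \<Rightarrow> bool" where
  "multiplicative f \<longleftrightarrow> f 1 = 1 \<and> (\<forall>a b. 0 < a \<longrightarrow> 0 < b \<longrightarrow> coprime a b \<longrightarrow> f (a * b) = f a * f b)"

lemma bij_betw_divisors_coprime:
  fixes a b :: nat
  assumes "coprime a b" "0 < a" "0 < b"
  shows "bij_betw (\<lambda>(d, e). d * e) ({d. d dvd a} \<times> {e. e dvd b}) {d. d dvd a * b}"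
  unfolding bij_betw_def
proof
  have g: "gcd (d * e) a = d" if "d dvd a" "e dvd b" for d e
  proof -
    have "coprime e a" using assms(1) that(2) by (meson coprime_commute coprime_divisors dvd_refl)
    then have "gcd (d * e) a = gcd d a" by (intro gcd_mult_left_right_cancel) (simp add: coprime_commute)
    then show ?thesis using that(1) by simp
  qed
  show "inj_on (\<lambda>(d, e). d * e) ({d. d dvd a} \<times> {e. e dvd b})"
  proof (rule inj_onI, clarsimp)
    fix d e d' e' assume *: "d dvd a" "e dvd b" "d' dvd a" "e' dvd b" "d * e = d' * e'"
    then have "d = d'" using g by metis
    moreover have "d \<noteq> 0" using * assms by auto
    ultimately show "d = d' \<and> e = e'" using * by simp
  qed
  show "(\<lambda>(d, e). d * e) ` ({d. d dvd a} \<times> {e. e dvd b}) = {d. d dvd a * b}"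
  proof (intro subset_antisym subsetI)
    fix x assume "x \<in> {d. d dvd a * b}"
    then obtain d e where "x = d * e" "d dvd a" "e dvd b" using division_decomp by blast
    then show "x \<in> (\<lambda>(d, e). d * e) ` ({d. d dvd a} \<times> {e. e dvd b})"
      by (intro image_eqI[of _ _ "(d, e)"]) auto
  qed (auto intro: mult_dvd_mono)
qed

lemma multiplicative_dirichlet:
  assumes f: "multiplicative f" and g: "multiplicative g"
  shows "multiplicative (dirichlet f g)"
  unfolding multiplicative_def
proof (intro conjI allI impI)
  show "dirichlet f g 1 = 1" using f g by (simp add: dirichlet_def multiplicative_def)
  fix a b :: nat assume ab: "0 < a" "0 < b" "coprime a b"
  have "dirichlet f g (a * b)
      = (\<Sum>(d, e)\<in>{d. d dvd a} \<times> {e. e dvd b}. f (d * e) * g (a * b div (d * e)))"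
    unfolding dirichlet_def
    by (subst sum.reindex_bij_betw[OF bij_betw_divisors_coprime[OF ab(3,1,2)], symmetric])
       (simp add: case_prod_beta)
  also have "\<dots> = (\<Sum>(d, e)\<in>{d. d dvd a} \<times> {e. e dvd b}. (f d * g (a div d)) * (f e * g (b div e)))"
  proof (intro sum.cong refl, clarsimp)
    fix d e assume de: "d dvd a" "e dvd b"
    then have pos: "0 < d" "0 < e" "0 < a div d" "0 < b div e"
      using ab by (auto simp: dvd_div_eq_0_iff intro!: Nat.gr0I)
    have "coprime d e" using ab(3) de by (rule coprime_divisors[rotated 2])
    then have "f (d * e) = f d * f e" using f pos by (simp add: multiplicative_def)
    moreover have "a div d dvd a" "b div e dvd b" using de by (auto simp: dvd_def)
    then have "coprime (a div d) (b div e)" using ab(3) by (rule coprime_divisors)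
    then have "g (a div d * (b div e)) = g (a div d) * g (b div e)" using g pos by (simp add: multiplicative_def)
    moreover have "a * b div (d * e) = a div d * (b div e)" using de by (simp add: div_mult_div_if_dvd)
    ultimately show "f (d * e) * g (a * b div (d * e)) = f d * g (a div d) * (f e * g (b div e))" by simp
  qed
  also have "\<dots> = dirichlet f g a * dirichlet f g b"
    unfolding dirichlet_def sum_product sum.cartesian_product ..
  finally show "dirichlet f g (a * b) = dirichlet f g a * dirichlet f g b" .
qed

lemma dirichlet_prime_power:
  assumes "prime p"
  shows "dirichlet f g (p ^ k) = (\<Sum>i\<le>k. f (p ^ i) * g (p ^ (k - i)))"
proof -
  have "inj_on (\<lambda>i. p ^ i) {..k}"
    using prime_gt_1_nat[OF assms] by (auto simp: inj_on_def)
  moreover have "{d. d dvd p ^ k} = (\<lambda>i. p ^ i) ` {..k}"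
    using divides_primepow_nat[OF assms] by auto
  ultimately have "dirichlet f g (p ^ k) = (\<Sum>i\<le>k. f (p ^ i) * g (p ^ k div p ^ i))"
    unfolding dirichlet_def by (simp add: sum.reindex)
  also have "\<dots> = (\<Sum>i\<le>k. f (p ^ i) * g (p ^ (k - i)))"
    using prime_gt_0_nat[OF assms] by (intro sum.cong refl) (simp add: power_diff)
  finally show ?thesis .
qed

text \<open>By induction on \<open>n\<close>, splitting off the full power of one prime divisor.\<close>

lemma multiplicative_eqI:
  assumes f: "multiplicative f" and g: "multiplicative g"
    and eq: "\<And>p k. prime p \<Longrightarrow> 0 < k \<Longrightarrow> f (p ^ k) = g (p ^ k)"
    and "0 < n"
  shows "f n = g n"
  using \<open>0 < n\<close>
proof (induction n rule: less_induct)
  case (less n)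
  show ?case
  proof (cases "n = 1")
    case True
    then show ?thesis using f g by (simp add: multiplicative_def)
  next
    case False
    then obtain p where p: "prime p" "p dvd n" using prime_factor_nat by blast
    define k where "k = multiplicity p n"
    obtain l where l: "n = p ^ k * l" "\<not> p dvd l"
      using multiplicity_decompose'[of n p] less.prems p unfolding k_def by (metis not_prime_unit gr_implies_not_zero)
    have k: "0 < k" using l p by (cases k) auto
    have pos: "0 < l" "0 < p ^ k" using l less.prems by (auto intro!: Nat.gr0I)
    have "1 < p ^ k" using one_less_power[OF prime_gt_1_nat[OF p(1)] k] .
    then have "l < n" using l pos by simp
    then have "f l = g l" using less.IH pos by blast
    moreover have "coprime (p ^ k) l" using l p by (simp add: prime_imp_coprime)
    ultimately show ?thesis
      using f g pos eq[OF p(1) k] unfolding l(1) multiplicative_def by simp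
  qed
qed

text \<open>Chinese remainder theorem.\<close>

lemma multiplicative_rho: "multiplicative (rho m)"
  unfolding multiplicative_def
proof (intro conjI allI impI)
  have "quad_roots m 1 = {0}" by (auto simp: quad_roots_def)
  then show "rho m 1 = 1" by (simp add: rho_def)
  fix a b :: nat assume ab: "0 < a" "0 < b" "coprime a b"
  have mod: "c dvd (x mod c)\<^sup>2 + x mod c + m \<longleftrightarrow> c dvd x\<^sup>2 + x + m" for c x :: nat
  proof -
    have "[(x mod c)\<^sup>2 + x mod c + m = x\<^sup>2 + x + m] (mod c)"
      by (intro cong_add cong_pow) (simp_all add: Cong.cong_def)
    then show ?thesis by (rule cong_dvd_iff)
  qed
  have "bij_betw (\<lambda>x. (x mod a, x mod b)) (quad_roots m (a * b)) (quad_roots m a \<times> quad_roots m b)"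
    unfolding bij_betw_def
  proof
    show "inj_on (\<lambda>x. (x mod a, x mod b)) (quad_roots m (a * b))"
    proof (rule inj_onI)
      fix x y assume xy: "x \<in> quad_roots m (a * b)" "y \<in> quad_roots m (a * b)"
        "(x mod a, x mod b) = (y mod a, y mod b)"
      then have "[x = y] (mod a * b)"
        using ab(3) by (intro coprime_cong_mult_nat) (simp_all add: Cong.cong_def)
      then show "x = y" using xy by (simp add: Cong.cong_def quad_roots_def)
    qed
    show "(\<lambda>x. (x mod a, x mod b)) ` quad_roots m (a * b) = quad_roots m a \<times> quad_roots m b"
    proof (intro Set.set_eqI iffI)
      fix y assume "y \<in> (\<lambda>x. (x mod a, x mod b)) ` quad_roots m (a * b)"
      then obtain x where x: "x < a * b" "a * b dvd x\<^sup>2 + x + m" "y = (x mod a, x mod b)"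
        by (auto simp: quad_roots_def)
      have "a dvd x\<^sup>2 + x + m" "b dvd x\<^sup>2 + x + m"
        using x(2) dvd_mult_left dvd_mult_right by blast+
      then show "y \<in> quad_roots m a \<times> quad_roots m b"
        using ab x(3) by (simp add: quad_roots_def mod)
    next
      fix y assume "y \<in> quad_roots m a \<times> quad_roots m b"
      then obtain u v where uv: "y = (u, v)" "u < a" "a dvd u\<^sup>2 + u + m" "v < b" "b dvd v\<^sup>2 + v + m"
        by (auto simp: quad_roots_def)
      obtain x where x: "x < a * b" "[x = u] (mod a)" "[x = v] (mod b)"
        using binary_chinese_remainder_unique_nat[OF ab(3)] ab by blast
      have xm: "x mod a = u" "x mod b = v" using x uv by (auto simp: Cong.cong_def)
      have "a dvd x\<^sup>2 + x + m" "b dvd x\<^sup>2 + x + m"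
        using uv mod[of a x] mod[of b x] xm by simp_all
      then have "a * b dvd x\<^sup>2 + x + m" using ab(3) by (rule divides_mult)
      then show "y \<in> (\<lambda>x. (x mod a, x mod b)) ` quad_roots m (a * b)"
        using x(1) xm uv(1) by (intro image_eqI[of _ _ x]) (auto simp: quad_roots_def)
    qed
  qed
  then have "card (quad_roots m (a * b)) = card (quad_roots m a \<times> quad_roots m b)"
    by (rule bij_betw_same_card)
  then show "rho m (a * b) = rho m a * rho m b" by (simp add: rho_def card_cartesian_product)
qed

lemma quad_roots_int: "q dvd b\<^sup>2 + b + m \<longleftrightarrow> int q dvd (int b)\<^sup>2 + int b + int m"
  by (metis int_dvd_int_iff of_nat_add of_nat_power)

text \<open>Modulo an odd prime, \<open>b\<close> is a root exactly if \<open>2 b + 1\<close> is a square root of the discriminant.\<close>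

lemma quad_complete_square:
  "4 * ((x::int)\<^sup>2 + x + m) = (2 * x + 1)\<^sup>2 - (1 - 4 * m)"
  by (simp add: power2_eq_square algebra_simps)

lemma quad_root_simple:
  assumes "int p dvd x\<^sup>2 + x + int m" "\<not> int p dvd 1 - 4 * int m"
  shows "\<not> int p dvd 2 * x + 1"
proof
  assume "int p dvd 2 * x + 1"
  then have "int p dvd (2 * x + 1)\<^sup>2" by (simp add: power2_eq_square)
  then have "int p dvd (2 * x + 1)\<^sup>2 - 4 * (x\<^sup>2 + x + int m)"
    using assms(1) by (intro dvd_diff dvd_mult)
  then show False using assms(2) by (simp only: quad_complete_square) simp
qed

text \<open>If \<open>b\<close> and \<open>b0\<close> are roots, then \<open>p ^ k\<close> divides \<open>(b - b0) (b + b0 + 1)\<close>.  The prime \<open>p\<close> cannot divide both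
factors, since it would divide \<open>2 b0 + 1\<close> and hence the discriminant.  So \<open>b0\<close> and \<open>-1 - b0\<close> are the
only roots.\<close>

lemma quad_roots_prime_power:
  assumes p: "prime p" and k: "0 < k" and D: "\<not> int p dvd 1 - 4 * int m"
    and b0: "b0 \<in> quad_roots m (p ^ k)"
  shows "card (quad_roots m (p ^ k)) = 2"
proof -
  let ?q = "p ^ k"
  have b0': "b0 < ?q" "int ?q dvd (int b0)\<^sup>2 + int b0 + int m"
    using b0 by (auto simp: quad_roots_def quad_roots_int simp del: of_nat_power)
  have pq: "int p dvd int ?q" using k by simp
  have np: "\<not> int p dvd 2 * int b0 + 1"
    using quad_root_simple[OF dvd_trans[OF pq b0'(2)] D] .
  have "b0 \<noteq> ?q - 1 - b0"
  proof
    assume "b0 = ?q - 1 - b0"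
    then have "2 * int b0 + 1 = int ?q" using b0'(1) by linarith
    then show False using np pq by simp
  qed
  moreover have "quad_roots m ?q = {b0, ?q - 1 - b0}"
  proof (intro Set.set_eqI iffI)
    fix b assume "b \<in> quad_roots m ?q"
    then have b: "b < ?q" "int ?q dvd (int b)\<^sup>2 + int b + int m"
      by (auto simp: quad_roots_def quad_roots_int simp del: of_nat_power)
    have "int ?q dvd ((int b)\<^sup>2 + int b + int m) - ((int b0)\<^sup>2 + int b0 + int m)"
      using b(2) b0'(2) by (rule dvd_diff)
    also have "((int b)\<^sup>2 + int b + int m) - ((int b0)\<^sup>2 + int b0 + int m)
        = (int b - int b0) * (int b + int b0 + 1)"
      by (simp add: power2_eq_square algebra_simps)
    finally have d: "int p ^ k dvd (int b - int b0) * (int b + int b0 + 1)" by simp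
    have pp: "prime (int p)" using p by simp
    show "b \<in> {b0, ?q - 1 - b0}"
    proof (cases "int p dvd int b - int b0")
      case True
      have "\<not> int p dvd int b + int b0 + 1"
      proof
        assume "int p dvd int b + int b0 + 1"
        then have "int p dvd (int b + int b0 + 1) - (int b - int b0)" using True by (rule dvd_diff)
        then show False using np by simp
      qed
      then have "coprime (int p ^ k) (int b + int b0 + 1)"
        using pp by (simp add: prime_imp_coprime)
      then have "int ?q dvd int b - int b0" using d by (simp add: coprime_dvd_mult_left_iff)
      then have "int b = int b0" using b(1) b0'(1)
        by (metis cong_iff_dvd_diff cong_less_imp_eq_int of_nat_0_le_iff of_nat_less_iff)
      then show ?thesis by simp
    next
      case False
      then have "coprime (int p ^ k) (int b - int b0)"
        using pp by (simp add: prime_imp_coprime)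
      then have "int ?q dvd int b + int b0 + 1" using d by (simp add: coprime_dvd_mult_right_iff)
      then have "?q dvd b + b0 + 1" by (metis int_dvd_int_iff of_nat_1 of_nat_add)
      then obtain c where c: "b + b0 + 1 = ?q * c" by (auto simp: dvd_def)
      have "?q * c < ?q * 2" using c b(1) b0'(1) by linarith
      then have "c < 2" by simp
      moreover have "c \<noteq> 0" using c by (cases c) auto
      ultimately have "c = 1" by simp
      then have "b + b0 + 1 = ?q" using c by simp
      then have "b = ?q - 1 - b0" by linarith
      then show ?thesis by simp
    qed
  next
    fix b assume "b \<in> {b0, ?q - 1 - b0}"
    moreover have "?q - 1 - b0 \<in> quad_roots m ?q"
    proof -
      have e: "int (?q - 1 - b0) = int ?q - 1 - int b0" using b0'(1) by simp
      have "(int (?q - 1 - b0))\<^sup>2 + int (?q - 1 - b0) + int m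
          = int ?q * (int ?q - 1 - 2 * int b0) + ((int b0)\<^sup>2 + int b0 + int m)"
        unfolding e by (simp add: power2_eq_square algebra_simps)
      then have "int ?q dvd (int (?q - 1 - b0))\<^sup>2 + int (?q - 1 - b0) + int m"
        using b0'(2) by (metis dvd_add dvd_triv_left)
      then show ?thesis using b0'(1) unfolding quad_roots_def quad_roots_int mem_Collect_eq by linarith
    qed
    ultimately show "b \<in> quad_roots m ?q" using b0 by auto
  qed
  ultimately show ?thesis by simp
qed

lemma quad_roots_mod:
  assumes "0 < q" "int q dvd x\<^sup>2 + x + int m"
  shows "nat (x mod int q) \<in> quad_roots m q"
proof -
  have "[(x mod int q)\<^sup>2 + x mod int q + int m = x\<^sup>2 + x + int m] (mod int q)"
    by (intro cong_add cong_pow) (simp_all add: Cong.cong_def)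
  then have "int q dvd (x mod int q)\<^sup>2 + x mod int q + int m" using assms(2) by (simp add: cong_dvd_iff)
  moreover have "0 \<le> x mod int q" "x mod int q < int q" using assms(1) by simp_all
  ultimately show ?thesis unfolding quad_roots_def quad_roots_int by (simp add: nat_less_iff)
qed

text \<open>Hensel lifting: the derivative \<open>2 b + 1\<close> is invertible at a root, because its square is the
discriminant modulo \<open>p\<close>.\<close>

lemma quad_roots_hensel:
  assumes p: "prime p" and k: "0 < k" and D: "\<not> int p dvd 1 - 4 * int m"
  shows "quad_roots m (p ^ k) \<noteq> {} \<longleftrightarrow> quad_roots m p \<noteq> {}"
  using k
proof (induction k rule: nat_induct_non_zero)
  case (Suc k)
  have pos: "0 < p" using p by (simp add: prime_gt_0_nat)
  have "quad_roots m (p ^ Suc k) \<noteq> {} \<longleftrightarrow> quad_roots m (p ^ k) \<noteq> {}"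
  proof
    assume "quad_roots m (p ^ Suc k) \<noteq> {}"
    then obtain b where "p ^ Suc k dvd b\<^sup>2 + b + m" by (auto simp: quad_roots_def)
    then have "p ^ k dvd b\<^sup>2 + b + m" by (meson dvd_trans le_imp_power_dvd lessI less_imp_le)
    then have "int (p ^ k) dvd (int b)\<^sup>2 + int b + int m" by (simp only: quad_roots_int)
    from quad_roots_mod[OF _ this] pos show "quad_roots m (p ^ k) \<noteq> {}" by auto
  next
    assume "quad_roots m (p ^ k) \<noteq> {}"
    then obtain b where "p ^ k dvd b\<^sup>2 + b + m" by (auto simp: quad_roots_def)
    then have "int (p ^ k) dvd (int b)\<^sup>2 + int b + int m" by (simp only: quad_roots_int)
    then obtain c where c: "(int b)\<^sup>2 + int b + int m = int p ^ k * c" by (auto simp: dvd_def)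
    have "int p dvd (int b)\<^sup>2 + int b + int m"
      unfolding c using Suc.hyps by simp
    then have "\<not> int p dvd 2 * int b + 1" using D by (rule quad_root_simple)
    then have "coprime (2 * int b + 1) (int p)"
      using p by (simp add: prime_imp_coprime coprime_commute)
    then obtain t where t: "[(2 * int b + 1) * t = 1] (mod int p)"
      using cong_solve_coprime_int by blast
    \<comment> \<open>Newton step: \<open>t\<close> inverts the derivative modulo \<open>p\<close>\<close>
    define s where "s = - c * t"
    have "int p dvd c + (2 * int b + 1) * s"
    proof -
      have "int p dvd (- c) * ((2 * int b + 1) * t - 1)"
        using t by (intro dvd_mult) (simp add: cong_iff_dvd_diff)
      then show ?thesis by (simp add: s_def algebra_simps)
    qed
    then have "int p dvd c + (2 * int b + 1) * s + int p ^ k * s\<^sup>2"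
      using Suc.hyps by (intro dvd_add[of _ "c + (2 * int b + 1) * s"]) auto
    then have "int p ^ k * int p dvd int p ^ k * (c + (2 * int b + 1) * s + int p ^ k * s\<^sup>2)"
      by (rule mult_dvd_mono[OF dvd_refl])
    also have "int p ^ k * (c + (2 * int b + 1) * s + int p ^ k * s\<^sup>2)
        = int p ^ k * c + (int p ^ k * ((2 * int b + 1) * s) + int p ^ k * int p ^ k * s\<^sup>2)"
      by (simp add: algebra_simps)
    also have "\<dots> = (int b + int p ^ k * s)\<^sup>2 + (int b + int p ^ k * s) + int m"
      unfolding c[symmetric] by (simp add: power2_eq_square algebra_simps)
    finally have "int (p ^ Suc k) dvd (int b + int p ^ k * s)\<^sup>2 + (int b + int p ^ k * s) + int m"
      by (simp add: mult.commute)
    from quad_roots_mod[OF _ this] pos show "quad_roots m (p ^ Suc k) \<noteq> {}" by auto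
  qed
  then show ?case using Suc.IH by simp
qed simp

text \<open>At a prime dividing the discriminant the root is double: \<open>4 (b\<^sup>2 + b + m)\<close> is congruent to
\<open>(2 b + 1)\<^sup>2\<close>.\<close>

lemma quad_roots_ramified:
  assumes p: "prime p" and D: "int p dvd 1 - 4 * int m"
  shows "quad_roots m p = {(p - 1) div 2}"
proof -
  have odd: "odd p"
  proof
    assume "even p"
    then have "2 dvd int p" by simp
    then have "2 dvd 1 - 4 * int m" using D dvd_trans by blast
    then show False by presburger
  qed
  have "p dvd b\<^sup>2 + b + m \<longleftrightarrow> p dvd 2 * b + 1" for b
  proof -
    \<comment> \<open>\<open>p\<close> is odd, so the factor 4 may be inserted\<close>
    have "coprime (int p) 4"
    proof -
      have "coprime (int p) 2" using odd by simp
      then have "coprime (int p) (2 * 2)" by (simp only: coprime_mult_right_iff)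
      then show ?thesis by simp
    qed
    then have "int p dvd (int b)\<^sup>2 + int b + int m \<longleftrightarrow> int p dvd 4 * ((int b)\<^sup>2 + int b + int m)"
      by (rule coprime_dvd_mult_right_iff[symmetric])
    also have "\<dots> \<longleftrightarrow> int p dvd (2 * int b + 1)\<^sup>2"
      unfolding quad_complete_square using D by (simp add: dvd_diff_left_iff dvd_diff_right_iff)
    also have "\<dots> \<longleftrightarrow> int p dvd 2 * int b + 1"
      using p by (simp add: prime_dvd_power_iff)
    also have "\<dots> \<longleftrightarrow> p dvd 2 * b + 1"
    proof -
      have "2 * int b + 1 = int (2 * b + 1)" by simp
      then show ?thesis by (simp only: int_dvd_int_iff)
    qed
    finally show ?thesis by (simp only: quad_roots_int)
  qed
  moreover have "p dvd 2 * b + 1 \<longleftrightarrow> b = (p - 1) div 2" if "b < p" for b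
  proof
    assume "p dvd 2 * b + 1"
    then obtain c where c: "2 * b + 1 = p * c" by (auto simp: dvd_def)
    have "p * c < p * 2" using c that by linarith
    then have "c < 2" by simp
    moreover have "c \<noteq> 0" using c by (cases c) auto
    ultimately have "c = 1" by simp
    then show "b = (p - 1) div 2" using c by simp
  next
    assume "b = (p - 1) div 2"
    then have "2 * b + 1 = p" using odd by presburger
    then show "p dvd 2 * b + 1" by simp
  qed
  moreover have "(p - 1) div 2 < p" using prime_gt_0_nat[OF p] by simp
  ultimately show ?thesis unfolding quad_roots_def by auto
qed

text \<open>The triple \<open>(k, a, b)\<close> stands for the ideal \<open>k (\<int> a + \<int> (b + \<omega>))\<close>, whose norm is \<open>k\<^sup>2 a\<close>.  Each nonzero
ideal is described by exactly one triple (\<open>int_ideal_structure\<close> and \<open>ideal_of_inj\<close> below).\<close>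

definition triples :: "nat \<Rightarrow> (nat \<times> nat \<times> nat) set" where
  "triples m = {(k, a, b). 0 < k \<and> 0 < a \<and> b \<in> quad_roots m a}"

definition triple_norm :: "nat \<times> nat \<times> nat \<Rightarrow> nat" where
  "triple_norm = (\<lambda>(k, a, b). k\<^sup>2 * a)"

text \<open>The character \<open>X\<close> records how a prime decomposes: it is 0, 1, or -1 according to whether
the polynomial has a double root, two roots, or no root modulo the prime.\<close>

locale splitting_character =
  fixes m :: nat and X :: "nat \<Rightarrow> int"
  assumes squarefree_disc: "squarefree (1 - 4 * int m)"
    and X_1: "X 1 = 1" and X_mult: "X (a * b) = X a * X b"
    and X_ramified: "prime p \<Longrightarrow> int p dvd 1 - 4 * int m \<Longrightarrow> X p = 0"
    and X_unramified: "prime p \<Longrightarrow> \<not> int p dvd 1 - 4 * int m \<Longrightarrow>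
                       X p = (if quad_roots m p = {} then -1 else 1)"
begin

lemma X_power: "X (p ^ k) = X p ^ k"
  using X_1 by (induction k) (simp_all add: X_mult)

text \<open>In the ramified case the right-hand side is 1 for \<open>k = 0\<close> and 0 otherwise; there are no roots
modulo \<open>p\<^sup>2\<close> because \<open>p\<^sup>2\<close> would divide the discriminant.\<close>

lemma rho_prime_power:
  assumes p: "prime p"
  shows "rho m (p ^ Suc k) = X p ^ Suc k + X p ^ k"
proof (cases "int p dvd 1 - 4 * int m")
  case True
  have pp: "prime (int p)" using p by simp
  have "quad_roots m (p ^ Suc k) = {}" if "0 < k"
  proof (rule ccontr)
    assume "quad_roots m (p ^ Suc k) \<noteq> {}"
    then obtain b where b: "p ^ Suc k dvd b\<^sup>2 + b + m" by (auto simp: quad_roots_def)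
    have "p ^ 2 dvd p ^ Suc k" using that by (intro le_imp_power_dvd) simp
    then have "p ^ 2 dvd b\<^sup>2 + b + m" using b dvd_trans by blast
    then have sq: "int p ^ 2 dvd (int b)\<^sup>2 + int b + int m"
      unfolding quad_roots_int by simp
    then have "int p dvd 4 * ((int b)\<^sup>2 + int b + int m)"
      by (meson dvd_mult dvd_trans dvd_power zero_less_numeral)
    then have "int p dvd 4 * ((int b)\<^sup>2 + int b + int m) + (1 - 4 * int m)"
      using True by (rule dvd_add)
    then have "int p dvd (2 * int b + 1)\<^sup>2" unfolding quad_complete_square by simp
    then have "int p dvd 2 * int b + 1" using pp by (simp add: prime_dvd_power_iff)
    then have "int p ^ 2 dvd (2 * int b + 1)\<^sup>2" by (rule dvd_power_same)
    then have "int p ^ 2 dvd (2 * int b + 1)\<^sup>2 - 4 * ((int b)\<^sup>2 + int b + int m)"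
      using sq by (intro dvd_diff dvd_mult)
    then have "int p ^ 2 dvd 1 - 4 * int m" unfolding quad_complete_square by simp
    then have "is_unit (int p)" using squarefree_disc unfolding squarefree_def by blast
    then show False using pp not_prime_unit by blast
  qed
  moreover have "rho m (p ^ Suc 0) = 1"
    using quad_roots_ramified[OF p True] by (simp add: rho_def)
  moreover have "X p = 0" by (rule X_ramified[OF p True])
  ultimately show ?thesis by (cases "k = 0") (simp_all add: rho_def)
next
  case False
  show ?thesis
  proof (cases "quad_roots m p = {}")
    case True
    then have "quad_roots m (p ^ Suc k) = {}" using quad_roots_hensel[OF p zero_less_Suc False] by blast
    then show ?thesis using X_unramified[OF p False] True by (simp add: rho_def)
  next
    case F: False
    then obtain b where "b \<in> quad_roots m (p ^ Suc k)"
      using quad_roots_hensel[OF p zero_less_Suc False] by blast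
    then have "card (quad_roots m (p ^ Suc k)) = 2"
      by (rule quad_roots_prime_power[OF p zero_less_Suc False])
    then show ?thesis using X_unramified[OF p False] F by (simp add: rho_def)
  qed
qed

definition square_ind :: "nat \<Rightarrow> int" where
  "square_ind n = (if is_nth_power 2 n then 1 else 0)"

lemma multiplicative_square_ind: "multiplicative square_ind"
  unfolding multiplicative_def square_ind_def
  by (auto simp: is_nth_power_mult_coprime_nat_iff)

lemma multiplicative_X: "multiplicative X"
  using X_1 X_mult by (simp add: multiplicative_def)

lemma multiplicative_one: "multiplicative (\<lambda>_. 1)"
  by (simp add: multiplicative_def)

text \<open>Both sides grow by \<open>X p ^ (k+1) + X p ^ (k+2)\<close> when \<open>k\<close> increases by 2, so it suffices to
compare them for \<open>k = 0\<close> and \<open>k = 1\<close>.\<close>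

lemma dirichlet_square_rho_prime_power:
  assumes p: "prime p"
  shows "dirichlet square_ind (rho m) (p ^ k) = dirichlet X (\<lambda>_. 1) (p ^ k)"
proof -
  have sq: "square_ind (p ^ i) = (if even i then 1 else 0)" for i
    using is_nth_power_prime_power_nat_iff[OF p, of 2 i] by (simp add: square_ind_def)
  define S where "S k = (\<Sum>i\<le>k. square_ind (p ^ i) * rho m (p ^ (k - i)))" for k
  have rho0: "rho m 1 = 1" using multiplicative_rho by (simp add: multiplicative_def)
  have "S k = (\<Sum>i\<le>k. X p ^ i) \<and> S (Suc k) = (\<Sum>i\<le>Suc k. X p ^ i)"
  proof (induction k)
    case 0
    show ?case using rho0 rho_prime_power[OF p, of 0] sq[of 0] sq[of 1] by (simp add: S_def)
  next
    case (Suc k)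
    have "S (Suc (Suc k)) = rho m (p ^ Suc (Suc k)) + S k"
      unfolding S_def by (subst sum.atMost_Suc_shift, subst sum.atMost_Suc_shift)
         (simp add: sq sq[of 0, simplified] sq[of 1, simplified] del: power_Suc)
    then show ?case using Suc rho_prime_power[OF p, of "Suc k"] by simp
  qed
  then show ?thesis by (simp add: dirichlet_prime_power[OF p] S_def X_power)
qed

lemma dirichlet_square_rho:
  assumes "0 < n"
  shows "dirichlet square_ind (rho m) n = dirichlet X (\<lambda>_. 1) n"
proof (rule multiplicative_eqI)
  show "multiplicative (dirichlet square_ind (rho m))"
    by (intro multiplicative_dirichlet multiplicative_square_ind multiplicative_rho)
  show "multiplicative (dirichlet X (\<lambda>_. 1))"
    by (intro multiplicative_dirichlet multiplicative_X multiplicative_one)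
qed (simp_all add: dirichlet_square_rho_prime_power assms)

text \<open>An ideal of norm \<open>n\<close> is an integer \<open>k\<close> times an ideal of norm \<open>n / k\<^sup>2\<close> without integer factors, so
the count is the Dirichlet convolution of \<open>rho m\<close> with the indicator of the squares.\<close>

lemma card_triples:
  assumes n: "0 < n"
  shows "finite {\<tau>\<in>triples m. triple_norm \<tau> = n}"
    and "int (card {\<tau>\<in>triples m. triple_norm \<tau> = n}) = (\<Sum>d | d dvd n. X d)"
proof -
  let ?S = "SIGMA d:{d. d dvd n \<and> is_nth_power 2 d}. quad_roots m (n div d)"
  have bij: "bij_betw (\<lambda>(k, a, b). (k\<^sup>2, b)) {\<tau>\<in>triples m. triple_norm \<tau> = n} ?S"
    unfolding bij_betw_def
  proof
    show "inj_on (\<lambda>(k, a, b). (k\<^sup>2, b)) {\<tau>\<in>triples m. triple_norm \<tau> = n}"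
      by (auto simp: inj_on_def triples_def triple_norm_def)
    show "(\<lambda>(k, a, b). (k\<^sup>2, b)) ` {\<tau>\<in>triples m. triple_norm \<tau> = n} = ?S"
    proof (intro subset_antisym subsetI)
      fix y assume "y \<in> (\<lambda>(k, a, b). (k\<^sup>2, b)) ` {\<tau>\<in>triples m. triple_norm \<tau> = n}"
      then obtain k a b where "y = (k\<^sup>2, b)" "0 < k" "b \<in> quad_roots m a" "k\<^sup>2 * a = n"
        by (auto simp: triples_def triple_norm_def)
      moreover from this have "n div k\<^sup>2 = a" by auto
      ultimately show "y \<in> ?S" by auto
    next
      fix y assume "y \<in> ?S"
      then obtain k b where y: "y = (k\<^sup>2, b)" "k\<^sup>2 dvd n" "b \<in> quad_roots m (n div k\<^sup>2)"
        by (auto elim!: is_nth_powerE)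
      have e: "k\<^sup>2 * (n div k\<^sup>2) = n" using y(2) by simp
      have "(k, n div k\<^sup>2, b) \<in> {\<tau>\<in>triples m. triple_norm \<tau> = n}"
        using y n e by (auto simp: triples_def triple_norm_def intro!: Nat.gr0I)
      then show "y \<in> (\<lambda>(k, a, b). (k\<^sup>2, b)) ` {\<tau>\<in>triples m. triple_norm \<tau> = n}"
        using y(1) by (intro image_eqI) auto
    qed
  qed
  have fin1: "finite {d. d dvd n \<and> is_nth_power 2 d}" using n by (auto intro: finite_subset[of _ "{d. d dvd n}"])
  have fin2: "finite (quad_roots m a)" for a by (simp add: quad_roots_def)
  have "finite ?S" using fin1 fin2 by blast
  then show "finite {\<tau>\<in>triples m. triple_norm \<tau> = n}" using bij bij_betw_finite by blast
  have "int (card {\<tau>\<in>triples m. triple_norm \<tau> = n}) = int (card ?S)"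
    using bij_betw_same_card[OF bij] by simp
  also have "\<dots> = (\<Sum>d | d dvd n \<and> is_nth_power 2 d. rho m (n div d))"
    using fin1 fin2 by (simp add: card_SigmaI rho_def)
  also have "\<dots> = dirichlet square_ind (rho m) n"
    unfolding dirichlet_def square_ind_def using n
    by (intro sum.mono_neutral_cong_left) auto
  also have "\<dots> = (\<Sum>d | d dvd n. X d)"
    using dirichlet_square_rho[OF n] by (simp add: dirichlet_def)
  finally show "int (card {\<tau>\<in>triples m. triple_norm \<tau> = n}) = (\<Sum>d | d dvd n. X d)" .
qed

end

section \<open>The constant term of a planar theta series\<close>

lemma lattice_norm_lower_bound:
  fixes u v :: complex
  assumes "Im (cnj u * v) \<noteq> 0"
  shows "\<exists>c>0. \<forall>x y. c * (\<bar>x\<bar> + \<bar>y\<bar>) \<le> cmod (of_real x * u + of_real y * v)"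
proof -
  define d where "d = \<bar>Im (cnj u * v)\<bar>"
  define S where "S = cmod u + cmod v"
  have "u \<noteq> 0" using assms by auto
  then have S: "0 < S" by (simp add: S_def add_pos_nonneg)
  have d: "0 < d" using assms by (simp add: d_def)
  have "d / S * (\<bar>x\<bar> + \<bar>y\<bar>) \<le> cmod (of_real x * u + of_real y * v)" for x y
  proof -
    define w where "w = of_real x * u + of_real y * v"
    have "Im (cnj u * w) = y * Im (cnj u * v)" by (simp add: w_def algebra_simps)
    then have "\<bar>y\<bar> * d \<le> cmod u * cmod w"
      using abs_Im_le_cmod[of "cnj u * w"] by (simp add: d_def abs_mult norm_mult)
    moreover have "Im (cnj v * w) = - x * Im (cnj u * v)" by (simp add: w_def algebra_simps)
    then have "\<bar>x\<bar> * d \<le> cmod v * cmod w"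
      using abs_Im_le_cmod[of "cnj v * w"] by (simp add: d_def abs_mult norm_mult)
    ultimately have "d * (\<bar>x\<bar> + \<bar>y\<bar>) \<le> S * cmod w"
      by (simp add: S_def algebra_simps)
    then have "d * (\<bar>x\<bar> + \<bar>y\<bar>) \<le> S * cmod (of_real x * u + of_real y * v)" by (simp only: w_def)
    then show ?thesis using S by (simp add: field_simps)
  qed
  then show ?thesis using d S by (intro exI[of _ "d / S"]) simp
qed

definition gauss :: "complex \<Rightarrow> complex \<Rightarrow> real \<Rightarrow> real \<Rightarrow> real" where
  "gauss u v x y = exp (- (cmod (of_real x * u + of_real y * v))\<^sup>2)"

text \<open>A Gaussian decays faster than any exponential of the coordinates, also after
multiplication by a power of the distance; third powers suffice for third derivatives.
Exponential majorants have the advantage that their lattice sums are geometric series.\<close>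

lemma gauss_bounds:
  assumes "Im (cnj u * v) \<noteq> 0"
  obtains C where "\<And>x y. gauss u v x y \<le> C * exp (- (\<bar>x\<bar> + \<bar>y\<bar>))" and "0 < C"
    "\<And>x y k. k \<le> 3 \<Longrightarrow> (cmod (of_real x * u + of_real y * v)) ^ k * gauss u v x y
        \<le> C * exp (- (\<bar>x\<bar> + \<bar>y\<bar>))"
proof -
  obtain c where c: "0 < c" "\<And>x y. c * (\<bar>x\<bar> + \<bar>y\<bar>) \<le> cmod (of_real x * u + of_real y * v)"
    using lattice_norm_lower_bound[OF assms] by blast
  \<comment> \<open>the maximum of \<open>P (3 + 1 / c) - P\<^sup>2\<close>, where \<open>P\<close> is the distance from the origin\<close>
  define K where "K = (3 + 1 / c)\<^sup>2 / 4"
  have bound: "(cmod (of_real x * u + of_real y * v)) ^ k * gauss u v x y \<le> exp K * exp (- (\<bar>x\<bar> + \<bar>y\<bar>))"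
    if "k \<le> 3" for x y k
  proof -
    define P where "P = cmod (of_real x * u + of_real y * v)"
    have P: "0 \<le> P" "\<bar>x\<bar> + \<bar>y\<bar> \<le> P / c"
      using c(1) c(2)[of x y] by (simp_all add: P_def field_simps)
    have "P \<le> exp P" using exp_ge_add_one_self[of P] by linarith
    then have "P ^ k \<le> exp P ^ k" using P(1) by (rule power_mono)
    also have "\<dots> \<le> exp P ^ 3" using P(1) that by (intro power_increasing) simp_all
    also have "\<dots> = exp (3 * P)" by (simp add: exp_of_nat_mult[symmetric])
    finally have "P ^ k * gauss u v x y \<le> exp (3 * P) * exp (- P\<^sup>2)"
      unfolding gauss_def P_def[symmetric] by (intro mult_right_mono) simp_all
    also have "\<dots> = exp (3 * P - P\<^sup>2)" by (simp add: exp_add[symmetric])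
    also have "\<dots> \<le> exp (K - P / c)"
    proof -
      have "0 \<le> (P - (3 + 1 / c) / 2)\<^sup>2" by simp
      then have "P * (3 + 1 / c) \<le> P\<^sup>2 + K"
        by (simp add: K_def power2_eq_square field_simps)
      then show ?thesis by (simp add: field_simps)
    qed
    also have "\<dots> \<le> exp (K - (\<bar>x\<bar> + \<bar>y\<bar>))" using P(2) by simp
    also have "\<dots> = exp K * exp (- (\<bar>x\<bar> + \<bar>y\<bar>))" by (simp add: exp_add[symmetric])
    finally show ?thesis by (simp add: P_def)
  qed
  from bound[of 0] have "gauss u v x y \<le> exp K * exp (- (\<bar>x\<bar> + \<bar>y\<bar>))" for x y by simp
  from that[OF this _ bound] show ?thesis by simp
qed

definition third_diff :: "(real \<Rightarrow> real) \<Rightarrow> real \<Rightarrow> real \<Rightarrow> real" where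
  "third_diff f s x = f x - 3 * f (x + s) + 3 * f (x + 2 * s) - f (x + 3 * s)"

text \<open>The mean value theorem, applied three times.\<close>

lemma third_difference:
  fixes f :: "real \<Rightarrow> real"
  assumes s: "0 < s"
    and 1: "\<And>x. (f has_real_derivative f1 x) (at x)"
    and 2: "\<And>x. (f1 has_real_derivative f2 x) (at x)"
    and 3: "\<And>x. (f2 has_real_derivative f3 x) (at x)"
  obtains z where "a \<le> z" "z \<le> a + 3 * s"
    "third_diff f s a = - (s ^ 3) * f3 z"
proof -
  have d: "((\<lambda>x. g (x + c)) has_real_derivative g' (x + c)) (at x)"
    if "\<And>x. (g has_real_derivative g' x) (at x)" for g g' c x
    using DERIV_shift that by blast
  have "\<exists>z. a < z \<and> z < a + s \<and>
      (f (a + s) - 2 * f (a + s + s) + f (a + s + 2 * s)) - (f a - 2 * f (a + s) + f (a + 2 * s))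
        = (a + s - a) * (f1 z - 2 * f1 (z + s) + f1 (z + 2 * s))"
    by (rule MVT2) (use s in \<open>auto intro!: derivative_eq_intros d[OF 1] 1\<close>)
  then obtain z1 where z1: "a < z1" "z1 < a + s"
      "(f (a + s) - 2 * f (a + s + s) + f (a + s + 2 * s)) - (f a - 2 * f (a + s) + f (a + 2 * s))
        = s * (f1 z1 - 2 * f1 (z1 + s) + f1 (z1 + 2 * s))" by auto
  have "\<exists>z. z1 < z \<and> z < z1 + s \<and>
      (f1 (z1 + s) - f1 (z1 + s + s)) - (f1 z1 - f1 (z1 + s)) = (z1 + s - z1) * (f2 z - f2 (z + s))"
    by (rule MVT2) (use s in \<open>auto intro!: derivative_eq_intros d[OF 2] 2\<close>)
  then obtain z2 where z2: "z1 < z2" "z2 < z1 + s"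
      "(f1 (z1 + s) - f1 (z1 + s + s)) - (f1 z1 - f1 (z1 + s)) = s * (f2 z2 - f2 (z2 + s))" by auto
  have "\<exists>z. z2 < z \<and> z < z2 + s \<and> f2 (z2 + s) - f2 z2 = (z2 + s - z2) * f3 z"
    by (rule MVT2) (use s 3 in auto)
  then obtain z3 where z3: "z2 < z3" "z3 < z2 + s" "f2 (z2 + s) - f2 z2 = s * f3 z3" by auto
  show ?thesis
  proof (rule that)
    show "a \<le> z3" "z3 \<le> a + 3 * s" using z1 z2 z3 by linarith+
    have e: "f1 z1 - 2 * f1 (z1 + s) + f1 (z1 + 2 * s) = - (s * (f2 z2 - f2 (z2 + s)))"
      using z2(3) by (simp add: algebra_simps)
    have e2: "f2 z2 - f2 (z2 + s) = - (s * f3 z3)" using z3(3) by simp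
    have "f (a + s + s) = f (a + 2 * s)" "f (a + s + 2 * s) = f (a + 3 * s)"
      by (rule arg_cong[where f = f], simp)+
    then have "third_diff f s a
        = - ((f (a + s) - 2 * f (a + s + s) + f (a + s + 2 * s)) - (f a - 2 * f (a + s) + f (a + 2 * s)))"
      unfolding third_diff_def by linarith
    also have "\<dots> = - (s ^ 3) * f3 z3"
      unfolding z1(3) e e2 by (simp add: power3_eq_cube)
    finally show "third_diff f s a = - (s ^ 3) * f3 z3" .
  qed
qed

text \<open>The third derivative of \<open>exp (- Q)\<close> for a quadratic \<open>Q\<close> is \<open>(3 Q' Q'' - Q' ^ 3) exp (- Q)\<close>, and \<open>\<bar>Q'\<bar>\<close> is at most
\<open>2 \<bar>u\<bar>\<close> times the distance of the point from the origin.\<close>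

lemma gauss_third_difference:
  assumes "Im (cnj u * v) \<noteq> 0"
  obtains C where "0 < C" "\<And>s x y. 0 < s \<Longrightarrow> s \<le> 1 \<Longrightarrow>
     \<bar>third_diff (\<lambda>x. gauss u v x y) s x\<bar>
       \<le> C * s ^ 3 * exp (- (\<bar>x\<bar> + \<bar>y\<bar>))"
proof -
  obtain C where C: "0 < C" "\<And>x y k. k \<le> 3 \<Longrightarrow> (cmod (of_real x * u + of_real y * v)) ^ k * gauss u v x y
        \<le> C * exp (- (\<bar>x\<bar> + \<bar>y\<bar>))"
    using gauss_bounds[OF assms] by metis
  define U where "U = cmod u"
  define C' where "C' = (8 * U ^ 3 + 12 * U ^ 3) * C * exp 3"
  have U0: "0 < U" using assms by (auto simp: U_def)
  have main: "\<bar>third_diff (\<lambda>x. gauss u v x y) s x\<bar>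
       \<le> C' * s ^ 3 * exp (- (\<bar>x\<bar> + \<bar>y\<bar>))" if s: "0 < s" "s \<le> 1" for s x y
  proof -
    define b where "b = Re (cnj u * v) * y"
    define Q where "Q x = (cmod (of_real x * u + of_real y * v))\<^sup>2" for x :: real
    define h where "h x = 2 * U\<^sup>2 * x + 2 * b" for x
    have Q: "Q x = U\<^sup>2 * x\<^sup>2 + 2 * b * x + (cmod v)\<^sup>2 * y\<^sup>2" for x
      unfolding Q_def U_def b_def cmod_power2 by (simp add: algebra_simps power2_eq_square)
    have dQ: "(Q has_real_derivative h x) (at x)" for x
      unfolding Q[abs_def] h_def by (auto intro!: derivative_eq_intros)
    have dh: "(h has_real_derivative 2 * U\<^sup>2) (at x)" for x
      unfolding h_def by (auto intro!: derivative_eq_intros)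
    have G: "gauss u v x y = exp (- Q x)" for x by (simp add: gauss_def Q_def)
    define f where "f x = exp (- Q x)" for x
    have df: "(f has_real_derivative - h x * f x) (at x)" for x
      unfolding f_def by (auto intro!: derivative_eq_intros dQ)
    have df1: "((\<lambda>x. - h x * f x) has_real_derivative ((h x)\<^sup>2 - 2 * U\<^sup>2) * f x) (at x)" for x
      by (auto intro!: derivative_eq_intros dh df simp: power2_eq_square algebra_simps)
    have df2: "((\<lambda>x. ((h x)\<^sup>2 - 2 * U\<^sup>2) * f x) has_real_derivative
        (6 * U\<^sup>2 * h x - (h x) ^ 3) * f x) (at x)" for x
      by (auto intro!: derivative_eq_intros dh df simp: power2_eq_square power3_eq_cube algebra_simps)
    obtain z where z: "x \<le> z" "z \<le> x + 3 * s"
      "third_diff f s x = - (s ^ 3) * ((6 * U\<^sup>2 * h z - (h z) ^ 3) * f z)"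
      using third_difference[OF s(1) df df1 df2] by metis
    define P where "P = cmod (of_real z * u + of_real y * v)"
    have hz: "h z = 2 * Re (cnj u * (of_real z * u + of_real y * v))"
      unfolding h_def b_def U_def cmod_power2 by (simp add: algebra_simps power2_eq_square)
    have "\<bar>Re (cnj u * (of_real z * u + of_real y * v))\<bar> \<le> U * P"
      using abs_Re_le_cmod[of "cnj u * (of_real z * u + of_real y * v)"] by (simp add: U_def P_def norm_mult)
    then have h: "\<bar>h z\<bar> \<le> 2 * U * P" unfolding hz by simp
    then have h3: "\<bar>h z\<bar> ^ 3 \<le> (2 * U * P) ^ 3" by (intro power_mono) simp_all
    have "\<bar>6 * U\<^sup>2 * h z - (h z) ^ 3\<bar> \<le> \<bar>6 * U\<^sup>2 * h z\<bar> + \<bar>(h z) ^ 3\<bar>" by (rule abs_triangle_ineq4)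
    also have "\<dots> = 6 * U\<^sup>2 * \<bar>h z\<bar> + \<bar>h z\<bar> ^ 3" by (simp add: abs_mult power_abs)
    also have "\<dots> \<le> 6 * U\<^sup>2 * (2 * U * P) + (2 * U * P) ^ 3"
      using h h3 by (intro add_mono mult_left_mono) simp_all
    also have "\<dots> = 12 * U ^ 3 * P ^ 1 + 8 * U ^ 3 * P ^ 3"
      by (simp add: power2_eq_square power3_eq_cube)
    finally have "\<bar>6 * U\<^sup>2 * h z - (h z) ^ 3\<bar> * f z \<le> (12 * U ^ 3 * P ^ 1 + 8 * U ^ 3 * P ^ 3) * f z"
      by (rule mult_right_mono) (simp add: f_def)
    also have "\<dots> = 12 * U ^ 3 * (P ^ 1 * f z) + 8 * U ^ 3 * (P ^ 3 * f z)"
      by (simp add: algebra_simps)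
    also have "\<dots> \<le> 12 * U ^ 3 * (C * exp (- (\<bar>z\<bar> + \<bar>y\<bar>))) + 8 * U ^ 3 * (C * exp (- (\<bar>z\<bar> + \<bar>y\<bar>)))"
      using C(2)[of 1 z y] C(2)[of 3 z y] U0 unfolding P_def f_def G by (intro add_mono mult_left_mono) simp_all
    also have "\<dots> = (8 * U ^ 3 + 12 * U ^ 3) * C * exp (- (\<bar>z\<bar> + \<bar>y\<bar>))" by (simp add: algebra_simps)
    also have "\<dots> \<le> (8 * U ^ 3 + 12 * U ^ 3) * C * exp (3 - (\<bar>x\<bar> + \<bar>y\<bar>))"
      using z s C(1) U0 by (intro mult_left_mono) auto
    also have "\<dots> = C' * exp (- (\<bar>x\<bar> + \<bar>y\<bar>))" by (simp add: C'_def exp_add[symmetric])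
    finally have "\<bar>6 * U\<^sup>2 * h z - (h z) ^ 3\<bar> * f z \<le> C' * exp (- (\<bar>x\<bar> + \<bar>y\<bar>))" .
    then have "s ^ 3 * (\<bar>6 * U\<^sup>2 * h z - (h z) ^ 3\<bar> * f z) \<le> s ^ 3 * (C' * exp (- (\<bar>x\<bar> + \<bar>y\<bar>)))"
      using s(1) by (intro mult_left_mono) simp_all
    moreover have "\<bar>third_diff f s x\<bar>
        = s ^ 3 * (\<bar>6 * U\<^sup>2 * h z - (h z) ^ 3\<bar> * f z)"
      unfolding z(3) using s(1) by (simp add: abs_mult f_def)
    moreover have "(\<lambda>x. gauss u v x y) = f" by (simp add: G f_def fun_eq_iff)
    ultimately show ?thesis by (simp add: mult_ac)
  qed
  have "0 < C'" using U0 C(1) by (simp add: C'_def)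
  from that[OF this main] show ?thesis .
qed

lemma has_sum_exp_abs_int:
  assumes s: "0 < s"
  shows "((\<lambda>x::int. exp (- (s * \<bar>real_of_int x\<bar>))) has_sum (1 + exp (-s)) / (1 - exp (-s))) UNIV"
proof -
  define q where "q = exp (-s)"
  have q: "0 < q" "q < 1" using s by (simp_all add: q_def)
  have pow: "q ^ n = exp (- (s * real n))" for n
    by (simp add: q_def exp_of_nat_mult[symmetric] mult.commute)
  have geo: "((\<lambda>n. q ^ n) has_sum 1 / (1 - q)) UNIV"
    using q by (intro sums_nonneg_imp_has_sum geometric_sums) simp_all
  have e1: "q ^ nat x = exp (- (s * \<bar>real_of_int x\<bar>))" if "0 \<le> x" for x
    using that by (simp add: pow)
  have e2: "q * q ^ nat (- x - 1) = exp (- (s * \<bar>real_of_int x\<bar>))" if "x < 0" for x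
  proof -
    have "q * q ^ nat (- x - 1) = q ^ Suc (nat (- x - 1))" by simp
    also have "Suc (nat (- x - 1)) = nat (- x)" using that by simp
    finally show ?thesis using that by (simp only: pow) simp
  qed
  have 1: "((\<lambda>x::int. exp (- (s * \<bar>real_of_int x\<bar>))) has_sum 1 / (1 - q)) {0..}"
    by (subst has_sum_reindex_bij_witness[of _ int nat UNIV "\<lambda>n. q ^ n" _ _ "1 / (1 - q)"])
       (use geo in \<open>simp_all add: e1\<close>)
  have 2: "((\<lambda>x::int. exp (- (s * \<bar>real_of_int x\<bar>))) has_sum q * (1 / (1 - q))) {..<0}"
    by (subst has_sum_reindex_bij_witness[of _ "\<lambda>n. - int n - 1" "\<lambda>x. nat (- x - 1)" UNIV "\<lambda>n. q * q ^ n" _ _ "q * (1 / (1 - q))"])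
       (use has_sum_cmult_right[OF geo, of q] in \<open>simp_all add: e2\<close>)
  have "((\<lambda>x::int. exp (- (s * \<bar>real_of_int x\<bar>))) has_sum (1 / (1 - q) + q * (1 / (1 - q)))) ({0..} \<union> {..<0})"
    by (rule has_sum_Un_disjoint[OF 1 2]) auto
  moreover have "{0..} \<union> {..<0} = (UNIV :: int set)" by auto
  ultimately show ?thesis by (simp add: q_def add_divide_distrib)
qed

lemma exp_neg_lower: "0 < s \<Longrightarrow> s \<le> (1::real) \<Longrightarrow> s / 2 \<le> 1 - exp (- s)"
proof -
  assume s: "0 < s" "s \<le> 1"
  have "exp (-s) * (1 + s) \<le> exp (-s) * exp s"
    by (intro mult_left_mono exp_ge_add_one_self) simp
  then have "exp (-s) \<le> 1 / (1 + s)" using s by (simp add: exp_add[symmetric] field_simps)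
  also have "\<dots> \<le> 1 - s / 2" using s by (simp add: field_simps mult_left_le)
  finally show ?thesis by simp
qed

lemma exp_abs_sum_bound:
  assumes "0 < s" "s \<le> (1::real)"
  shows "(1 + exp (-s)) / (1 - exp (-s)) \<le> 4 / s"
proof -
  have "s / 2 \<le> 1 - exp (-s)" by (rule exp_neg_lower[OF assms])
  moreover have "1 + exp (-s) \<le> 2" using assms by simp
  ultimately have "(1 + exp (-s)) / (1 - exp (-s)) \<le> 2 / (s / 2)"
    using assms by (intro frac_le) simp_all
  then show ?thesis by simp
qed

text \<open>The majorant for the terms of a theta series at scale \<open>s\<close>.\<close>

definition exp_abs :: "real \<Rightarrow> int \<times> int \<Rightarrow> real" where
  "exp_abs s = (\<lambda>(x, y). exp (- (s * \<bar>real_of_int x\<bar> + s * \<bar>real_of_int y\<bar>)))"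

lemma has_sum_exp_abs:
  assumes s: "0 < s"
  shows "(exp_abs s has_sum ((1 + exp (-s)) / (1 - exp (-s)))\<^sup>2) UNIV"
proof -
  define S where "S = (1 + exp (-s)) / (1 - exp (-s))"
  note 1 = has_sum_exp_abs_int[OF s, folded S_def]
  have inner: "((\<lambda>y. exp_abs s (x, y)) has_sum exp (- (s * \<bar>real_of_int x\<bar>)) * S) UNIV" for x
  proof -
    have "exp_abs s (x, y) = exp (- (s * \<bar>real_of_int x\<bar>)) * exp (- (s * \<bar>real_of_int y\<bar>))" for y
      by (simp add: exp_abs_def exp_add[symmetric])
    then show ?thesis using has_sum_cmult_right[OF 1, of "exp (- (s * \<bar>real_of_int x\<bar>))"] by simp
  qed
  have outer: "((\<lambda>x::int. exp (- (s * \<bar>real_of_int x\<bar>)) * S) has_sum S * S) UNIV"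
    using has_sum_cmult_left[OF 1, of S] .
  have "(exp_abs s has_sum S * S) (UNIV \<times> UNIV)"
    by (rule has_sum_SigmaI[OF inner outer], rule summable_on_SigmaI[OF inner])
       (use outer in \<open>auto simp: has_sum_imp_summable exp_abs_def\<close>)
  then show ?thesis by (simp add: S_def power2_eq_square)
qed

definition theta_term :: "complex \<Rightarrow> complex \<Rightarrow> real \<Rightarrow> int \<times> int \<Rightarrow> real" where
  "theta_term u v t = (\<lambda>(x, y). exp (- t * (cmod (of_int x * u + of_int y * v))\<^sup>2))"

text \<open>At parameter \<open>t\<close> the theta series samples a fixed Gaussian on a grid of mesh \<open>sqrt t\<close>.\<close>

lemma theta_term_gauss:
  assumes "0 \<le> t"
  shows "theta_term u v t (x, y) = gauss u v (sqrt t * of_int x) (sqrt t * of_int y)"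
proof -
  have "of_real (sqrt t * of_int x) * u + of_real (sqrt t * of_int y) * v
      = of_real (sqrt t) * (of_int x * u + of_int y * v)"
    by (simp add: algebra_simps)
  then have "(cmod (of_real (sqrt t * of_int x) * u + of_real (sqrt t * of_int y) * v))\<^sup>2
      = t * (cmod (of_int x * u + of_int y * v))\<^sup>2"
    using assms by (simp add: norm_mult power_mult_distrib)
  then show ?thesis by (simp add: theta_term_def gauss_def)
qed

lemma summable_theta_term:
  assumes "Im (cnj u * v) \<noteq> 0" "0 < t"
  shows "theta_term u v t summable_on UNIV"
proof -
  obtain C where C: "\<And>x y. gauss u v x y \<le> C * exp (- (\<bar>x\<bar> + \<bar>y\<bar>))"
    using gauss_bounds[OF assms(1)] by metis
  have "exp_abs (sqrt t) summable_on UNIV"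
    using has_sum_exp_abs[of "sqrt t"] assms(2) has_sum_imp_summable by force
  then have "(\<lambda>z. C * exp_abs (sqrt t) z) summable_on UNIV" by (rule summable_on_cmult_right)
  then show ?thesis
  proof (rule summable_on_comparison_test)
    fix z :: "int \<times> int"
    obtain x y where z: "z = (x, y)" by force
    show "theta_term u v t z \<le> C * exp_abs (sqrt t) z"
      using C[of "sqrt t * of_int x" "sqrt t * of_int y"] assms(2)
      by (simp add: z theta_term_gauss exp_abs_def abs_mult)
  qed (auto simp: theta_term_def)
qed

definition parity :: "int \<Rightarrow> real" where
  "parity x = (if even x then 1 else -1)"

lemma summable_alternating_theta_term:
  assumes "Im (cnj u * v) \<noteq> 0" "0 < t"
  shows "(\<lambda>z. parity (fst z) * theta_term u v t z) summable_on UNIV"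
proof -
  have "(\<lambda>z. norm (parity (fst z) * theta_term u v t z)) = theta_term u v t"
    by (auto simp: parity_def theta_term_def fun_eq_iff)
  then have "(\<lambda>z. norm (parity (fst z) * theta_term u v t z)) summable_on UNIV"
    using summable_theta_term[OF assms] by simp
  then show ?thesis by (rule abs_summable_summable)
qed

definition alternating_theta :: "complex \<Rightarrow> complex \<Rightarrow> real \<Rightarrow> real" where
  "alternating_theta u v t = (\<Sum>\<^sub>\<infinity>z. parity (fst z) * theta_term u v t z)"

text \<open>Shifting the summation variable \<open>x\<close> by one changes the sign of an alternating sum, so the sum
equals one eighth of the alternating sum of third differences.  With mesh \<open>s = sqrt t\<close>, these
are of size \<open>s ^ 3\<close> on about \<open>1 / s\<^sup>2\<close> relevant lattice points.  (Second differences would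
only give a bounded sum.)\<close>

lemma alternating_theta_bound:
  assumes "Im (cnj u * v) \<noteq> 0"
  obtains C where "\<And>t. 0 < t \<Longrightarrow> t \<le> 1 \<Longrightarrow>
    \<bar>alternating_theta u v t\<bar> \<le> C * sqrt t"
proof -
  obtain C where C: "0 < C" "\<And>s x y. 0 < s \<Longrightarrow> s \<le> 1 \<Longrightarrow>
     \<bar>third_diff (\<lambda>x. gauss u v x y) s x\<bar>
       \<le> C * s ^ 3 * exp (- (\<bar>x\<bar> + \<bar>y\<bar>))"
    using gauss_third_difference[OF assms] by metis
  have "\<bar>alternating_theta u v t\<bar> \<le> 2 * C * sqrt t" if t: "0 < t" "t \<le> 1" for t
  proof -
    define s where "s = sqrt t"
    have s: "0 < s" "s \<le> 1" using t by (simp_all add: s_def)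
    define T where "T k z = parity (fst z) * theta_term u v t (fst z + k, snd z)" for k :: int and z :: "int \<times> int"
    define A where "A = alternating_theta u v t"
    note sum0 = summable_alternating_theta_term[OF assms t(1)]
    have T: "(T k has_sum parity k * A) UNIV" for k
    proof -
      have "((\<lambda>z. parity (fst z) * theta_term u v t z) has_sum A) UNIV"
        using sum0 by (simp add: A_def alternating_theta_def has_sum_infsum)
      then have "((\<lambda>z. parity (fst z + k) * theta_term u v t (fst z + k, snd z)) has_sum A) UNIV"
        by (subst has_sum_reindex_bij_witness[of _ "\<lambda>z. (fst z - k, snd z)" "\<lambda>z. (fst z + k, snd z)" UNIV "\<lambda>z. parity (fst z) * theta_term u v t z" _ _ A]) auto
      from has_sum_cmult_right[OF this, of "parity k"] show ?thesis
        by (rule back_subst[of "\<lambda>f. (f has_sum parity k * A) UNIV"]) (auto simp: T_def parity_def fun_eq_iff)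
    qed
    have "((\<lambda>z. T 0 z + (-3) * T 1 z + (3 * T 2 z + (-1) * T 3 z)) has_sum
        (parity 0 * A + (-3) * (parity 1 * A) + (3 * (parity 2 * A) + (-1) * (parity 3 * A)))) UNIV"
      by (intro has_sum_add has_sum_cmult_right T)
    then have D: "((\<lambda>z. T 0 z + (-3) * T 1 z + (3 * T 2 z + (-1) * T 3 z)) has_sum 8 * A) UNIV"
      by (simp add: parity_def)
    define S where "S = (1 + exp (-s)) / (1 - exp (-s))"
    have E: "((\<lambda>z. C * s ^ 3 * exp_abs s z) has_sum C * s ^ 3 * S\<^sup>2) UNIV"
      unfolding S_def by (intro has_sum_cmult_right has_sum_exp_abs s)
    have "norm (8 * A) \<le> C * s ^ 3 * S\<^sup>2"
    proof (rule norm_infsum_le[OF D E])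
      fix z :: "int \<times> int"
      obtain x y where z: "z = (x, y)" by force
      let ?g = "\<lambda>x. gauss u v x (s * of_int y)"
      have th: "theta_term u v t (x + k, y) = ?g (s * of_int x + of_int k * s)" for k
        using t by (simp add: theta_term_gauss s_def algebra_simps)
      have e: "T 0 z + (-3) * T 1 z + (3 * T 2 z + (-1) * T 3 z)
        = parity x * third_diff ?g s (s * of_int x)"
        using th[of 0] th[of 1] th[of 2] th[of 3] by (simp add: T_def z third_diff_def algebra_simps)
      have "norm (T 0 z + (-3) * T 1 z + (3 * T 2 z + (-1) * T 3 z)) = \<bar>third_diff ?g s (s * of_int x)\<bar>"
        unfolding e by (simp add: abs_mult parity_def)
      also have "\<dots> \<le> C * s ^ 3 * exp (- (\<bar>s * of_int x\<bar> + \<bar>s * of_int y\<bar>))"  by (rule C(2)[OF s])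
      also have "\<dots> = C * s ^ 3 * exp_abs s z" using s by (simp add: z exp_abs_def abs_mult)
      finally show "norm (T 0 z + (-3) * T 1 z + (3 * T 2 z + (-1) * T 3 z)) \<le> C * s ^ 3 * exp_abs s z" .
    qed
    also have "\<dots> \<le> C * s ^ 3 * (4 / s)\<^sup>2"
      using exp_abs_sum_bound[OF s] s C(1) unfolding S_def
      by (intro mult_left_mono power_mono divide_nonneg_nonneg) simp_all
    also have "\<dots> = 8 * (2 * C * s)" using s by (simp add: power2_eq_square power3_eq_cube)
    finally show ?thesis by (simp add: A_def s_def)
  qed
  then show ?thesis by (rule that)
qed

lemma alternating_theta_tendsto:
  assumes "Im (cnj u * v) \<noteq> 0"
  shows "((\<lambda>t. alternating_theta u v t) \<longlongrightarrow> 0) (at_right 0)"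
proof -
  obtain C where C: "\<And>t. 0 < t \<Longrightarrow> t \<le> 1 \<Longrightarrow>
    \<bar>alternating_theta u v t\<bar> \<le> C * sqrt t"
    using alternating_theta_bound[OF assms] by metis
  show ?thesis
  proof (rule Lim_null_comparison)
    show "eventually (\<lambda>t. norm (alternating_theta u v t) \<le> C * sqrt t) (at_right 0)"
      using eventually_at_right_less[of 0] eventually_at_right_real[of 0 1]
      by (auto elim!: eventually_mono intro!: C)
    show "((\<lambda>t. C * sqrt t) \<longlongrightarrow> 0) (at_right 0)"
      by (auto intro!: tendsto_eq_intros)
  qed
qed

definition theta :: "complex \<Rightarrow> complex \<Rightarrow> real \<Rightarrow> real" where
  "theta u v t = (\<Sum>\<^sub>\<infinity>z\<in>UNIV - {(0, 0)}. theta_term u v t z)"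

text \<open>The function that is -3 on pairs of even numbers and 1 on all other pairs is minus the sum of
the three nontrivial characters of \<open>(\<int>/2)\<^sup>2\<close>.  Summing it against the Gaussian therefore gives
three alternating sums, the last two after a change of the lattice basis.  The sum over
pairs of even numbers is the full sum at \<open>4 t\<close>, and the zero vector accounts for \<open>1 - 4 = -3\<close>.\<close>

theorem theta_constant_term:
  assumes uv: "Im (cnj u * v) \<noteq> 0"
  shows "((\<lambda>t. theta u v t - 4 * theta u v (4 * t)) \<longlongrightarrow> 3) (at_right 0)"
proof -
  define A where "A = alternating_theta"
  have uv2: "Im (cnj v * u) \<noteq> 0" "Im (cnj u * (v - u)) \<noteq> 0"
    using uv by (simp_all add: algebra_simps)
  have eq: "3 - (A u v t + (A v u t + A u (v - u) t)) = theta u v t - 4 * theta u v (4 * t)" if t: "0 < t" for t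
  proof -
    note sA = summable_alternating_theta_term[OF _ t]
    have A1: "((\<lambda>(x, y). parity x * theta_term u v t (x, y)) has_sum A u v t) UNIV"
      using sA[OF uv] by (simp add: A_def alternating_theta_def has_sum_infsum case_prod_unfold)
    have "((\<lambda>z. parity (fst z) * theta_term v u t z) has_sum A v u t) UNIV"
      using sA[OF uv2(1)] by (simp add: A_def alternating_theta_def has_sum_infsum)
    then have A2: "((\<lambda>(x, y). parity y * theta_term u v t (x, y)) has_sum A v u t) UNIV"
      by (subst has_sum_reindex_bij_witness[of _ prod.swap prod.swap UNIV "\<lambda>z. parity (fst z) * theta_term v u t z" _ _ "A v u t"])
         (auto simp: theta_term_def add.commute)
    have "((\<lambda>z. parity (fst z) * theta_term u (v - u) t z) has_sum A u (v - u) t) UNIV"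
      using sA[OF uv2(2)] by (simp add: A_def alternating_theta_def has_sum_infsum)
    then have A3: "((\<lambda>(x, y). parity (x + y) * theta_term u v t (x, y)) has_sum A u (v - u) t) UNIV"
      by (subst has_sum_reindex_bij_witness[of _ "\<lambda>(x, y). (x - y, y)" "\<lambda>(x, y). (x + y, y)" UNIV "\<lambda>z. parity (fst z) * theta_term u (v - u) t z" _ _ "A u (v - u) t"])
         (auto simp: theta_term_def algebra_simps)
    have B: "(theta_term u v t' has_sum (1 + theta u v t')) UNIV" if t': "0 < t'" for t'
    proof -
      have "theta_term u v t' summable_on (UNIV - {(0, 0)})"
        using summable_theta_term[OF uv t'] by (rule summable_on_subset) simp
      then have "(theta_term u v t' has_sum theta u v t') (UNIV - {(0, 0)})"
        by (simp add: theta_def has_sum_infsum)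
      moreover have "(theta_term u v t' has_sum theta_term u v t' (0, 0)) {(0, 0)}"
        by (rule has_sum_finiteI) simp_all
      ultimately have "(theta_term u v t' has_sum (theta_term u v t' (0, 0) + theta u v t')) ({(0, 0)} \<union> (UNIV - {(0, 0)}))"
        by (intro has_sum_Un_disjoint) auto
      then show ?thesis by (simp add: theta_term_def insert_UNIV)
    qed
    \<comment> \<open>the sublattice of index 4, a copy of the whole lattice scaled by 2\<close>
    let ?ev = "{z :: int \<times> int. even (fst z) \<and> even (snd z)}"
    have "(theta_term u v t has_sum (1 + theta u v (4 * t))) ?ev"
    proof (subst has_sum_reindex_bij_witness[of _ "\<lambda>(x, y). (2 * x, 2 * y)" "\<lambda>(x, y). (x div 2, y div 2)" UNIV "theta_term u v (4 * t)" _ _ "1 + theta u v (4 * t)"])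
      show "(theta_term u v (4 * t) has_sum (1 + theta u v (4 * t))) UNIV" using B t by simp
      have "theta_term u v (4 * t) (x, y) = theta_term u v t (2 * x, 2 * y)" for x y
      proof -
        have "of_int (2 * x) * u + of_int (2 * y) * v = 2 * (of_int x * u + of_int y * v)" by (simp add: algebra_simps)
        then have "(cmod (of_int (2 * x) * u + of_int (2 * y) * v))\<^sup>2 = 4 * (cmod (of_int x * u + of_int y * v))\<^sup>2"
          by (simp only: norm_mult power_mult_distrib) simp
        then show ?thesis unfolding theta_term_def by (simp only: prod.case) simp
      qed
      then show "theta_term u v (4 * t) ((\<lambda>(x, y). (x div 2, y div 2)) a) = theta_term u v t a" if "a \<in> ?ev" for a
        using that by (auto simp: case_prod_unfold)
    qed auto
    then have Ev: "((\<lambda>z. of_bool (z \<in> ?ev) * theta_term u v t z) has_sum (1 + theta u v (4 * t))) UNIV"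
      by (subst has_sum_cong_neutral[where T = ?ev and g = "theta_term u v t"]) auto
    have "((\<lambda>z. theta_term u v t z + (-4) * (of_bool (z \<in> ?ev) * theta_term u v t z)
        + ((case z of (x, y) \<Rightarrow> parity x * theta_term u v t (x, y)) +
          ((case z of (x, y) \<Rightarrow> parity y * theta_term u v t (x, y)) + (case z of (x, y) \<Rightarrow> parity (x + y) * theta_term u v t (x, y)))))
       has_sum ((1 + theta u v t) + (-4) * (1 + theta u v (4 * t)) + (A u v t + (A v u t + A u (v - u) t)))) UNIV"
      by (intro has_sum_add has_sum_cmult_right B t Ev A1 A2 A3)
    moreover have "theta_term u v t z + (-4) * (of_bool (z \<in> ?ev) * theta_term u v t z)
        + ((case z of (x, y) \<Rightarrow> parity x * theta_term u v t (x, y)) +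
          ((case z of (x, y) \<Rightarrow> parity y * theta_term u v t (x, y)) + (case z of (x, y) \<Rightarrow> parity (x + y) * theta_term u v t (x, y)))) = 0" for z
      by (cases z) (auto simp: parity_def)
    ultimately have "((\<lambda>_. 0) has_sum ((1 + theta u v t) + (-4) * (1 + theta u v (4 * t)) + (A u v t + (A v u t + A u (v - u) t)))) (UNIV :: (int \<times> int) set)"
      by simp
    then have "(1 + theta u v t) + (-4) * (1 + theta u v (4 * t)) + (A u v t + (A v u t + A u (v - u) t)) = 0"
      using has_sum_unique has_sum_0_simp by blast
    then show ?thesis by simp
  qed
  have "((\<lambda>t. 3 - (A u v t + (A v u t + A u (v - u) t))) \<longlongrightarrow> 3 - (0 + (0 + 0))) (at_right 0)"
    unfolding A_def by (intro tendsto_intros alternating_theta_tendsto uv uv2)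
  moreover have "eventually (\<lambda>t. 3 - (A u v t + (A v u t + A u (v - u) t)) = theta u v t - 4 * theta u v (4 * t)) (at_right 0)"
    using eventually_at_right_less[of 0] by (rule eventually_mono) (rule eq)
  ultimately show ?thesis by (simp add: tendsto_cong)
qed

section \<open>The constant term of the Lambert series\<close>

text \<open>The function \<open>1 / (exp x + 1)\<close>, known as the Fermi function, arises from
\<open>1 / (exp x - 1)\<close> by removing the pole: see \<open>ideal_sum_fermi\<close>.\<close>

definition fermi :: "real \<Rightarrow> real" where
  "fermi x = 1 / (exp x + 1)"

lemma fermi_range: "0 < fermi x" "fermi x < 1"
  unfolding fermi_def using exp_gt_zero[of x] by (simp_all add: field_simps add_pos_pos)

lemma fermi_le: "fermi x \<le> exp (- x)"
proof -
  have "1 / (exp x + 1) \<le> 1 / exp x" by (intro frac_le) simp_all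
  then show ?thesis by (simp add: fermi_def exp_minus inverse_eq_divide)
qed

definition fermi' :: "real \<Rightarrow> real" where
  "fermi' x = - fermi x * (1 - fermi x)"

lemma fermi_deriv: "(fermi has_real_derivative fermi' x) (at x)"
proof -
  have "exp x + 1 \<noteq> 0" using exp_gt_zero[of x] by linarith
  then show ?thesis unfolding fermi'_def fermi_def[abs_def]
    by (auto intro!: derivative_eq_intros simp: field_simps power2_eq_square)
qed

lemma fermi_deriv2:
  "(fermi' has_real_derivative fermi x * (1 - fermi x) * (1 - 2 * fermi x)) (at x)"
  unfolding fermi'_def[abs_def]
  by (auto intro!: derivative_eq_intros fermi_deriv simp: fermi'_def algebra_simps)

text \<open>The second derivative of \<open>fermi\<close> at \<open>z\<close> is bounded by \<open>exp (- z)\<close>.\<close>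

lemma fermi_deriv_lipschitz:
  assumes "a \<le> x" "x \<le> a + w" "a \<le> y" "y \<le> a + w"
  shows "\<bar>fermi' x - fermi' y\<bar> \<le> w * exp (- a)"
proof -
  have *: "\<bar>fermi' x - fermi' y\<bar> \<le> w * exp (- a)"
    if "x < y" "a \<le> x" "y \<le> a + w" for x y
  proof -
    have "\<exists>z. x < z \<and> z < y \<and> fermi' y - fermi' x
        = (y - x) * (fermi z * (1 - fermi z) * (1 - 2 * fermi z))"
      by (rule MVT2[OF that(1)]) (rule fermi_deriv2)
    then obtain z where z: "x < z" "z < y"
      "fermi' y - fermi' x = (y - x) * (fermi z * (1 - fermi z) * (1 - 2 * fermi z))"
      by blast
    have "\<bar>fermi z * (1 - fermi z) * (1 - 2 * fermi z)\<bar> = fermi z * (1 - fermi z) * \<bar>1 - 2 * fermi z\<bar>"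
      using fermi_range[of z] by (simp add: abs_mult)
    also have "\<dots> \<le> fermi z * 1 * 1"
      using fermi_range[of z] by (intro mult_mono) auto
    also have "\<dots> \<le> exp (- z)" using fermi_le[of z] by simp
    also have "\<dots> \<le> exp (- a)" using z that by simp
    finally have "(y - x) * \<bar>fermi z * (1 - fermi z) * (1 - 2 * fermi z)\<bar> \<le> w * exp (- a)"
      using that by (intro mult_mono) auto
    moreover have "\<bar>fermi' x - fermi' y\<bar> = (y - x) * \<bar>fermi z * (1 - fermi z) * (1 - 2 * fermi z)\<bar>"
      unfolding abs_minus_commute[of "fermi' x"] z(3) abs_mult[of "y - x"] using that(1) by simp
    ultimately show ?thesis by (simp only:)
  qed
  consider "x < y" | "x = y" | "y < x" by linarith
  then show ?thesis
  proof cases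
    case 1 then show ?thesis using *[of x y] assms by blast
  next
    case 2 then show ?thesis using assms by simp
  next
    case 3 then show ?thesis using *[of y x] assms by (simp add: abs_minus_commute)
  qed
qed

lemma fermi_interpolation:
  assumes l: "0 \<le> l" "l \<le> 1" and w: "0 < w"
  shows "\<bar>fermi (a + l * w) - ((1 - l) * fermi a + l * fermi (a + w))\<bar> \<le> w\<^sup>2 * exp (- a)"
proof (cases "l = 0")
  case False
  then have l0: "0 < l * w" using l w by simp
  have lw: "l * w \<le> w" using l w by (simp add: mult_left_le_one_le)
  have "\<exists>z. a < z \<and> z < a + l * w \<and> fermi (a + l * w) - fermi a = (a + l * w - a) * fermi' z"
    by (rule MVT2[OF _ fermi_deriv]) (use l0 in simp)
  then obtain z1 where z1: "a < z1" "z1 < a + l * w" "fermi (a + l * w) - fermi a = l * w * fermi' z1"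
    unfolding add_diff_cancel_left' by blast
  have "\<exists>z. a < z \<and> z < a + w \<and> fermi (a + w) - fermi a = (a + w - a) * fermi' z"
    by (rule MVT2[OF _ fermi_deriv]) (use w in simp)
  then obtain z2 where z2: "a < z2" "z2 < a + w" "fermi (a + w) - fermi a = w * fermi' z2"
    unfolding add_diff_cancel_left' by blast
  have "fermi (a + l * w) - ((1 - l) * fermi a + l * fermi (a + w))
      = (fermi (a + l * w) - fermi a) - l * (fermi (a + w) - fermi a)" by (simp add: algebra_simps)
  also have "\<dots> = (l * w) * (fermi' z1 - fermi' z2)"
    unfolding z1(3) z2(3) by (simp add: algebra_simps)
  finally have e: "fermi (a + l * w) - ((1 - l) * fermi a + l * fermi (a + w)) = \<dots>" .
  have "\<bar>(l * w) * (fermi' z1 - fermi' z2)\<bar>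
      = (l * w) * \<bar>fermi' z1 - fermi' z2\<bar>"
    by (subst abs_mult) (simp only: abs_of_pos[OF l0])
  also have "\<dots> \<le> w * (w * exp (- a))"
  proof -
    have "z1 \<le> a + w" using z1 lw by linarith
    then show ?thesis
      by (intro mult_mono fermi_deriv_lipschitz lw abs_ge_zero) (use z1 z2 w in linarith)+
  qed
  finally show ?thesis unfolding e by (simp add: power2_eq_square mult.assoc)
qed simp

text \<open>On each period, replace \<open>fermi\<close> by its linear interpolation between the two end points.  As \<open>c\<close>
has mean value 0, only the slope enters; the slopes telescope to \<open>- fermi 0 = - 1 / 2\<close>,
while the interpolation errors sum to \<open>O(t)\<close>.\<close>

lemma fermi_periodic_sum_bound:
  fixes c :: "nat \<Rightarrow> real"
  assumes M: "0 < M" and periodic: "\<And>n. c (n + M) = c n" and zero: "(\<Sum>i<M. c i) = 0"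
    and t: "0 < t" "t * real M \<le> 1"
    and S: "(\<lambda>n. c n * fermi (t * real n)) sums S"
  shows "\<bar>S - (- (\<Sum>i<M. real i * c i) / (2 * real M))\<bar> \<le> 2 * (\<Sum>i<M. \<bar>c i\<bar>) * (t * real M)"
proof -
  define w where "w = t * real M"
  define K where "K = (\<Sum>i<M. \<bar>c i\<bar>)"
  define L where "L = (\<Sum>i<M. c i * (real i / real M))"
  define G where "G j = fermi (w * real j)" for j :: nat
  have w: "0 < w" "w \<le> 1" using M t by (simp_all add: w_def)
  have per: "c (j * M + i) = c i" for j i
    by (induction j) (use periodic in \<open>auto simp: ac_simps\<close>, metis add.commute add.left_commute periodic)
  \<comment> \<open>the interpolation error on the \<open>j\<close>-th period\<close>
  define err where "err j = (\<Sum>i<M. c i * (fermi (w * real j + real i / real M * w)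
      - ((1 - real i / real M) * fermi (w * real j) + real i / real M * fermi (w * real j + w))))" for j :: nat
  have block: "(\<Sum>n\<in>{j * M..<j * M + M}. c n * fermi (t * real n)) = L * (G (Suc j) - G j) + err j" for j
  proof -
    have "(\<Sum>n\<in>{j * M..<j * M + M}. c n * fermi (t * real n))
        = (\<Sum>i<M. c (j * M + i) * fermi (t * real (j * M + i)))"
      by (rule sum.reindex_bij_witness[of _ "\<lambda>i. j * M + i" "\<lambda>n. n - j * M"]) auto
    also have "\<dots> = (\<Sum>i<M. c i * fermi (w * real j + real i / real M * w))"
    proof (intro sum.cong refl)
      fix i
      have "t * real (j * M + i) = w * real j + real i / real M * w"
        using M by (simp add: w_def field_simps)
      then show "c (j * M + i) * fermi (t * real (j * M + i)) = c i * fermi (w * real j + real i / real M * w)"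
        by (simp only: per)
    qed
    also have "\<dots> = (\<Sum>i<M. c i * ((1 - real i / real M) * fermi (w * real j) + real i / real M * fermi (w * real j + w))) + err j"
      unfolding err_def sum.distrib[symmetric] by (intro sum.cong refl) (simp add: algebra_simps)
    also have "(\<Sum>i<M. c i * ((1 - real i / real M) * fermi (w * real j) + real i / real M * fermi (w * real j + w)))
        = (\<Sum>i<M. G j * c i + (G (Suc j) - G j) * (c i * (real i / real M)))"
      unfolding G_def by (intro sum.cong refl) (simp add: algebra_simps)
    also have "\<dots> = G j * (\<Sum>i<M. c i) + (G (Suc j) - G j) * L"
      by (simp only: sum.distrib L_def sum_distrib_left)
    finally show ?thesis by (simp add: zero)
  qed
  have err: "\<bar>err j\<bar> \<le> K * w\<^sup>2 * exp (- w) ^ j" for j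
  proof -
    have "\<bar>err j\<bar> \<le> (\<Sum>i<M. \<bar>c i\<bar> * (w\<^sup>2 * exp (- (w * real j))))"
      unfolding err_def
      by (rule order_trans[OF sum_abs], rule sum_mono, subst abs_mult, rule mult_left_mono,
          rule fermi_interpolation) (use M w in auto)
    also have "\<dots> = K * (w\<^sup>2 * exp (- (w * real j)))"
      by (simp only: K_def sum_distrib_right)
    also have "exp (- (w * real j)) = exp (- w) ^ j"
      by (simp add: exp_of_nat_mult[symmetric] mult.commute)
    also have "K * (w\<^sup>2 * exp (- w) ^ j) = K * w\<^sup>2 * exp (- w) ^ j" by simp
    finally show ?thesis .
  qed
  have "(\<lambda>j. L * (G (Suc j) - G j) + err j) sums S"
    using sums_group[OF S M] by (simp add: block)
  moreover have "(\<lambda>j. L * (G (Suc j) - G j)) sums (L * (0 - G 0))"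
  proof (intro sums_mult telescope_sums)
    show "G \<longlonglongrightarrow> 0"
    proof (rule Lim_null_comparison)
      show "eventually (\<lambda>n. norm (G n) \<le> exp (- w) ^ n) sequentially"
        using fermi_le fermi_range(1) by (intro always_eventually)
          (auto simp: G_def exp_of_nat_mult[symmetric] mult.commute abs_of_pos)
      show "(\<lambda>n. exp (- w) ^ n) \<longlonglongrightarrow> 0" using w by (intro LIMSEQ_power_zero) simp
    qed
  qed
  ultimately have "(\<lambda>j. err j) sums (S - L * (0 - G 0))"
    using sums_diff by fastforce
  moreover have geo: "(\<lambda>j. K * w\<^sup>2 * exp (- w) ^ j) sums (K * w\<^sup>2 * (1 / (1 - exp (- w))))"
    using w by (intro sums_mult geometric_sums) simp
  ultimately have "norm (S - L * (0 - G 0)) \<le> K * w\<^sup>2 * (1 / (1 - exp (- w)))"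
    using norm_sums_le[of err _ "\<lambda>j. K * w\<^sup>2 * exp (- w) ^ j"] err by auto
  also have "\<dots> \<le> K * w\<^sup>2 * (1 / (w / 2))"
    using exp_neg_lower[OF w] w by (intro mult_left_mono divide_left_mono) (auto simp: K_def sum_nonneg)
  also have "\<dots> = 2 * K * w" using w by (simp add: power2_eq_square)
  also have "S - L * (0 - G 0) = S - (- (\<Sum>i<M. real i * c i) / (2 * real M))"
    by (simp add: G_def fermi_def L_def sum_divide_distrib mult.commute)
  finally show ?thesis by (simp add: K_def w_def)
qed

text \<open>Summation by fibres: a sum over objects graded by a norm, at most \<open>n\<close> of them of norm
\<open>n\<close>, is a power series.\<close>

lemma has_sum_by_norm:
  fixes \<phi> :: "'a \<Rightarrow> real" and \<nu> :: "'a \<Rightarrow> nat"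
  assumes q: "0 < q" "q < 1"
    and fin: "\<And>n. finite {a\<in>A. \<nu> a = n}" and card: "\<And>n. card {a\<in>A. \<nu> a = n} \<le> n"
    and \<phi>: "\<And>a. a \<in> A \<Longrightarrow> \<bar>\<phi> a\<bar> \<le> 1"
  shows "((\<lambda>a. \<phi> a * q ^ \<nu> a) has_sum (\<Sum>n. (\<Sum>a\<in>{a\<in>A. \<nu> a = n}. \<phi> a) * q ^ n)) A"
proof -
  let ?f = "\<lambda>(n, a). \<phi> a * q ^ \<nu> a"
  let ?B = "\<lambda>n. {a\<in>A. \<nu> a = n}"
  have sumn: "summable (\<lambda>n. real n * q ^ n)"
  proof (rule summable_comparison_test')
    show "summable (\<lambda>n. of_nat (Suc n) * q ^ n)"
      using geometric_deriv_sums[of q] q by (auto simp: sums_iff)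
    show "norm (real n * q ^ n) \<le> of_nat (Suc n) * q ^ n" for n using q by (auto intro: mult_right_mono)
  qed
  have bound: "(\<Sum>a\<in>?B n. \<bar>\<phi> a\<bar>) \<le> real n" for n
  proof -
    have "(\<Sum>a\<in>?B n. \<bar>\<phi> a\<bar>) \<le> (\<Sum>a\<in>?B n. 1)" using \<phi> by (intro sum_mono) auto
    also have "\<dots> \<le> real n" using card[of n] by simp
    finally show ?thesis .
  qed
  have inner: "((\<lambda>a. ?f (n, a)) has_sum (\<Sum>a\<in>?B n. \<phi> a) * q ^ n) (?B n)" for n
    by (rule has_sum_finiteI[OF fin]) (auto simp: sum_distrib_right intro!: sum.cong)
  have inner': "((\<lambda>a. norm (?f (n, a))) has_sum (\<Sum>a\<in>?B n. \<bar>\<phi> a\<bar>) * q ^ n) (?B n)" for n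
    using q by (intro has_sum_finiteI[OF fin]) (auto simp: sum_distrib_right abs_mult intro!: sum.cong)
  have absn: "norm ((\<Sum>a\<in>?B n. \<phi> a) * q ^ n) \<le> real n * q ^ n" for n
  proof -
    have "\<bar>\<Sum>a\<in>?B n. \<phi> a\<bar> \<le> real n" using sum_abs[of \<phi> "?B n"] bound[of n] by linarith
    then show ?thesis using q by (simp add: abs_mult mult_right_mono)
  qed
  have "summable (\<lambda>n. norm ((\<Sum>a\<in>?B n. \<phi> a) * q ^ n))"
    by (rule summable_comparison_test'[OF sumn]) (use absn in simp)
  then have outer: "((\<lambda>n. (\<Sum>a\<in>?B n. \<phi> a) * q ^ n) has_sum (\<Sum>n. (\<Sum>a\<in>?B n. \<phi> a) * q ^ n)) UNIV"
    by (intro norm_summable_imp_has_sum summable_sums) (auto intro: summable_norm_cancel)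
  have "summable (\<lambda>n. (\<Sum>a\<in>?B n. \<bar>\<phi> a\<bar>) * q ^ n)"
    using q bound by (intro summable_comparison_test'[OF sumn]) (auto simp: abs_mult sum_nonneg intro!: mult_right_mono)
  then have "(\<lambda>n. (\<Sum>a\<in>?B n. \<bar>\<phi> a\<bar>) * q ^ n) summable_on UNIV"
    using q by (intro summable_nonneg_imp_summable_on) (auto simp: sum_nonneg)
  then have "(\<lambda>z. norm (?f z)) summable_on Sigma UNIV ?B"
    by (intro summable_on_SigmaI[OF inner']) auto
  then have "?f summable_on Sigma UNIV ?B" by (rule abs_summable_summable)
  from has_sum_SigmaI[OF inner outer this]
  have "(?f has_sum (\<Sum>n. (\<Sum>a\<in>?B n. \<phi> a) * q ^ n)) (Sigma UNIV ?B)" .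
  then show ?thesis
    by (subst has_sum_reindex_bij_witness[of A snd "\<lambda>a. (\<nu> a, a)" "Sigma UNIV ?B" ?f _ _
          "\<Sum>n. (\<Sum>a\<in>?B n. \<phi> a) * q ^ n"]) auto
qed

lemma card_divisors_le: "card {d::nat. d dvd n \<and> 0 < n} \<le> n"
proof -
  have "{d. d dvd n \<and> 0 < n} \<subseteq> {1..n}" by (auto dest: dvd_imp_le intro!: Nat.gr0I simp: Suc_le_eq)
  then show ?thesis using card_mono[of "{1..n}"] by fastforce
qed

locale periodic_splitting_character = splitting_character +
  fixes N :: nat
  assumes N_pos: "1 < N" and X_periodic: "X (n + N) = X n" and X_sum: "(\<Sum>i<N. X i) = 0"
    and X_0: "X 0 = 0" and X_bound: "\<bar>X n\<bar> \<le> 1"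
begin

text \<open>The function \<open>F\<close> of the introductory comment.\<close>

definition ideal_sum :: "real \<Rightarrow> real" where
  "ideal_sum t = (\<Sum>\<^sub>\<infinity>\<tau>\<in>triples m. exp (- t * real (triple_norm \<tau>)))"

lemma divisor_sum_le: "0 < n \<Longrightarrow> (\<Sum>d | d dvd n. X d) \<le> int n"
proof -
  assume n: "0 < n"
  have "(\<Sum>d | d dvd n. X d) \<le> (\<Sum>d | d dvd n. 1)"
    using X_bound by (intro sum_mono) (metis abs_le_D1)
  also have "\<dots> \<le> int n" using card_divisors_le[of n] n by simp
  finally show ?thesis .
qed

lemma card_norm_fibre_le: "card {\<tau>\<in>triples m. triple_norm \<tau> = n} \<le> n" "finite {\<tau>\<in>triples m. triple_norm \<tau> = n}"
proof -
  have 0: "{\<tau>\<in>triples m. triple_norm \<tau> = 0} = {}" by (auto simp: triples_def triple_norm_def)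
  show "card {\<tau>\<in>triples m. triple_norm \<tau> = n} \<le> n"
  proof (cases "n = 0")
    case True
    show ?thesis by (simp only: True 0 card.empty le0)
  next
    case False
    then show ?thesis using card_triples(2)[of n] divisor_sum_le[of n] by linarith
  qed
  show "finite {\<tau>\<in>triples m. triple_norm \<tau> = n}"
  proof (cases "n = 0")
    case True
    show ?thesis by (simp only: True 0 finite.emptyI)
  next
    case False
    then show ?thesis using card_triples(1)[of n] by blast
  qed
qed

text \<open>Ideals of norm \<open>n\<close> are as numerous as the divisors of \<open>n\<close>, counted with weight \<open>X\<close>; so the sum over ideals
may be taken over pairs \<open>(d, k)\<close> with \<open>d k\<close> in the role of the norm.\<close>

lemma ideal_sum_conv_pairs:
  assumes t: "0 < t"
  shows "((\<lambda>\<tau>. exp (- t * real (triple_norm \<tau>))) has_sum ideal_sum t) (triples m)"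
    and "((\<lambda>(d, k). real_of_int (X d) * exp (- t * real (d * k))) has_sum ideal_sum t) ({1..} \<times> {1..})"
proof -
  define q where "q = exp (- t)"
  have q: "0 < q" "q < 1" using t by (simp_all add: q_def)
  have pow: "q ^ n = exp (- t * real n)" for n
    by (simp add: q_def exp_of_nat_mult[symmetric] mult.commute)
  define S where "S = (\<Sum>n. (\<Sum>\<tau>\<in>{\<tau>\<in>triples m. triple_norm \<tau> = n}. 1) * q ^ n)"
  have T: "((\<lambda>\<tau>. 1 * q ^ triple_norm \<tau>) has_sum S) (triples m)"
    unfolding S_def by (rule has_sum_by_norm[OF q card_norm_fibre_le(2,1)]) simp
  show 1: "((\<lambda>\<tau>. exp (- t * real (triple_norm \<tau>))) has_sum ideal_sum t) (triples m)"
    unfolding ideal_sum_def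
    using has_sum_infsum[OF has_sum_imp_summable[OF T[unfolded pow mult_1]]] .
  have S: "S = ideal_sum t"
    by (rule has_sum_unique[OF T[unfolded pow mult_1] 1])
  let ?P = "{1..} \<times> {1..} :: (nat \<times> nat) set"
  have bij: "bij_betw (\<lambda>z. fst z) {z\<in>?P. fst z * snd z = n} {d. d dvd n \<and> 0 < n}" for n
    unfolding bij_betw_def
  proof
    show "inj_on fst {z\<in>?P. fst z * snd z = n}" by (auto simp: inj_on_def)
    show "fst ` {z\<in>?P. fst z * snd z = n} = {d. d dvd n \<and> 0 < n}"
    proof (intro subset_antisym subsetI)
      fix d assume d: "d \<in> {d. d dvd n \<and> 0 < n}"
      then have "(d, n div d) \<in> {z\<in>?P. fst z * snd z = n}"
        by (auto simp: Suc_le_eq dvd_div_eq_0_iff intro!: Nat.gr0I)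
      then show "d \<in> fst ` {z\<in>?P. fst z * snd z = n}" by force
    qed auto
  qed
  have fin: "finite {d::nat. d dvd n \<and> 0 < n}" for n by (cases "n = 0") auto
  have P: "((\<lambda>z. real_of_int (X (fst z)) * q ^ (fst z * snd z)) has_sum
      (\<Sum>n. (\<Sum>z\<in>{z\<in>?P. fst z * snd z = n}. real_of_int (X (fst z))) * q ^ n)) ?P"
  proof (rule has_sum_by_norm[OF q])
    show "finite {z\<in>?P. fst z * snd z = n}" for n using bij_betw_finite[OF bij] fin by blast
    show "card {z\<in>?P. fst z * snd z = n} \<le> n" for n using bij_betw_same_card[OF bij] card_divisors_le by simp
    show "\<bar>real_of_int (X (fst z))\<bar> \<le> 1" for z using X_bound[of "fst z"] by linarith
  qed
  have fibre: "(\<Sum>z\<in>{z\<in>?P. fst z * snd z = n}. real_of_int (X (fst z))) = (\<Sum>\<tau>\<in>{\<tau>\<in>triples m. triple_norm \<tau> = n}. 1)" for n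
  proof (cases "n = 0")
    case True
    have "{z\<in>?P. fst z * snd z = 0} = {}" "{\<tau>\<in>triples m. triple_norm \<tau> = 0} = {}"
      by (auto simp: triples_def triple_norm_def)
    then show ?thesis using True by (simp only: sum.empty)
  next
    case False
    have "(\<Sum>z\<in>{z\<in>?P. fst z * snd z = n}. real_of_int (X (fst z))) = (\<Sum>d\<in>{d. d dvd n \<and> 0 < n}. real_of_int (X d))"
      by (rule sum.reindex_bij_betw[OF bij])
    also have "\<dots> = of_int (\<Sum>d | d dvd n. X d)" using False by simp
    also have "\<dots> = real_of_int (int (card {\<tau>\<in>triples m. triple_norm \<tau> = n}))"
      using card_triples(2)[of n] False by simp
    finally show ?thesis by simp
  qed
  have "((\<lambda>z. real_of_int (X (fst z)) * q ^ (fst z * snd z)) has_sum ideal_sum t) ?P"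
    using P unfolding fibre S_def[symmetric] S .
  then show "((\<lambda>(d, k). real_of_int (X d) * exp (- t * real (d * k))) has_sum ideal_sum t) ({1..} \<times> {1..})"
    unfolding pow case_prod_unfold .
qed

lemma ideal_sum_lambert:
  assumes t: "0 < t"
  shows "((\<lambda>d. real_of_int (X d) * (1 / (exp (t * real d) - 1))) has_sum ideal_sum t) {1..}"
proof (rule has_sum_SigmaD[OF ideal_sum_conv_pairs(2)[OF t]])
  fix d :: nat assume d: "d \<in> {1..}"
  define q where "q = exp (- t * real d)"
  have q: "0 < q" "q < 1" using t d by (simp_all add: q_def)
  have pow: "q ^ k = exp (- t * real (d * k))" for k
    by (simp add: q_def exp_of_nat_mult[symmetric] mult_ac)
  have "((\<lambda>k. q ^ k) has_sum q / (1 - q)) {1..}"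
    using has_sum_geometric_from_1[of q] q by simp
  moreover have "q / (1 - q) = 1 / (exp (t * real d) - 1)"
    using q t d by (simp add: q_def exp_minus field_simps)
  ultimately have "((\<lambda>k. real_of_int (X d) * q ^ k) has_sum (real_of_int (X d) * (1 / (exp (t * real d) - 1)))) {1..}"
    by (metis has_sum_cmult_right)
  then show "((\<lambda>k. case (d, k) of (d, k) \<Rightarrow> real_of_int (X d) * exp (- t * real (d * k)))
      has_sum (real_of_int (X d) * (1 / (exp (t * real d) - 1)))) {1..}"
    by (simp only: pow prod.case)
qed

lemma ideal_sum_fermi:
  assumes t: "0 < t"
  shows "(\<lambda>d. real_of_int (X d) * fermi (t * real d)) sums (ideal_sum t - 2 * ideal_sum (2 * t))"
proof -
  have id: "1 / (exp y - 1) + (-2) * (1 / (exp (2 * y) - 1)) = fermi y" if "0 < y" for y :: real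
  proof -
    define E where "E = exp y"
    have E: "1 < E" "exp (2 * y) = E * E" using that by (simp_all add: E_def exp_add[symmetric])
    have "E * E - 1 = (E - 1) * (E + 1)" by (simp add: algebra_simps)
    then show ?thesis using E by (simp add: fermi_def E_def[symmetric] divide_simps)
  qed
  have "((\<lambda>d. real_of_int (X d) * (1 / (exp (t * real d) - 1))
      + (-2) * (real_of_int (X d) * (1 / (exp (2 * t * real d) - 1)))) has_sum (ideal_sum t + (-2) * ideal_sum (2 * t))) {1..}"
    using t by (intro has_sum_add has_sum_cmult_right ideal_sum_lambert) simp_all
  also have "?this \<longleftrightarrow> ((\<lambda>d. real_of_int (X d) * fermi (t * real d)) has_sum (ideal_sum t + (-2) * ideal_sum (2 * t))) UNIV"
  proof (rule has_sum_cong_neutral)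
    fix d :: nat assume "d \<in> {1..} \<inter> UNIV"
    then have "0 < t * real d" using t by simp
    then have eq: "fermi (t * real d) = 1 / (exp (t * real d) - 1) + (-2) * (1 / (exp (2 * t * real d) - 1))"
      by (simp only: id[symmetric] mult.assoc)
    show "real_of_int (X d) * (1 / (exp (t * real d) - 1))
      + (-2) * (real_of_int (X d) * (1 / (exp (2 * t * real d) - 1))) = real_of_int (X d) * fermi (t * real d)"
      unfolding eq by (simp only: distrib_left mult.left_commute)
  qed (auto simp: X_0 not_le Suc_le_eq)
  finally show ?thesis using has_sum_imp_sums by fastforce
qed

text \<open>The value at \<open>s = 0\<close> of the analytic continuation of the Dirichlet series of \<open>X\<close>.\<close>

definition L0 :: real where
  "L0 = - (\<Sum>i<N. real i * real_of_int (X i)) / real N"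

lemma ideal_sum_double_tendsto:
  "((\<lambda>t. ideal_sum t - 2 * ideal_sum (2 * t)) \<longlongrightarrow> L0 / 2) (at_right 0)"
proof -
  define K where "K = 2 * (\<Sum>i<N. \<bar>real_of_int (X i)\<bar>) * real N"
  have z: "(\<Sum>i<N. real_of_int (X i)) = 0" using X_sum by (metis of_int_0 of_int_sum)
  have bound: "norm ((ideal_sum t - 2 * ideal_sum (2 * t)) - L0 / 2) \<le> K * t" if "0 < t" "t * real N \<le> 1" for t
    using fermi_periodic_sum_bound[OF _ _ z that ideal_sum_fermi[OF that(1)]] N_pos X_periodic
    by (simp add: L0_def K_def algebra_simps)
  have "eventually (\<lambda>t. t \<in> {0<..<1 / real N}) (at_right 0)"
    using N_pos by (intro eventually_at_right_real) simp
  then have "eventually (\<lambda>t. norm ((ideal_sum t - 2 * ideal_sum (2 * t)) - L0 / 2) \<le> K * t) (at_right 0)"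
  proof (rule eventually_mono)
    fix t :: real assume "t \<in> {0<..<1 / real N}"
    then show "norm ((ideal_sum t - 2 * ideal_sum (2 * t)) - L0 / 2) \<le> K * t"
      using N_pos by (intro bound) (simp_all add: field_simps)
  qed
  moreover have "((\<lambda>t. K * t) \<longlongrightarrow> 0) (at_right 0)" by (auto intro!: tendsto_eq_intros)
  ultimately have "((\<lambda>t. (ideal_sum t - 2 * ideal_sum (2 * t)) - L0 / 2) \<longlongrightarrow> 0) (at_right 0)"
    by (rule Lim_null_comparison)
  then show ?thesis by (rule LIM_zero_cancel)
qed

text \<open>\<open>F(t) - 4 F(4t)\<close> is \<open>F(t) - 2 F(2t)\<close> plus twice the same expression at \<open>2 t\<close>.\<close>

theorem ideal_sum_constant_term:
  "((\<lambda>t. ideal_sum t - 4 * ideal_sum (4 * t)) \<longlongrightarrow> 3 / 2 * L0) (at_right 0)"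
proof -
  have "filterlim (\<lambda>t::real. 2 * t) (at_right 0) (at_right 0)"
    by (auto simp: filterlim_at eventually_at_right_less intro!: tendsto_eq_intros)
       (auto simp: eventually_at_filter)
  from filterlim_compose[OF ideal_sum_double_tendsto this]
  have "((\<lambda>t. (ideal_sum t - 2 * ideal_sum (2 * t)) + 2 * (ideal_sum (2 * t) - 2 * ideal_sum (2 * (2 * t))))
      \<longlongrightarrow> L0 / 2 + 2 * (L0 / 2)) (at_right 0)"
    by (intro tendsto_intros ideal_sum_double_tendsto)
  then show ?thesis by simp
qed

end

section \<open>The ring of integers\<close>

text \<open>If the powers of a rational number have a common denominator, its own denominator is 1,
since powers of a larger one would be unbounded divisors of \<open>d\<close>.\<close>

lemma rat_integral_of_bounded_denominators:
  fixes q :: rat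
  assumes "0 < (d::int)" and "\<And>k. of_int d * q ^ k \<in> \<int>"
  shows "q \<in> \<int>"
proof -
  obtain a b where ab: "quotient_of q = (a, b)" by force
  have b: "0 < b" "coprime a b" and q: "q = of_int a / of_int b"
    using ab quotient_of_denom_pos quotient_of_coprime quotient_of_div by blast+
  have "b ^ k dvd d" for k
  proof -
    obtain c where "of_int d * q ^ k = (of_int c :: rat)" using assms(2)[of k] by (auto elim: Ints_cases)
    then have "of_int (d * a ^ k) = (of_int (c * b ^ k) :: rat)"
      using b(1) by (simp add: q power_divide field_simps)
    then have "d * a ^ k = c * b ^ k" by (simp only: of_int_eq_iff)
    then have "b ^ k dvd d * a ^ k" by simp
    moreover have "coprime (b ^ k) (a ^ k)" using b(2) by (simp add: coprime_commute)
    ultimately show ?thesis by (simp add: coprime_dvd_mult_left_iff)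
  qed
  then have le: "b ^ k \<le> d" for k using assms(1) zdvd_imp_le by blast
  have "b = 1"
  proof (rule ccontr)
    assume "b \<noteq> 1"
    then have "2 \<le> b" using b(1) by simp
    then have "2 ^ nat d \<le> b ^ nat d" by (intro power_mono) simp_all
    moreover have "int (nat d) < int (2 ^ nat d)" unfolding of_nat_less_iff by (rule less_exp)
    then have "d < 2 ^ nat d" using assms(1) by simp
    ultimately show False using le[of "nat d"] by linarith
  qed
  then show ?thesis using q by simp
qed

lemma rat_integral_of_squarefree_mult:
  fixes q :: rat
  assumes "squarefree (D::int)" and "of_int D * q\<^sup>2 \<in> \<int>"
  shows "q \<in> \<int>"
proof -
  obtain a b where ab: "quotient_of q = (a, b)" by force
  have b: "0 < b" "coprime a b" and q: "q = of_int a / of_int b"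
    using ab quotient_of_denom_pos quotient_of_coprime quotient_of_div by blast+
  obtain c where "of_int D * q\<^sup>2 = (of_int c :: rat)" using assms(2) by (auto elim: Ints_cases)
  then have "of_int (D * a\<^sup>2) = (of_int (c * b\<^sup>2) :: rat)"
    using b(1) by (simp add: q power_divide field_simps)
  then have "D * a\<^sup>2 = c * b\<^sup>2" by (simp only: of_int_eq_iff)
  then have "b\<^sup>2 dvd D * a\<^sup>2" by simp
  moreover have "coprime (b\<^sup>2) (a\<^sup>2)" using b(2) by (simp add: coprime_commute)
  ultimately have "b\<^sup>2 dvd D" by (simp add: coprime_dvd_mult_left_iff)
  then have "is_unit b" using assms(1) by (simp add: squarefree_def)
  then have "b = 1" using b(1) by simp
  then show ?thesis using q by simp
qed

locale imaginary_quadratic =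
  fixes D :: int and m :: nat
  assumes D_eq: "D = 1 - 4 * int m" and m_ge_2: "2 \<le> m" and squarefree_D: "squarefree D"
begin

definition r :: complex where "r = csqrt (of_int D)"

definition \<omega> :: complex where "\<omega> = (1 + r) / 2"

lemma r_altdef: "r = \<i> * of_real (sqrt (4 * real m - 1))"
proof -
  have "real_of_int D = - (4 * real m - 1)" by (simp add: D_eq)
  moreover have "(0::real) \<le> 4 * real m - 1" using m_ge_2 by simp
  ultimately show ?thesis unfolding r_def
    by (subst csqrt_of_real_nonpos) simp_all
qed

lemma r_squared: "r * r = of_int D"
  unfolding r_def by (metis power2_csqrt power2_eq_square)

lemma omega_squared: "\<omega> * \<omega> = \<omega> - of_nat m"
proof -
  have "4 * (\<omega> * \<omega>) = 1 + 2 * r + r * r" by (simp add: \<omega>_def field_simps)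
  also have "r * r = of_int D" by (rule r_squared)
  also have "(of_int D :: complex) = 1 - 4 * of_nat m" by (subst D_eq) simp
  also have "1 + 2 * r + (1 - 4 * of_nat m) = 4 * (\<omega> - of_nat m)" by (simp add: \<omega>_def field_simps)
  finally have "4 * (\<omega> * \<omega>) = 4 * (\<omega> - of_nat m)" .
  then show ?thesis by (simp only: mult_cancel_left) simp
qed

lemma cnj_omega: "cnj \<omega> = 1 - \<omega>"
  by (simp add: \<omega>_def r_altdef field_simps)

lemma Im_omega: "0 < Im \<omega>"
  using m_ge_2 by (simp add: \<omega>_def r_altdef)

lemma Re_r: "Re r = 0" and Im_r: "Im r \<noteq> 0"
  using m_ge_2 by (simp_all add: r_altdef)

lemma of_rat_complex: "complex_of_rat q = of_real (of_rat q)"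
proof -
  obtain a b where "quotient_of q = (a, b)" by force
  then have "q = of_int a / of_int b" by (rule quotient_of_div)
  then show ?thesis by (simp add: of_rat_divide)
qed

lemma r_coordinates_unique:
  assumes "of_rat a + of_rat b * r = of_rat a' + of_rat b' * r"
  shows "a = a'" "b = b'"
proof -
  have c: "Re (of_rat x :: complex) = of_rat x" "Im (of_rat x :: complex) = 0" for x
    by (simp_all add: of_rat_complex)
  have "Re (of_rat a + of_rat b * r) = Re (of_rat a' + of_rat b' * r)" 
    "Im (of_rat a + of_rat b * r) = Im (of_rat a' + of_rat b' * r)" using assms by simp_all
  then show "a = a'" "b = b'" by (simp_all add: c Re_r Im_r)
qed

lemma quad_field_altdef: "quad_field D = {of_rat a + of_rat b * r | a b. True}"
  by (simp add: quad_field_def r_def)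

lemma quad_fieldI: "of_rat a + of_rat b * r \<in> quad_field D"
  by (auto simp: quad_field_altdef)

lemma quad_field_mult:
  assumes "x \<in> quad_field D" "y \<in> quad_field D"
  shows "x * y \<in> quad_field D"
proof -
  obtain a b c d where xy: "x = of_rat a + of_rat b * r" "y = of_rat c + of_rat d * r"
    using assms by (auto simp: quad_field_altdef)
  have "x * y = of_rat a * of_rat c + of_rat b * of_rat d * (r * r) + (of_rat a * of_rat d + of_rat b * of_rat c) * r"
    unfolding xy by (simp add: algebra_simps)
  also have "\<dots> = of_rat (a * c + b * d * of_int D) + of_rat (a * d + b * c) * r"
    unfolding r_squared by (simp add: of_rat_add of_rat_mult)
  finally show ?thesis using quad_fieldI by simp
qed

lemma quad_field_inverse:
  assumes "x \<in> quad_field D"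
  shows "inverse x \<in> quad_field D"
proof (cases "x = 0")
  case True
  then show ?thesis using assms by simp
next
  case False
  obtain a b where x: "x = of_rat a + of_rat b * r" using assms by (auto simp: quad_field_altdef)
  define n where "n = a\<^sup>2 - b\<^sup>2 * of_int D"
  have e: "x * (of_rat a - of_rat b * r) = of_rat n"
  proof -
    have "x * (of_rat a - of_rat b * r) = of_rat a * of_rat a - of_rat b * of_rat b * (r * r)"
      unfolding x by (simp add: algebra_simps)
    then show ?thesis unfolding r_squared
      by (simp add: n_def of_rat_diff of_rat_mult power2_eq_square)
  qed
  have "n \<noteq> 0"
  proof
    assume "n = 0"
    then have "of_rat a + of_rat (- b) * r = of_rat 0 + of_rat 0 * r" using e False by (simp add: of_rat_minus)
    then have "a = 0" "b = 0" using r_coordinates_unique[of a "-b" 0 0] by simp_all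
    then show False using False x by simp
  qed
  then have "inverse x = (of_rat a - of_rat b * r) / of_rat n"
    using e False by (simp add: field_simps)
  also have "\<dots> = of_rat (a / n) + of_rat (- b / n) * r"
    using \<open>n \<noteq> 0\<close> by (simp add: of_rat_divide of_rat_minus field_simps)
  finally show ?thesis using quad_fieldI by simp
qed

lemma quad_field_divide:
  "x \<in> quad_field D \<Longrightarrow> y \<in> quad_field D \<Longrightarrow> x / y \<in> quad_field D"
  unfolding divide_inverse by (intro quad_field_mult quad_field_inverse)

definition pt :: "int \<Rightarrow> int \<Rightarrow> complex" where
  "pt x y = of_int x + of_int y * \<omega>"

lemma pt_add: "pt x y + pt x' y' = pt (x + x') (y + y')"
  by (simp add: pt_def algebra_simps)

lemma pt_diff: "pt x y - pt x' y' = pt (x - x') (y - y')"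
  by (simp add: pt_def algebra_simps)

lemma pt_mult: "pt x y * pt x' y' = pt (x * x' - int m * (y * y')) (x * y' + y * x' + y * y')"
proof -
  have "pt x y * pt x' y' = of_int (x * x') + of_int (x * y' + y * x') * \<omega> + of_int (y * y') * (\<omega> * \<omega>)"
    by (simp add: pt_def algebra_simps)
  then show ?thesis unfolding omega_squared by (simp add: pt_def algebra_simps)
qed

lemma pt_eq_iff: "pt x y = pt x' y' \<longleftrightarrow> x = x' \<and> y = y'"
proof
  assume e: "pt x y = pt x' y'"
  then have "Im (pt x y) = Im (pt x' y')" by simp
  then have "y = y'" using Im_omega by (simp add: pt_def)
  then show "x = x' \<and> y = y'" using e by (simp add: pt_def)
qed simp

lemma pt_eq_0_iff: "pt x y = 0 \<longleftrightarrow> x = 0 \<and> y = 0"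
  using pt_eq_iff[of x y 0 0] by (simp add: pt_def)

lemma pt_in_field: "pt x y \<in> quad_field D"
proof -
  have "pt x y = of_rat (of_int x + of_int y / 2) + of_rat (of_int y / 2) * r"
    unfolding pt_def \<omega>_def of_rat_add of_rat_divide of_rat_of_int_eq of_rat_numeral_eq
    by (simp add: field_simps)
  then show ?thesis using quad_fieldI by metis
qed

lemma cmod_pt: "(cmod (pt x y))\<^sup>2 = of_int (x\<^sup>2 + x * y + int m * y\<^sup>2)"
proof -
  have "complex_of_real ((cmod (pt x y))\<^sup>2) = pt x y * cnj (pt x y)"
    by (rule complex_norm_square)
  also have "cnj (pt x y) = pt (x + y) (- y)"
    by (simp add: pt_def cnj_omega algebra_simps)
  also have "pt x y * pt (x + y) (- y) = pt (x\<^sup>2 + x * y + int m * y\<^sup>2) 0"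
    unfolding pt_mult by (simp add: power2_eq_square algebra_simps)
  also have "\<dots> = complex_of_real (of_int (x\<^sup>2 + x * y + int m * y\<^sup>2))" by (simp add: pt_def)
  finally show ?thesis by (simp only: of_real_eq_iff)
qed

lemma pt_algebraic_int: "algebraic_int (pt x y)"
proof (rule algebraic_int.intros)
  let ?p = "[:of_int (x\<^sup>2 + x * y + int m * y\<^sup>2), - of_int (2 * x + y), 1:] :: complex poly"
  show "lead_coeff ?p = 1" by simp
  show "\<forall>i. poly.coeff ?p i \<in> \<int>"
  proof
    fix i show "poly.coeff ?p i \<in> \<int>"
      by (cases i; simp; cases "i - 1"; simp add: coeff_pCons split: nat.split)
  qed
  have "poly ?p (pt x y) = pt (x\<^sup>2 + x * y + int m * y\<^sup>2) 0 - pt (2 * x + y) 0 * pt x y + pt x y * pt x y"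
    by (simp add: pt_def algebra_simps)
  also have "\<dots> = 0"
    unfolding pt_mult pt_add pt_diff pt_eq_0_iff by (simp add: power2_eq_square algebra_simps)
  finally show "poly ?p (pt x y) = 0" .
qed

text \<open>The order \<open>\<int> + \<int> r\<close>; denominators in the field are measured against it.\<close>

definition \<Lambda> :: "complex set" where
  "\<Lambda> = {of_int x + of_int y * r | x y. True}"

lemma \<Lambda>_closed:
  "0 \<in> \<Lambda>" "z \<in> \<Lambda> \<Longrightarrow> w \<in> \<Lambda> \<Longrightarrow> z + w \<in> \<Lambda>" "z \<in> \<Lambda> \<Longrightarrow> w \<in> \<Lambda> \<Longrightarrow> z - w \<in> \<Lambda>"
  "z \<in> \<Lambda> \<Longrightarrow> of_int n * z \<in> \<Lambda>"
proof -
  show "0 \<in> \<Lambda>" unfolding \<Lambda>_def by (auto intro!: exI[of _ 0])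
  assume "z \<in> \<Lambda>"
  then obtain x y where z: "z = of_int x + of_int y * r" by (auto simp: \<Lambda>_def)
  have "of_int n * z = of_int (n * x) + of_int (n * y) * r" by (simp add: z algebra_simps)
  then show "of_int n * z \<in> \<Lambda>" unfolding \<Lambda>_def by blast
  assume "w \<in> \<Lambda>"
  then obtain x' y' where w: "w = of_int x' + of_int y' * r" by (auto simp: \<Lambda>_def)
  have "z + w = of_int (x + x') + of_int (y + y') * r" by (simp add: z w algebra_simps)
  then show "z + w \<in> \<Lambda>" unfolding \<Lambda>_def by blast
  have "z - w = of_int (x - x') + of_int (y - y') * r" by (simp add: z w algebra_simps)
  then show "z - w \<in> \<Lambda>" unfolding \<Lambda>_def by blast
qed

lemma \<Lambda>_sum: "(\<And>i. i \<in> A \<Longrightarrow> f i \<in> \<Lambda>) \<Longrightarrow> sum f A \<in> \<Lambda>"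
  by (induction A rule: infinite_finite_induct) (auto intro: \<Lambda>_closed)

lemma common_denominator:
  assumes "\<And>i. z i \<in> quad_field D"
  shows "\<exists>d::int. 0 < d \<and> (\<forall>i<(n::nat). of_int d * z i \<in> \<Lambda>)"
proof (induction n)
  case 0
  show ?case by (auto intro: exI[of _ 1])
next
  case (Suc n)
  then obtain d where d: "0 < d" "\<forall>i<n. of_int d * z i \<in> \<Lambda>" by blast
  obtain a b where zn: "z n = of_rat a + of_rat b * r"
    using assms[of n] by (auto simp: quad_field_altdef)
  obtain a1 a2 b1 b2 where q: "quotient_of a = (a1, a2)" "quotient_of b = (b1, b2)" by force
  have pos: "0 < a2" "0 < b2" and e: "a = of_int a1 / of_int a2" "b = of_int b1 / of_int b2"
    using q[THEN quotient_of_denom_pos] q[THEN quotient_of_div] by simp_all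
  have "of_int (a2 * b2) * z n = of_int (a1 * b2) + of_int (b1 * a2) * r"
    using pos by (simp add: zn e of_rat_divide field_simps)
  then have "of_int (a2 * b2) * z n \<in> \<Lambda>" unfolding \<Lambda>_def by blast
  then have n: "of_int d * (of_int (a2 * b2) * z n) \<in> \<Lambda>" by (rule \<Lambda>_closed)
  have "of_int (d * (a2 * b2)) * z i \<in> \<Lambda>" if "i < Suc n" for i
  proof (cases "i = n")
    case True
    have "of_int (d * (a2 * b2)) * z n = of_int d * (of_int (a2 * b2) * z n)" by simp
    then show ?thesis using n True by (simp only:)
  next
    case False
    then have "of_int d * z i \<in> \<Lambda>" using d(2) that by simp
    then have "of_int (a2 * b2) * (of_int d * z i) \<in> \<Lambda>" by (rule \<Lambda>_closed)
    moreover have "of_int (d * (a2 * b2)) * z i = of_int (a2 * b2) * (of_int d * z i)" by simp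
    ultimately show ?thesis by (simp only:)
  qed
  then have "\<forall>i<Suc n. of_int (d * (a2 * b2)) * z i \<in> \<Lambda>" by blast
  moreover have "0 < d * (a2 * b2)" using d(1) pos by simp
  ultimately show ?case by blast
qed

lemma quad_field_power: "x \<in> quad_field D \<Longrightarrow> x ^ n \<in> quad_field D"
proof (induction n)
  case 0
  have "pt 1 0 \<in> quad_field D" by (rule pt_in_field)
  then show ?case by (simp add: pt_def)
qed (auto intro: quad_field_mult)

text \<open>The powers below the degree of a monic equation have a common denominator, and the equation
expresses all other powers through these with integer coefficients.\<close>

lemma algebraic_int_bounded_denominators:
  assumes "x \<in> quad_field D" "algebraic_int x"
  shows "\<exists>d::int. 0 < d \<and> (\<forall>k. of_int d * x ^ k \<in> \<Lambda>)"
proof -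
  obtain p where p: "lead_coeff p = 1" "\<forall>i. poly.coeff p i \<in> \<int>" "poly p x = 0"
    using assms(2) by (auto elim: algebraic_int.cases)
  define n where "n = degree p"
  obtain d where d: "0 < d" "\<forall>i<n. of_int d * x ^ i \<in> \<Lambda>"
    using common_denominator[of "\<lambda>i. x ^ i" n] quad_field_power assms(1) by blast
  have "of_int d * x ^ k \<in> \<Lambda>" for k
  proof (induction k rule: less_induct)
    case (less k)
    show ?case
    proof (cases "k < n")
      case True
      then show ?thesis using d by blast
    next
      case False
      have "0 = x ^ (k - n) * poly p x" using p(3) by simp
      also have "\<dots> = x ^ (k - n) * ((\<Sum>i<n. poly.coeff p i * x ^ i) + x ^ n)"
        using p(1) by (simp add: poly_altdef n_def lessThan_Suc_atMost[symmetric])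
      also have "\<dots> = (\<Sum>i<n. poly.coeff p i * x ^ (k - n + i)) + x ^ k"
      proof -
        have "x ^ (k - n) * (\<Sum>i<n. poly.coeff p i * x ^ i) = (\<Sum>i<n. poly.coeff p i * x ^ (k - n + i))"
          unfolding sum_distrib_left by (intro sum.cong refl) (simp only: power_add mult.left_commute)
        moreover have "x ^ (k - n) * x ^ n = x ^ k" using False by (simp add: power_add[symmetric])
        ultimately show ?thesis by (simp only: distrib_left)
      qed
      finally have "x ^ k = 0 - (\<Sum>i<n. poly.coeff p i * x ^ (k - n + i))" by (simp add: eq_neg_iff_add_eq_0 add.commute)
      then have e: "of_int d * x ^ k = 0 - (\<Sum>i<n. poly.coeff p i * (of_int d * x ^ (k - n + i)))"
        by (simp add: sum_distrib_left mult_ac)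
      have "poly.coeff p i * (of_int d * x ^ (k - n + i)) \<in> \<Lambda>" if "i < n" for i
      proof -
        obtain c where "poly.coeff p i = of_int c" using p(2) by (metis Ints_cases)
        moreover have "of_int d * x ^ (k - n + i) \<in> \<Lambda>" using less.IH[of "k - n + i"] False that by simp
        ultimately show ?thesis using \<Lambda>_closed(4) by simp
      qed
      then show ?thesis unfolding e by (intro \<Lambda>_closed \<Lambda>_sum) auto
    qed
  qed
  then show ?thesis using d(1) by blast
qed

text \<open>The norm of \<open>x ^ k\<close> is the \<open>k\<close>-th power of the norm of \<open>x\<close>, with denominators bounded independently
of \<open>k\<close>.\<close>

lemma norm_integral:
  assumes x: "x = of_rat a + of_rat b * r" and d: "0 < d" "\<And>k. of_int d * x ^ k \<in> \<Lambda>"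
  shows "a\<^sup>2 - b\<^sup>2 * of_int D \<in> \<int>"
proof (rule rat_integral_of_bounded_denominators)
  show "0 < d * d" using d(1) by simp
  fix k
  define n where "n = a\<^sup>2 - b\<^sup>2 * of_int D"
  have cr: "cnj (of_rat y) = of_rat y" for y
    by (simp add: of_rat_complex)
  have cnj_r: "cnj r = - r" by (simp add: r_altdef)
  have "x * cnj x = of_rat a * of_rat a - of_rat b * of_rat b * (r * r)"
    unfolding x by (simp add: cr cnj_r algebra_simps)
  then have xn: "x * cnj x = of_rat n"
    unfolding r_squared by (simp add: n_def of_rat_diff of_rat_mult power2_eq_square)
  obtain u v where uv: "of_int d * x ^ k = of_int u + of_int v * r" using d(2)[of k] by (auto simp: \<Lambda>_def)
  have "of_rat (of_int (d * d) * n ^ k) = (of_int d * x ^ k) * cnj (of_int d * x ^ k)"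
    by (simp add: of_rat_mult of_rat_power xn[symmetric] power_mult_distrib mult_ac)
  also have "\<dots> = of_int u * of_int u - of_int v * of_int v * (r * r)"
    unfolding uv by (simp add: cnj_r algebra_simps)
  also have "\<dots> = of_rat (of_int (u * u - v * v * D))" unfolding r_squared by (simp add: of_rat_diff of_rat_mult)
  finally have "of_int (d * d) * n ^ k = of_int (u * u - v * v * D)" by (simp only: of_rat_eq_iff)
  then show "of_int (d * d) * (a\<^sup>2 - b\<^sup>2 * of_int D) ^ k \<in> \<int>" by (simp add: n_def[symmetric])
qed

text \<open>The powers of both \<open>z\<close> and \<open>z - 1\<close> have bounded denominators, so both norms are integers; their
difference is the trace of \<open>z\<close> minus 1.  Integral trace and norm,
together with a squarefree discriminant congruent to 1 modulo 4, force \<open>z\<close> into the lattice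
spanned by \<open>1\<close> and \<open>\<omega>\<close>.\<close>

theorem quad_integers_eq: "quad_integers D = {pt x y | x y. True}"
proof (intro subset_antisym subsetI)
  fix z assume "z \<in> {pt x y | x y. True}"
  then show "z \<in> quad_integers D" using pt_in_field pt_algebraic_int by (auto simp: quad_integers_def)
next
  fix z assume "z \<in> quad_integers D"
  then have z: "z \<in> quad_field D" "algebraic_int z" by (auto simp: quad_integers_def)
  obtain a b where ab: "z = of_rat a + of_rat b * r" using z(1) by (auto simp: quad_field_altdef)
  obtain d where d: "0 < d" "\<And>k. of_int d * z ^ k \<in> \<Lambda>"
    using algebraic_int_bounded_denominators[OF z] by blast
  have "of_int d * (z ^ j * (z - 1) ^ k) \<in> \<Lambda>" for j k
  proof (induction k arbitrary: j)
    case 0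
    show ?case using d(2) by simp
  next
    case (Suc k)
    have step: "of_int d * (z ^ j * (z - 1) ^ Suc k)
        = of_int d * (z ^ Suc j * (z - 1) ^ k) - of_int d * (z ^ j * (z - 1) ^ k)"
      by (simp add: algebra_simps)
    show ?case unfolding step by (rule \<Lambda>_closed(3)[OF Suc Suc])
  qed
  \<comment> \<open>hence \<open>norm_integral\<close> applies to \<open>z - 1\<close> as well\<close>
  from this[of 0] have d1: "of_int d * (z - 1) ^ k \<in> \<Lambda>" for k by simp
  have z1: "z - 1 = of_rat (a - 1) + of_rat b * r" by (simp add: ab of_rat_diff)
  have n: "a\<^sup>2 - b\<^sup>2 * of_int D \<in> \<int>" by (rule norm_integral[OF ab d])
  have n1: "(a - 1)\<^sup>2 - b\<^sup>2 * of_int D \<in> \<int>" by (rule norm_integral[OF z1 d(1) d1])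
  have "2 * a = (a\<^sup>2 - b\<^sup>2 * of_int D) - ((a - 1)\<^sup>2 - b\<^sup>2 * of_int D) + 1"
    by (simp add: power2_eq_square algebra_simps)
  then have "2 * a \<in> \<int>" using n n1 by (metis Ints_1 Ints_add Ints_diff)
  then obtain T where T: "2 * a = of_int T" by (auto elim: Ints_cases)
  obtain n' where n': "a\<^sup>2 - b\<^sup>2 * of_int D = of_int n'" using n by (auto elim: Ints_cases)
  have "of_int D * (2 * b)\<^sup>2 = (2 * a)\<^sup>2 - 4 * (a\<^sup>2 - b\<^sup>2 * of_int D)"
    by (simp add: power2_eq_square algebra_simps)
  also have "\<dots> = of_int (T\<^sup>2 - 4 * n')" unfolding T n' by simp
  finally have Db: "of_int D * (2 * b)\<^sup>2 = (of_int (T\<^sup>2 - 4 * n') :: rat)" .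
  then have "2 * b \<in> \<int>" using rat_integral_of_squarefree_mult[OF squarefree_D] by (metis Ints_of_int)
  then obtain y where y: "2 * b = of_int y" by (auto elim: Ints_cases)
  have "of_int (D * y\<^sup>2) = (of_int (T\<^sup>2 - 4 * n') :: rat)" using Db unfolding y by simp
  then have "D * y\<^sup>2 = T\<^sup>2 - 4 * n'" by (simp only: of_int_eq_iff)
  then have "T\<^sup>2 - y\<^sup>2 = 4 * (n' - int m * y\<^sup>2)" by (simp add: D_eq algebra_simps)
  then have "even (T\<^sup>2 - y\<^sup>2)" by simp
  then have "even (T - y)" by simp
  then obtain x where x: "T - y = 2 * x" by (rule evenE)
  have "of_int (T - y) = (2 * a - 2 * b :: rat)" by (simp only: T y of_int_diff)
  then have av: "a = of_int x + b" unfolding x by simp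
  have bv: "b = of_int y / 2" using y by simp
  have "complex_of_rat a = of_int x + of_int y / 2" "complex_of_rat b = of_int y / 2"
    unfolding av bv of_rat_add of_rat_divide of_rat_of_int_eq of_rat_numeral_eq by (rule refl)+
  then have "z = pt x y" unfolding ab by (simp add: pt_def \<omega>_def field_simps)
  then show "z \<in> {pt x y | x y. True}" by blast
qed

end

section \<open>Ideals as lattices\<close>

text \<open>The least positive element generates, by division with remainder.\<close>

lemma int_subgroup_generator:
  fixes G :: "int set"
  assumes closed: "\<And>x y. x \<in> G \<Longrightarrow> y \<in> G \<Longrightarrow> x - y \<in> G" and pos: "g \<in> G" "g \<noteq> 0"
  obtains e where "0 < e" "\<And>x. x \<in> G \<longleftrightarrow> e dvd x"
proof -
  have 0: "0 \<in> G" using closed[OF pos(1) pos(1)] by simp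
  have neg: "- x \<in> G" if "x \<in> G" for x using closed[OF 0 that] by simp
  have add: "x + y \<in> G" if "x \<in> G" "y \<in> G" for x y using closed[OF that(1) neg[OF that(2)]] by simp
  define P where "P n \<longleftrightarrow> 0 < n \<and> int n \<in> G" for n
  have "P (nat \<bar>g\<bar>)" using pos neg[OF pos(1)] by (auto simp: P_def abs_if)
  then have least: "P (LEAST n. P n)" by (rule LeastI)
  have least_le: "(LEAST n. P n) \<le> n" if "P n" for n using that by (rule Least_le)
  define e where "e = int (LEAST n. P n)"
  have e: "0 < e" "e \<in> G" using least by (simp_all add: P_def e_def)
  have mult: "e * z \<in> G" for z
  proof -
    have nat: "e * int n \<in> G" for n
      by (induction n) (use 0 add e(2) in \<open>simp_all add: distrib_left\<close>)
    show ?thesis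
    proof (cases "0 \<le> z")
      case True
      then show ?thesis using nat[of "nat z"] by simp
    next
      case False
      then show ?thesis using neg[OF nat[of "nat (- z)"]] by simp
    qed
  qed
  have "x \<in> G \<longleftrightarrow> e dvd x" for x
  proof
    assume x: "x \<in> G"
    have "x mod e = x - e * (x div e)" by (simp add: minus_mult_div_eq_mod)
    then have "x mod e \<in> G" using closed[OF x mult] by simp
    moreover have "0 \<le> x mod e" "x mod e < e" using e(1) by simp_all
    ultimately have "\<not> 0 < x mod e"
    proof -
      assume a: "x mod e \<in> G" "0 \<le> x mod e" "x mod e < e"
      show ?thesis
      proof
        assume "0 < x mod e"
        then have "P (nat (x mod e))" using a by (simp add: P_def)
        then have "(LEAST n. P n) \<le> nat (x mod e)" by (rule least_le)
        then show False using a by (simp add: e_def)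
      qed
    qed
    then have "x mod e = 0" using \<open>0 \<le> x mod e\<close> by simp
    then show "e dvd x" by (simp add: dvd_eq_mod_eq_0)
  next
    assume "e dvd x"
    then show "x \<in> G" using mult by (auto simp: dvd_def)
  qed
  then show ?thesis using that e(1) by blast
qed

definition Lat :: "complex \<Rightarrow> complex \<Rightarrow> complex set" where
  "Lat u v = {of_int x * u + of_int y * v | x y. True}"

lemma Lat_scale: "(*) \<alpha> ` Lat u v = Lat (\<alpha> * u) (\<alpha> * v)"
proof -
  have "\<alpha> * (of_int x * u + of_int y * v) = of_int x * (\<alpha> * u) + of_int y * (\<alpha> * v)" for x y
    by (simp add: algebra_simps)
  then show ?thesis unfolding Lat_def by (auto simp: image_iff) metis+
qed

lemma Lat_mem: "u \<in> Lat u v" "v \<in> Lat u v"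
  unfolding Lat_def by (auto intro: exI[of _ 0] exI[of _ 1])

lemma Lat_sub:
  assumes "u' \<in> Lat u v" "v' \<in> Lat u v"
  shows "Lat u' v' \<subseteq> Lat u v"
proof
  fix z assume "z \<in> Lat u' v'"
  then obtain x y where z: "z = of_int x * u' + of_int y * v'" by (auto simp: Lat_def)
  obtain a b where u: "u' = of_int a * u + of_int b * v" using assms by (auto simp: Lat_def)
  obtain c d where v: "v' = of_int c * u + of_int d * v" using assms by (auto simp: Lat_def)
  have "z = of_int (x * a + y * c) * u + of_int (x * b + y * d) * v"
    unfolding z u v by (simp add: algebra_simps)
  then show "z \<in> Lat u v" unfolding Lat_def by blast
qed

text \<open>The area of a fundamental parallelogram.  It serves to define norms, because it scales by
\<open>\<bar>\<alpha>\<bar>\<^sup>2\<close> under multiplication by \<open>\<alpha>\<close>.\<close>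

definition covol :: "complex \<Rightarrow> complex \<Rightarrow> real" where
  "covol u v = \<bar>Im (cnj u * v)\<bar>"

lemma covol_scale: "covol (\<alpha> * u) (\<alpha> * v) = (cmod \<alpha>)\<^sup>2 * covol u v"
proof -
  define z where "z = cnj u * v"
  have "cnj (\<alpha> * u) * (\<alpha> * v) = (\<alpha> * cnj \<alpha>) * z" by (simp add: z_def)
  then have "cnj (\<alpha> * u) * (\<alpha> * v) = of_real ((cmod \<alpha>)\<^sup>2) * z" by (simp only: complex_norm_square)
  then have "Im (cnj (\<alpha> * u) * (\<alpha> * v)) = (cmod \<alpha>)\<^sup>2 * Im z" by simp
  then show ?thesis by (simp only: covol_def z_def abs_mult abs_power2 power2_abs abs_of_nonneg[OF zero_le_power2])
qed

lemma covol_multiple: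
  assumes "u' \<in> Lat u v" "v' \<in> Lat u v"
  shows "\<exists>n::nat. covol u' v' = real n * covol u v"
proof -
  obtain a b where u: "u' = of_int a * u + of_int b * v" using assms by (auto simp: Lat_def)
  obtain c d where v: "v' = of_int c * u + of_int d * v" using assms by (auto simp: Lat_def)
  have "Im (cnj u' * v') = of_int (a * d - b * c) * Im (cnj u * v)"
    unfolding u v by (simp add: algebra_simps)
  then have "covol u' v' = real (nat \<bar>a * d - b * c\<bar>) * covol u v"
    by (simp add: covol_def abs_mult)
  then show ?thesis by blast
qed

text \<open>The covolumes of two bases of the same lattice are integer multiples of each other.\<close>

lemma covol_unique:
  assumes "Lat u v = Lat u' v'" "covol u v \<noteq> 0"
  shows "covol u v = covol u' v'"
proof -
  obtain n where n: "covol u' v' = real n * covol u v" using covol_multiple Lat_mem assms(1) by metis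
  obtain k where k: "covol u v = real k * covol u' v'" using covol_multiple Lat_mem assms(1) by metis
  have "covol u v = (real k * real n) * covol u v" using k unfolding n by (simp only: mult.assoc)
  then have "real k * real n = 1" using assms(2) by (simp only: mult_cancel_right1) simp
  then have "real (k * n) = real 1" by simp
  then have "k * n = 1" by (simp only: of_nat_eq_iff)
  then show ?thesis using n by simp
qed

context imaginary_quadratic
begin

abbreviation (input) "\<O> \<equiv> quad_integers D"

lemma pt_mem: "pt x y \<in> \<O>"
  by (auto simp: quad_integers_eq)

lemma O_memE: "z \<in> \<O> \<Longrightarrow> (\<And>x y. z = pt x y \<Longrightarrow> P) \<Longrightarrow> P"
  by (auto simp: quad_integers_eq)

lemma O_mult: "z \<in> \<O> \<Longrightarrow> w \<in> \<O> \<Longrightarrow> z * w \<in> \<O>"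
  by (elim O_memE) (simp add: pt_mult pt_mem)

lemma O_add: "z \<in> \<O> \<Longrightarrow> w \<in> \<O> \<Longrightarrow> z + w \<in> \<O>"
  by (elim O_memE) (simp add: pt_add pt_mem)

lemma int_in_O: "of_int n \<in> \<O>"
  using pt_mem[of n 0] by (simp add: pt_def)

lemma nat_in_O: "of_nat n \<in> \<O>"
  using int_in_O[of "int n"] by simp

lemma O_subset_field: "\<O> \<subseteq> quad_field D"
  by (auto simp: quad_integers_def)

definition int_ideal :: "complex set \<Rightarrow> bool" where
  "int_ideal J \<longleftrightarrow> J \<subseteq> \<O> \<and> 0 \<in> J \<and> J \<noteq> {0} \<and> (\<forall>x\<in>J. \<forall>y\<in>J. x + y \<in> J) \<and> (\<forall>z\<in>\<O>. \<forall>x\<in>J. z * x \<in> J)"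

lemma int_ideal_fractional: "int_ideal J \<Longrightarrow> fractional_ideal D J"
  unfolding int_ideal_def fractional_ideal_def
  using O_subset_field int_in_O[of 1] by (auto intro!: bexI[of _ 1])

lemma int_ideal_scale:
  assumes "0 \<in> I" "x \<in> I" "x \<noteq> 0" "\<And>x y. x \<in> I \<Longrightarrow> y \<in> I \<Longrightarrow> x + y \<in> I"
    "\<And>z x. z \<in> \<O> \<Longrightarrow> x \<in> I \<Longrightarrow> z * x \<in> I"
    and "\<alpha> \<noteq> 0" "(*) \<alpha> ` I \<subseteq> \<O>"
  shows "int_ideal ((*) \<alpha> ` I)"
  unfolding int_ideal_def
proof (intro conjI ballI)
  show "(*) \<alpha> ` I \<subseteq> \<O>" by (fact assms(7))
  show "0 \<in> (*) \<alpha> ` I" using assms(1) by (intro image_eqI[of _ _ 0]) simp_all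
  have "\<alpha> * x \<in> (*) \<alpha> ` I" "\<alpha> * x \<noteq> 0" using assms(2,3,6) by auto
  then show "(*) \<alpha> ` I \<noteq> {0}" by blast
next
  fix x y assume "x \<in> (*) \<alpha> ` I" "y \<in> (*) \<alpha> ` I"
  then obtain x' y' where "x = \<alpha> * x'" "y = \<alpha> * y'" "x' \<in> I" "y' \<in> I" by blast
  then show "x + y \<in> (*) \<alpha> ` I"
    using assms(4) by (intro image_eqI[of _ _ "x' + y'"]) (simp_all add: distrib_left)
next
  fix z x assume "z \<in> \<O>" "x \<in> (*) \<alpha> ` I"
  then obtain x' where "x = \<alpha> * x'" "x' \<in> I" "z \<in> \<O>" by blast
  then show "z * x \<in> (*) \<alpha> ` I" using assms(5) by (intro image_eqI[of _ _ "z * x'"]) simp_all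
qed

fun ideal_of :: "nat \<times> nat \<times> nat \<Rightarrow> complex set" where
  "ideal_of (k, a, b) = Lat (of_nat (k * a)) (of_nat k * (of_nat b + \<omega>))"

lemma ideal_of_mem_iff:
  "pt x y \<in> ideal_of (k, a, b) \<longleftrightarrow> (\<exists>s t. x = int k * (int a * s + int b * t) \<and> y = int k * t)"
proof -
  have "of_int s * of_nat (k * a) + of_int t * (of_nat k * (of_nat b + \<omega>))
      = pt (int k * (int a * s + int b * t)) (int k * t)" for s t
    by (simp add: pt_def algebra_simps)
  then show ?thesis by (simp add: Lat_def pt_eq_iff)
qed

lemma ideal_of_subset_O: "ideal_of \<tau> \<subseteq> \<O>"
proof -
  obtain k a b where \<tau>: "\<tau> = (k, a, b)" by (cases \<tau>)
  have "of_int s * of_nat (k * a) + of_int t * (of_nat k * (of_nat b + \<omega>))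
      = pt (int k * (int a * s + int b * t)) (int k * t)" for s t
    by (simp add: pt_def algebra_simps)
  then show ?thesis using pt_mem by (auto simp: Lat_def \<tau>)
qed

lemma ideal_of_int_ideal:
  assumes "(k, a, b) \<in> triples m"
  shows "int_ideal (ideal_of (k, a, b))"
proof -
  have k: "0 < k" "0 < a" and "a dvd b\<^sup>2 + b + m" using assms by (auto simp: triples_def quad_roots_def)
  then obtain g where "b\<^sup>2 + b + m = a * g" by (auto simp: dvd_def)
  then have "int (b\<^sup>2 + b + m) = int (a * g)" by (simp only:)
  then have g: "(int b)\<^sup>2 + int b + int m = int a * int g" by simp
  let ?J = "ideal_of (k, a, b)"
  have add: "x + y \<in> ?J" if x: "x \<in> ?J" and y: "y \<in> ?J" for x y
  proof -
    obtain x1 x2 y1 y2 where e: "x = pt x1 x2" "y = pt y1 y2" using x y ideal_of_subset_O by (meson O_memE subsetD)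
    obtain s t where st: "x1 = int k * (int a * s + int b * t)" "x2 = int k * t" using x by (auto simp: e ideal_of_mem_iff simp del: ideal_of.simps)
    obtain s' t' where st': "y1 = int k * (int a * s' + int b * t')" "y2 = int k * t'" using y by (auto simp: e ideal_of_mem_iff simp del: ideal_of.simps)
    show ?thesis unfolding e pt_add ideal_of_mem_iff st st'
      by (intro exI[of _ "s + s'"] exI[of _ "t + t'"]) (simp add: algebra_simps)
  qed
  have mult: "z * x \<in> ?J" if z: "z \<in> \<O>" and x: "x \<in> ?J" for z x
  proof -
    obtain p q where zz: "z = pt p q" using z by (rule O_memE)
    obtain x1 x2 where e: "x = pt x1 x2" using x ideal_of_subset_O by (meson O_memE subsetD)
    obtain s t where st: "x1 = int k * (int a * s + int b * t)" "x2 = int k * t" using x by (auto simp: e ideal_of_mem_iff simp del: ideal_of.simps)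
    have "p * x1 - int m * (q * x2) = int k * (int a * (p * s - q * (int b * s + int g * t)) + int b * (p * t + q * (int a * s + (int b + 1) * t)))"
    proof -
      have "int k * (int a * (p * s - q * (int b * s + int g * t)) + int b * (p * t + q * (int a * s + (int b + 1) * t)))
        = p * x1 + int k * q * t * ((int b)\<^sup>2 + int b - int a * int g)"
        unfolding st by (simp add: algebra_simps power2_eq_square)
      also have "(int b)\<^sup>2 + int b - int a * int g = - int m" using g by simp
      finally show ?thesis unfolding st by simp
    qed
    moreover have "p * x2 + q * x1 + q * x2 = int k * (p * t + q * (int a * s + (int b + 1) * t))"
      unfolding st by (simp add: algebra_simps)
    ultimately show ?thesis unfolding zz e pt_mult ideal_of_mem_iff by blast
  qed
  have "pt (int k * int a) 0 \<in> ?J" unfolding ideal_of_mem_iff by (rule exI[of _ 1], rule exI[of _ 0]) simp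
  moreover have "pt (int k * int a) 0 \<noteq> 0" using k by (simp add: pt_eq_0_iff)
  ultimately have "?J \<noteq> {0}" by blast
  moreover have "pt 0 0 \<in> ?J" unfolding ideal_of_mem_iff by (auto intro!: exI[of _ 0])
  then have "0 \<in> ?J" by (simp add: pt_def)
  ultimately show ?thesis unfolding int_ideal_def using ideal_of_subset_O add mult by blast
qed

text \<open>The second coordinates of \<open>J\<close> form a group \<open>k \<int>\<close>, and the integers in \<open>J\<close> a group \<open>e \<int>\<close>.  Multiplication
by \<open>\<omega>\<close> shows that \<open>k\<close> divides \<open>e\<close> and the first coordinate of any element with second coordinate
\<open>k\<close>.  Multiplication of \<open>k (b + \<omega>)\<close> by the conjugate of \<open>b + \<omega>\<close> gives the congruence for \<open>b\<close>.\<close>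

lemma int_ideal_structure:
  assumes J: "int_ideal J"
  shows "\<exists>\<tau>\<in>triples m. J = ideal_of \<tau>"
proof -
  have sub: "J \<subseteq> \<O>" and add: "\<And>x y. x \<in> J \<Longrightarrow> y \<in> J \<Longrightarrow> x + y \<in> J"
    and mult: "\<And>z x. z \<in> \<O> \<Longrightarrow> x \<in> J \<Longrightarrow> z * x \<in> J" and "0 \<in> J" "J \<noteq> {0}"
    using J by (auto simp: int_ideal_def)
  have diff: "x - y \<in> J" if "x \<in> J" "y \<in> J" for x y
    using add[OF that(1) mult[OF int_in_O[of "-1"] that(2)]] by simp
  have om: "pt (- int m * y) (x + y) \<in> J" if "pt x y \<in> J" for x y
    using mult[OF pt_mem[of 0 1] that] by (simp add: pt_mult)
  define G0 where "G0 = {x. pt x 0 \<in> J}"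
  define G1 where "G1 = {y. \<exists>x. pt x y \<in> J}"
  obtain z where z: "z \<in> J" "z \<noteq> 0" using \<open>0 \<in> J\<close> \<open>J \<noteq> {0}\<close> by blast
  obtain x0 y0 where z0: "z = pt x0 y0" using z sub by (meson O_memE subsetD)
  \<comment> \<open>the norm of a nonzero element, a nonzero integer in \<open>J\<close>\<close>
  define n0 where "n0 = x0\<^sup>2 + x0 * y0 + int m * y0\<^sup>2"
  have "real_of_int n0 \<noteq> 0" using z(2) cmod_pt[of x0 y0] z0 by (auto simp: n0_def)
  then have n0: "n0 \<noteq> 0" by simp
  have "pt (x0 + y0) (- y0) * pt x0 y0 = pt n0 0"
    unfolding pt_mult n0_def by (simp add: power2_eq_square algebra_simps)
  then have n0J: "pt n0 0 \<in> J" using mult[OF pt_mem z(1)[unfolded z0]] by metis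
  obtain e where e: "0 < e" "\<And>x. pt x 0 \<in> J \<longleftrightarrow> e dvd x"
    using int_subgroup_generator[of G0 n0] n0 n0J diff by (auto simp: G0_def pt_diff[symmetric]) (metis diff_0_right pt_diff)
  have G1c: "x - y \<in> G1" if "x \<in> G1" "y \<in> G1" for x y
    using that diff by (auto simp: G1_def) (metis pt_diff)
  have "n0 \<in> G1" using om[OF n0J] by (auto simp: G1_def)
  then obtain k where k: "0 < k" "\<And>y. y \<in> G1 \<longleftrightarrow> k dvd y"
    using int_subgroup_generator[of G1 n0] G1c n0 by blast
  obtain c where c: "pt c k \<in> J" using k(2)[of k] by (auto simp: G1_def)
  have "pt e 0 \<in> J" using e(2) by simp
  from om[OF this] have "e \<in> G1" by (auto simp: G1_def)
  then obtain a where a: "e = k * a" using k(2) by (auto simp: dvd_def)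
  have "c + k \<in> G1" using om[OF c] by (auto simp: G1_def)
  then have "k dvd c" using k(2) by (metis dvd_add_right_iff dvd_refl add.commute)
  then obtain b' where b': "c = k * b'" by (auto simp: dvd_def)
  have apos: "0 < a" using a e(1) k(1) by (simp add: zero_less_mult_iff)
  define b where "b = b' mod a"
  have b: "0 \<le> b" "b < a" using apos by (simp_all add: b_def)
  have kb: "pt (k * b) k \<in> J"
  proof -
    have "k * b = c - e * (b' div a)"
      unfolding b_def a b' minus_mult_div_eq_mod[symmetric] by (simp add: algebra_simps)
    moreover have "pt (e * (b' div a)) 0 \<in> J" using e(2) by simp
    from diff[OF c this] have "pt (c - e * (b' div a)) k \<in> J" by (simp add: pt_diff)
    ultimately show ?thesis by simp
  qed
  have root: "a dvd b\<^sup>2 + b + int m"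
  proof -
    have "pt (b + 1) (- 1) * pt (k * b) k = pt (k * (b\<^sup>2 + b + int m)) 0"
      unfolding pt_mult by (simp add: power2_eq_square algebra_simps)
    then have "pt (k * (b\<^sup>2 + b + int m)) 0 \<in> J" using mult[OF pt_mem kb] by metis
    then have "k * a dvd k * (b\<^sup>2 + b + int m)" using e(2) a by simp
    then show ?thesis using k(1) by simp
  qed
  have mem: "pt x y \<in> J \<longleftrightarrow> (\<exists>s t. x = k * (a * s + b * t) \<and> y = k * t)" for x y
  proof
    assume xy: "pt x y \<in> J"
    then have "y \<in> G1" by (auto simp: G1_def)
    then obtain t where t: "y = k * t" using k(2) by (auto simp: dvd_def)
    have "pt (t * (k * b)) (t * k) \<in> J" using mult[OF int_in_O[of t] kb] by (simp add: pt_def algebra_simps)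
    from diff[OF xy this] have "pt (x - t * (k * b)) 0 \<in> J" by (simp add: pt_diff t mult.commute)
    then obtain s where "x - t * (k * b) = k * a * s" using e(2) a by (auto simp: dvd_def)
    then have "x = k * (a * s + b * t)" by (simp add: algebra_simps)
    then show "\<exists>s t. x = k * (a * s + b * t) \<and> y = k * t" using t by blast
  next
    assume "\<exists>s t. x = k * (a * s + b * t) \<and> y = k * t"
    then obtain s t where st: "x = k * (a * s + b * t)" "y = k * t" by blast
    have 1: "pt (t * (k * b)) (t * k) \<in> J" using mult[OF int_in_O[of t] kb] by (simp add: pt_def algebra_simps)
    have 2: "pt (k * a * s) 0 \<in> J" using e(2) a by simp
    from add[OF 1 2] show "pt x y \<in> J" unfolding pt_add st by (simp add: algebra_simps)
  qed
  define \<tau> where "\<tau> = (nat k, nat a, nat b)"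
  have ints: "int (nat k) = k" "int (nat a) = a" "int (nat b) = b" using k(1) apos b by simp_all
  have "\<tau> \<in> triples m"
    using k(1) apos b root by (simp add: \<tau>_def triples_def quad_roots_def quad_roots_int ints del: int_nat_eq)
  moreover have "J = ideal_of \<tau>"
  proof (intro subset_antisym subsetI)
    fix z assume zJ: "z \<in> J"
    then obtain x y where "z = pt x y" using sub by (meson O_memE subsetD)
    then show "z \<in> ideal_of \<tau>" using zJ mem[of x y] ideal_of_mem_iff[of x y "nat k" "nat a" "nat b"]
      unfolding \<tau>_def ints by blast
  next
    fix z assume zJ: "z \<in> ideal_of \<tau>"
    then obtain x y where "z = pt x y" using ideal_of_subset_O by (meson O_memE subsetD)
    then show "z \<in> J" using zJ mem[of x y] ideal_of_mem_iff[of x y "nat k" "nat a" "nat b"]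
      unfolding \<tau>_def ints by blast
  qed
  ultimately show ?thesis by blast
qed

lemma ideal_of_inj:
  assumes t: "(k, a, b) \<in> triples m" "(k', a', b') \<in> triples m" and e: "ideal_of (k, a, b) = ideal_of (k', a', b')"
  shows "(k, a, b) = (k', a', b')"
proof -
  have pos: "0 < k" "0 < a" "b < a" "0 < k'" "0 < a'" "b' < a'" using t by (auto simp: triples_def quad_roots_def)
  have kd: "int k' dvd int k" "int k dvd int k'"
  proof -
    have "pt (int k * int b) (int k) \<in> ideal_of (k', a', b')"
      unfolding e[symmetric] ideal_of_mem_iff by (rule exI[of _ 0], rule exI[of _ 1]) simp
    then show "int k' dvd int k" unfolding ideal_of_mem_iff by (metis dvd_triv_left)
    have "pt (int k' * int b') (int k') \<in> ideal_of (k, a, b)"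
      unfolding e ideal_of_mem_iff by (rule exI[of _ 0], rule exI[of _ 1]) simp
    then show "int k dvd int k'" unfolding ideal_of_mem_iff by (metis dvd_triv_left)
  qed
  then have k: "k' = k" by (metis dvd_antisym int_dvd_int_iff)
  have ad: "int a' dvd int a" "int a dvd int a'"
  proof -
    have "pt (int k * int a) 0 \<in> ideal_of (k', a', b')"
      unfolding e[symmetric] ideal_of_mem_iff by (rule exI[of _ 1], rule exI[of _ 0]) simp
    then obtain s where "int a = int a' * s" unfolding ideal_of_mem_iff k using pos by auto
    then show "int a' dvd int a" by (rule dvdI)
    have "pt (int k' * int a') 0 \<in> ideal_of (k, a, b)"
      unfolding e ideal_of_mem_iff by (rule exI[of _ 1], rule exI[of _ 0]) simp
    then obtain s where "int a' = int a * s" unfolding ideal_of_mem_iff k using pos by auto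
    then show "int a dvd int a'" by (rule dvdI)
  qed
  then have a: "a' = a" by (metis dvd_antisym int_dvd_int_iff)
  have "pt (int k * int b) (int k) \<in> ideal_of (k', a', b')"
    unfolding e[symmetric] ideal_of_mem_iff by (rule exI[of _ 0], rule exI[of _ 1]) simp
  then obtain s where "int b = int a * s + int b'" unfolding ideal_of_mem_iff k a using pos by auto
  then have "[int b = int b'] (mod int a)" by (simp add: cong_iff_dvd_diff)
  then have "[b = b'] (mod a)" by (simp only: cong_int_iff)
  then have "b = b'" using pos a by (simp add: Cong.cong_def)
  then show ?thesis using k a by simp
qed

fun covol_ideal_of :: "nat \<times> nat \<times> nat \<Rightarrow> real" where
  "covol_ideal_of (k, a, b) = covol (of_nat (k * a)) (of_nat k * (of_nat b + \<omega>))"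

lemma covol_ideal_of: "covol_ideal_of \<tau> = real (triple_norm \<tau>) * Im \<omega>"
proof (cases \<tau>)
  case (fields k a b)
  have "Im (cnj (of_nat (k * a)) * (of_nat k * (of_nat b + \<omega>))) = real (k\<^sup>2 * a) * Im \<omega>"
    by (simp add: power2_eq_square)
  then show ?thesis using Im_omega by (simp add: fields covol_def triple_norm_def abs_mult)
qed

text \<open>Comparison of covolumes.\<close>

lemma ideal_of_norm_scale:
  assumes "\<tau> \<in> triples m" "\<tau>' \<in> triples m" and e: "(*) \<alpha> ` ideal_of \<tau> = ideal_of \<tau>'" and "\<alpha> \<noteq> 0"
  shows "real (triple_norm \<tau>') = (cmod \<alpha>)\<^sup>2 * real (triple_norm \<tau>)"
proof -
  obtain k a b where t: "\<tau> = (k, a, b)" by (cases \<tau>)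
  obtain k' a' b' where t': "\<tau>' = (k', a', b')" by (cases \<tau>')
  let ?u = "of_nat (k * a) :: complex" and ?v = "of_nat k * (of_nat b + \<omega>)"
  have "0 < triple_norm \<tau>" using assms(1) by (auto simp: t triple_norm_def triples_def)
  then have c0: "covol_ideal_of \<tau> \<noteq> 0" using Im_omega by (simp add: covol_ideal_of)
  have "Lat (\<alpha> * ?u) (\<alpha> * ?v) = Lat (of_nat (k' * a')) (of_nat k' * (of_nat b' + \<omega>))"
    using e unfolding t t' ideal_of.simps Lat_scale .
  moreover have s: "covol (\<alpha> * ?u) (\<alpha> * ?v) = (cmod \<alpha>)\<^sup>2 * covol_ideal_of \<tau>"
    unfolding covol_scale t by simp
  moreover have "covol (\<alpha> * ?u) (\<alpha> * ?v) \<noteq> 0" unfolding s using c0 assms(4) by simp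
  ultimately have "(cmod \<alpha>)\<^sup>2 * covol_ideal_of \<tau> = covol_ideal_of \<tau>'"
    unfolding t' covol_ideal_of.simps using covol_unique by metis
  then show ?thesis using Im_omega by (simp add: covol_ideal_of)
qed

end

section \<open>Ideal classes and their theta series\<close>

context imaginary_quadratic
begin

text \<open>The coset of a fractional ideal modulo the principal ones, as a set of lattices.\<close>

definition homothety_class :: "complex set \<Rightarrow> complex set set" where
  "homothety_class I = {(*) \<alpha> ` I | \<alpha>. \<alpha> \<in> quad_field D - {0}}"

lemma homothety_class_scale:
  assumes "\<gamma> \<in> quad_field D" "\<gamma> \<noteq> 0"
  shows "homothety_class ((*) \<gamma> ` I) = homothety_class I"
proof (intro subset_antisym subsetI)
  fix A assume "A \<in> homothety_class ((*) \<gamma> ` I)"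
  then obtain \<alpha> where \<alpha>: "\<alpha> \<in> quad_field D - {0}" "A = (*) \<alpha> ` (*) \<gamma> ` I" by (auto simp: homothety_class_def)
  have "A = (*) (\<alpha> * \<gamma>) ` I" unfolding \<alpha>(2) image_image by (simp add: mult.assoc)
  moreover have "\<alpha> * \<gamma> \<in> quad_field D - {0}" using \<alpha>(1) assms quad_field_mult by simp
  ultimately show "A \<in> homothety_class I" unfolding homothety_class_def by blast
next
  fix A assume "A \<in> homothety_class I"
  then obtain \<alpha> where \<alpha>: "\<alpha> \<in> quad_field D - {0}" "A = (*) \<alpha> ` I" by (auto simp: homothety_class_def)
  have "A = (*) (\<alpha> / \<gamma>) ` (*) \<gamma> ` I" unfolding \<alpha>(2) image_image using assms(2) by simp
  moreover have "\<alpha> / \<gamma> \<in> quad_field D - {0}" using \<alpha>(1) assms quad_field_divide by simp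
  ultimately show "A \<in> homothety_class ((*) \<gamma> ` I)" unfolding homothety_class_def by blast
qed

lemma homothety_class_self: "I \<in> homothety_class I"
proof -
  have "1 \<in> quad_field D - {0}" using pt_in_field[of 1 0] by (simp add: pt_def)
  moreover have "I = (*) 1 ` I" by simp
  ultimately show ?thesis unfolding homothety_class_def by blast
qed

text \<open>Products of ideals enter the class group only through principal factors, and
multiplication by \<open>\<alpha> \<O>\<close> is just multiplication by \<open>\<alpha>\<close>.\<close>

lemma ideal_times_principal:
  assumes I: "fractional_ideal D I"
  shows "ideal_times ((*) \<alpha> ` quad_integers D) I = (*) \<alpha> ` I"
proof (intro subset_antisym subsetI)
  fix z assume "z \<in> ideal_times ((*) \<alpha> ` quad_integers D) I"
  then obtain n a b where z: "z = (\<Sum>i<n. a i * b i)"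
    and ab: "\<forall>i<(n::nat). a i \<in> (*) \<alpha> ` quad_integers D \<and> b i \<in> I"
    unfolding ideal_times_def by blast
  have "\<exists>c. c \<in> quad_integers D \<and> a i = \<alpha> * c" if "i < n" for i using ab that by blast
  then obtain c where c: "\<And>i. i < n \<Longrightarrow> c i \<in> quad_integers D \<and> a i = \<alpha> * c i" by metis
  have cb: "c i * b i \<in> I" if "i < n" for i
    using I c[OF that] ab that unfolding fractional_ideal_def by blast
  have closed: "0 \<in> I" "\<And>x y. x \<in> I \<Longrightarrow> y \<in> I \<Longrightarrow> x + y \<in> I"
    using I unfolding fractional_ideal_def by blast+
  have "(\<Sum>i<k. c i * b i) \<in> I" if "k \<le> n" for k
    using that by (induction k) (use closed cb in auto)
  then have "(\<Sum>i<n. c i * b i) \<in> I" by blast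
  moreover have "z = \<alpha> * (\<Sum>i<n. c i * b i)"
    unfolding z sum_distrib_left using c by (intro sum.cong refl) (simp add: mult.assoc)
  ultimately show "z \<in> (*) \<alpha> ` I" by blast
next
  fix z assume "z \<in> (*) \<alpha> ` I"
  then obtain x where x: "x \<in> I" "z = \<alpha> * x" by blast
  have "\<alpha> * 1 \<in> (*) \<alpha> ` quad_integers D" using int_in_O[of 1] by auto
  then have p: "\<forall>i<Suc 0. \<alpha> * 1 \<in> (*) \<alpha> ` quad_integers D \<and> x \<in> I" using x by simp
  have q: "z = (\<Sum>i<Suc 0. (\<alpha> * 1) * x)" by (simp add: x)
  have "\<exists>n a b. z = (\<Sum>i<(n::nat). a i * b i) \<and> (\<forall>i<n. a i \<in> (*) \<alpha> ` quad_integers D \<and> b i \<in> I)"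
    by (rule exI[of _ "Suc 0"], rule exI[of _ "\<lambda>_. \<alpha> * 1"], rule exI[of _ "\<lambda>_. x"]) (rule conjI[OF q p])
  then show "z \<in> ideal_times ((*) \<alpha> ` quad_integers D) I"
    unfolding ideal_times_def by simp
qed

lemma class_number_homothety_class: "class_number D = card (homothety_class ` {I. fractional_ideal D I})"
proof -
  have "principal_fractional_ideals D #>\<^bsub>fractional_ideal_group D\<^esub> I = homothety_class I" if I: "fractional_ideal D I" for I
    unfolding r_coset_def principal_fractional_ideals_def homothety_class_def fractional_ideal_group_def
    using ideal_times_principal[OF I] by auto
  then have "rcosets\<^bsub>fractional_ideal_group D\<^esub> (principal_fractional_ideals D) = homothety_class ` {I. fractional_ideal D I}"
    unfolding RCOSETS_def by (auto simp: fractional_ideal_group_def)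
  then show ?thesis unfolding class_number_def order_def ideal_class_group_def FactGroup_def by simp
qed

definition triple_class :: "nat \<times> nat \<times> nat \<Rightarrow> complex set set" where
  "triple_class \<tau> = homothety_class (ideal_of \<tau>)"

lemma classes_eq_image_triples: "homothety_class ` {I. fractional_ideal D I} = triple_class ` triples m"
proof (intro subset_antisym subsetI)
  fix c assume "c \<in> homothety_class ` {I. fractional_ideal D I}"
  then obtain I where I: "fractional_ideal D I" "c = homothety_class I" by blast
  obtain d where d: "d \<in> quad_integers D" "d \<noteq> 0" "\<forall>x\<in>I. d * x \<in> quad_integers D"
    using I(1) unfolding fractional_ideal_def by blast
  have I': "0 \<in> I" "I \<noteq> {0}" "\<And>x y. x \<in> I \<Longrightarrow> y \<in> I \<Longrightarrow> x + y \<in> I"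
    "\<And>z x. z \<in> quad_integers D \<Longrightarrow> x \<in> I \<Longrightarrow> z * x \<in> I"
    using I(1) unfolding fractional_ideal_def by blast+
  obtain x where x: "x \<in> I" "x \<noteq> 0" using I'(1,2) by blast
  have "(*) d ` I \<subseteq> quad_integers D" using d(3) by blast
  with I'(1) x I'(3,4) d(2) have "int_ideal ((*) d ` I)" by (rule int_ideal_scale)
  then obtain \<tau> where \<tau>: "\<tau> \<in> triples m" "(*) d ` I = ideal_of \<tau>" using int_ideal_structure by blast
  have "d \<in> quad_field D" using d(1) O_subset_field by blast
  then have "c = triple_class \<tau>" using homothety_class_scale[of d I] d(2) I(2) \<tau>(2) by (simp add: triple_class_def)
  then show "c \<in> triple_class ` triples m" using \<tau>(1) by blast
next
  fix c assume "c \<in> triple_class ` triples m"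
  then obtain \<tau> where \<tau>: "\<tau> \<in> triples m" "c = triple_class \<tau>" by blast
  have "fractional_ideal D (ideal_of \<tau>)"
    using \<tau>(1) ideal_of_int_ideal int_ideal_fractional by (cases \<tau>) blast
  then show "c \<in> homothety_class ` {I. fractional_ideal D I}" using \<tau>(2) by (auto simp: triple_class_def)
qed

lemma triple_class_eqD:
  assumes "triple_class \<tau> = triple_class \<tau>'"
  shows "\<exists>\<alpha>. \<alpha> \<in> quad_field D \<and> \<alpha> \<noteq> 0 \<and> (*) \<alpha> ` ideal_of \<tau> = ideal_of \<tau>'"
proof -
  have "ideal_of \<tau>' \<in> homothety_class (ideal_of \<tau>)" using assms homothety_class_self[of "ideal_of \<tau>'"] by (simp add: triple_class_def)
  then show ?thesis unfolding homothety_class_def by blast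
qed

lemma triple_class_eqI:
  assumes "\<alpha> \<in> quad_field D" "\<alpha> \<noteq> 0" "(*) \<alpha> ` ideal_of \<tau> = ideal_of \<tau>'"
  shows "triple_class \<tau>' = triple_class \<tau>"
  using homothety_class_scale[OF assms(1,2), of "ideal_of \<tau>"] assms(3) by (simp add: triple_class_def)

text \<open>Gauss reduction.  Choose \<open>a\<close> minimal for the class and shift \<open>b\<close> by a multiple of \<open>a\<close> so that
\<open>\<bar>2 b + 1\<bar> \<le> a\<close>.  If \<open>b\<^sup>2 + b + m = a g\<close>, then multiplication by the conjugate of \<open>b + \<omega>\<close> over \<open>a\<close> exchanges the
roles of \<open>a\<close> and \<open>g\<close>, so \<open>a \<le> g\<close> and hence \<open>3 a\<^sup>2 \<le> 4 m - 1\<close>.\<close>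

lemma class_minimal_form:
  assumes c: "c \<in> triple_class ` triples m"
  shows "\<exists>a b. (1, a, b) \<in> triples m \<and> a \<le> 4 * m \<and> triple_class (1, a, b) = c"
proof -
  define P where "P a \<longleftrightarrow> (\<exists>b. (1, a, b) \<in> triples m \<and> triple_class (1, a, b) = c)" for a
  have "\<exists>a. P a"
  proof -
    obtain k a b where t: "(k, a, b) \<in> triples m" "c = triple_class (k, a, b)" using c by auto
    have t1: "(1, a, b) \<in> triples m" using t(1) by (simp add: triples_def)
    have "(*) (of_nat k) ` ideal_of (1, a, b) = ideal_of (k, a, b)"
      unfolding ideal_of.simps Lat_scale by simp
    moreover have "of_nat k \<in> quad_field D" by (rule subsetD[OF O_subset_field nat_in_O])
    moreover have "of_nat k \<noteq> (0::complex)" using t(1) by (simp add: triples_def)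
    ultimately have "triple_class (k, a, b) = triple_class (1, a, b)" using triple_class_eqI by blast
    then show ?thesis using t1 t(2) by (auto simp: P_def)
  qed
  define a where "a = (LEAST a. P a)"
  have "P a" unfolding a_def using \<open>\<exists>a. P a\<close> by (rule LeastI_ex)
  then obtain b where b: "(1, a, b) \<in> triples m" "triple_class (1, a, b) = c" by (auto simp: P_def)
  have a0: "0 < a" and rt: "int a dvd (int b)\<^sup>2 + int b + int m"
    using b(1) by (auto simp: triples_def quad_roots_def quad_roots_int)
  \<comment> \<open>the representative of \<open>b\<close> modulo \<open>a\<close> with \<open>\<bar>2 b + 1\<bar> \<le> a\<close>\<close>
  define b' where "b' = (if 2 * int b + 1 \<le> int a then int b else int b - int a)"
  have b'_bound: "\<bar>2 * b' + 1\<bar> \<le> int a"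
    using b(1) by (auto simp: b'_def triples_def quad_roots_def)
  have "b' = int b + (if 2 * int b + 1 \<le> int a then 0 else -1) * int a" by (simp add: b'_def)
  then obtain s where s: "b' = int b + s * int a" by blast
  have "int a dvd b'\<^sup>2 + b' + int m"
  proof -
    have e: "b'\<^sup>2 + b' + int m = ((int b)\<^sup>2 + int b + int m) + int a * (s * (2 * int b + s * int a + 1))"
      unfolding s by (simp add: power2_eq_square algebra_simps)
    show ?thesis unfolding e by (intro dvd_add rt dvd_triv_left)
  qed
  then obtain g where g: "b'\<^sup>2 + b' + int m = int a * g" by (auto simp: dvd_def)
  have four: "4 * (int a * g) = (2 * b' + 1)\<^sup>2 + (4 * int m - 1)"
    unfolding g[symmetric] by (simp add: power2_eq_square algebra_simps)
  have "0 < 4 * (int a * g)" unfolding four using m_ge_2 by (intro add_nonneg_pos) simp_all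
  then have g0: "0 < g" using a0 by (simp add: zero_less_mult_iff)
  define b'' where "b'' = nat ((- b' - 1) mod g)"
  have b''r: "b'' \<in> quad_roots m (nat g)"
  proof -
    have "int (nat g) dvd (- b' - 1)\<^sup>2 + (- b' - 1) + int m"
    proof -
      have "(- b' - 1)\<^sup>2 + (- b' - 1) + int m = g * int a"
        using g by (simp add: power2_eq_square algebra_simps)
      then show ?thesis using g0 by simp
    qed
    from quad_roots_mod[OF _ this] g0 show ?thesis by (simp add: b''_def)
  qed
  then have tr: "(1, nat g, b'') \<in> triples m" using g0 by (simp add: triples_def)
  \<comment> \<open>the conjugate of \<open>b + \<omega>\<close>, divided by \<open>a\<close>\<close>
  define \<beta> where "\<beta> = (of_int b' + 1 - \<omega>) / of_nat a"
  have \<beta>K: "\<beta> \<in> quad_field D"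
  proof -
    have "of_int b' + 1 - \<omega> = pt (b' + 1) (-1)" by (simp add: pt_def)
    then show ?thesis unfolding \<beta>_def using pt_in_field nat_in_O O_subset_field by (intro quad_field_divide) auto
  qed
  have \<beta>0: "\<beta> \<noteq> 0"
  proof -
    have "pt (b' + 1) (-1) \<noteq> 0" by (simp add: pt_eq_0_iff)
    then show ?thesis using a0 by (simp add: \<beta>_def pt_def)
  qed
  have \<beta>1: "\<beta> * of_nat a = of_int b' + 1 - \<omega>" using a0 by (simp add: \<beta>_def)
  have \<beta>2: "\<beta> * (of_int b' + \<omega>) = of_int g"
  proof -
    have "(of_int b' + 1 - \<omega>) * (of_int b' + \<omega>) = of_int b' * of_int b' + of_int b' + \<omega> - \<omega> * \<omega>"
      by (simp add: algebra_simps)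
    also have "\<dots> = of_int (b'\<^sup>2 + b' + int m)" unfolding omega_squared by (simp add: power2_eq_square)
    also have "\<dots> = of_int g * of_nat a" unfolding g by simp
    finally show ?thesis using a0 by (simp add: \<beta>_def field_simps)
  qed
  have L1: "ideal_of (1, a, b) = Lat (of_nat a) (of_int b' + \<omega>)"
  proof (intro subset_antisym)
    have m1: "of_nat a \<in> Lat (of_nat a) (of_int b' + \<omega>)" "of_nat a \<in> ideal_of (1, a, b)"
      using Lat_mem by simp_all
    have "of_nat b + \<omega> = of_int (- s) * of_nat a + of_int 1 * (of_int b' + \<omega>)" by (simp add: s)
    then have "of_nat b + \<omega> \<in> Lat (of_nat a) (of_int b' + \<omega>)" unfolding Lat_def by blast
    then show "ideal_of (1, a, b) \<subseteq> Lat (of_nat a) (of_int b' + \<omega>)"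
      using Lat_sub[OF m1(1)] by simp
    have "of_int b' + \<omega> = of_int s * of_nat a + of_int 1 * (of_nat b + \<omega>)" by (simp add: s)
    then have "of_int b' + \<omega> \<in> Lat (of_nat a) (of_nat b + \<omega>)" unfolding Lat_def by blast
    then show "Lat (of_nat a) (of_int b' + \<omega>) \<subseteq> ideal_of (1, a, b)"
      using Lat_sub[OF Lat_mem(1)] by simp
  qed
  have L2: "ideal_of (1, nat g, b'') = Lat (of_int b' + 1 - \<omega>) (of_int g)"
  proof -
    define q where "q = (- b' - 1) div g"
    have nb: "of_nat b'' = (of_int ((- b' - 1) mod g) :: complex)" using g0 by (simp add: b''_def)
    have e: "(- b' - 1) mod g = - b' - 1 - g * q" by (simp add: q_def minus_mult_div_eq_mod)
    have ng: "of_nat (nat g) = (of_int g :: complex)" using g0 by simp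
    have i: "ideal_of (1, nat g, b'') = Lat (of_int g) (of_int (- b' - 1 - g * q) + \<omega>)"
      by (simp only: ideal_of.simps of_nat_1 mult_1 ng nb e)
    show ?thesis unfolding i
    proof (intro subset_antisym)
      let ?R = "Lat (of_int b' + 1 - \<omega>) (of_int g)" and ?L = "Lat (of_int g) (of_int (- b' - 1 - g * q) + \<omega>)"
      have "of_int (- b' - 1 - g * q) + \<omega> = of_int (-1) * (of_int b' + 1 - \<omega>) + of_int (- q) * of_int g"
        by (simp add: algebra_simps)
      then have "of_int (- b' - 1 - g * q) + \<omega> \<in> ?R" unfolding Lat_def by blast
      then show "?L \<subseteq> ?R" using Lat_sub[OF Lat_mem(2)] by blast
      have "of_int b' + 1 - \<omega> = of_int (- q) * of_int g + of_int (-1) * (of_int (- b' - 1 - g * q) + \<omega>)"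
        by (simp add: algebra_simps)
      then have "of_int b' + 1 - \<omega> \<in> ?L" unfolding Lat_def by blast
      then show "?R \<subseteq> ?L" using Lat_sub[OF _ Lat_mem(1)] by blast
    qed
  qed
  have "(*) \<beta> ` ideal_of (1, a, b) = ideal_of (1, nat g, b'')"
    unfolding L1 L2 Lat_scale \<beta>1 \<beta>2 ..
  then have "triple_class (1, nat g, b'') = c" using triple_class_eqI[OF \<beta>K \<beta>0] b(2) by blast
  then have "P (nat g)" using tr by (auto simp: P_def)
  then have "a \<le> nat g" unfolding a_def by (rule Least_le)
  then have ag: "int a \<le> g" using g0 by simp
  have "int a * int a \<le> int a * g" using ag by (intro mult_left_mono) simp_all
  moreover have "(2 * b' + 1)\<^sup>2 \<le> int a * int a"
    using power_mono[OF b'_bound, of 2] by (simp add: power2_eq_square)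
  ultimately have "3 * (int a * int a) \<le> 4 * int m - 1" using four by linarith
  moreover have "int a * 1 \<le> int a * int a" using a0 by (intro mult_left_mono) simp_all
  ultimately have "a \<le> 4 * m" by linarith
  then show ?thesis using b by blast
qed

lemma finite_classes: "finite (triple_class ` triples m)"
proof (rule finite_subset)
  show "triple_class ` triples m \<subseteq> (\<lambda>(a, b). triple_class (1, a, b)) ` ({..4 * m} \<times> {..4 * m})"
  proof
    fix c assume "c \<in> triple_class ` triples m"
    from class_minimal_form[OF this] obtain a b where ab: "(1, a, b) \<in> triples m" "a \<le> 4 * m" "triple_class (1, a, b) = c" by blast
    have "b < a" using ab(1) by (simp add: triples_def quad_roots_def)
    then show "c \<in> (\<lambda>(a, b). triple_class (1, a, b)) ` ({..4 * m} \<times> {..4 * m})"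
      using ab by (intro image_eqI[of _ _ "(a, b)"]) auto
  qed
qed simp

lemma ideal_of_contains_int:
  assumes "(k, a, b) \<in> triples m"
  shows "of_nat (k * a) \<in> ideal_of (k, a, b)" "of_nat (k * a) \<noteq> (0 :: complex)"
  using assms Lat_mem by (simp_all add: triples_def)

text \<open>The quotient \<open>\<epsilon>\<close> preserves a lattice, so it satisfies the characteristic equation of an integer
matrix and is an algebraic integer; comparison of covolumes shows \<open>\<bar>\<epsilon>\<bar> = 1\<close>.  In
coordinates this is \<open>(2 x + y)\<^sup>2 + (4 m - 1) y\<^sup>2 = 4\<close> with \<open>m \<ge> 2\<close>.\<close>

lemma multiplier_eq_unit:
  assumes \<tau>: "\<tau> \<in> triples m" and e: "(*) \<alpha> ` ideal_of \<tau> = (*) \<beta> ` ideal_of \<tau>" and nz: "\<alpha> \<noteq> 0" "\<beta> \<noteq> 0"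
  shows "\<beta> = \<alpha> \<or> \<beta> = - \<alpha>"
proof -
  obtain k a b where t: "\<tau> = (k, a, b)" by (cases \<tau>)
  define \<epsilon> where "\<epsilon> = \<beta> / \<alpha>"
  have \<epsilon>0: "\<epsilon> \<noteq> 0" using nz by (simp add: \<epsilon>_def)
  have inv: "(*) \<epsilon> ` ideal_of \<tau> = ideal_of \<tau>"
  proof -
    have "(*) \<epsilon> ` ideal_of \<tau> = (*) (1 / \<alpha>) ` (*) \<beta> ` ideal_of \<tau>" unfolding image_image \<epsilon>_def by simp
    also have "\<dots> = ideal_of \<tau>" unfolding e[symmetric] image_image using nz by simp
    finally show ?thesis .
  qed
  have "real (triple_norm \<tau>) = (cmod \<epsilon>)\<^sup>2 * real (triple_norm \<tau>)"
    by (rule ideal_of_norm_scale[OF \<tau> \<tau> inv \<epsilon>0])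
  moreover have "triple_norm \<tau> \<noteq> 0" using \<tau> by (auto simp: t triples_def triple_norm_def)
  ultimately have norm1: "(cmod \<epsilon>)\<^sup>2 = 1" by simp
  define u v where "u = (of_nat (k * a) :: complex)" and "v = of_nat k * (of_nat b + \<omega>)"
  have L: "ideal_of \<tau> = Lat u v" by (simp add: t u_def v_def)
  have u0: "u \<noteq> 0" "u \<in> quad_field D"
    using ideal_of_contains_int[of k a b] \<tau> nat_in_O[of "k * a"] O_subset_field unfolding t u_def by blast+
  have v0: "v \<noteq> 0"
  proof -
    have "Im v = real k * Im \<omega>" by (simp add: v_def)
    then have "Im v \<noteq> 0" using Im_omega \<tau> by (simp add: t triples_def)
    then show ?thesis by auto
  qed
  have "\<epsilon> * u \<in> Lat u v" "\<epsilon> * v \<in> Lat u v"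
    using inv Lat_mem unfolding L by blast+
  then obtain p q p' q' where pq: "\<epsilon> * u = of_int p * u + of_int q * v" "\<epsilon> * v = of_int p' * u + of_int q' * v"
    by (auto simp: Lat_def)
  have "(\<epsilon> - of_int p) * u = of_int q * v" "(\<epsilon> - of_int q') * v = of_int p' * u"
    using pq by (simp_all add: algebra_simps)
  then have "((\<epsilon> - of_int p) * u) * ((\<epsilon> - of_int q') * v) = (of_int q * v) * (of_int p' * u)" by simp
  then have "((\<epsilon> - of_int p) * (\<epsilon> - of_int q') - of_int q * of_int p') * (u * v) = 0"
    by (simp add: algebra_simps)
  then have char: "(\<epsilon> - of_int p) * (\<epsilon> - of_int q') - of_int q * of_int p' = 0" using u0 v0 by simp
  have "algebraic_int \<epsilon>"
  proof (rule algebraic_int.intros)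
    let ?p = "[:of_int (p * q' - q * p'), - of_int (p + q'), 1:] :: complex poly"
    show "lead_coeff ?p = 1" by simp
    show "\<forall>i. poly.coeff ?p i \<in> \<int>"
    proof
      fix i show "poly.coeff ?p i \<in> \<int>"
        by (cases i; simp; cases "i - 1"; simp add: coeff_pCons split: nat.split)
    qed
    show "poly ?p \<epsilon> = 0" using char by (simp add: algebra_simps)
  qed
  moreover have "\<epsilon> \<in> quad_field D"
  proof -
    have "\<epsilon> * u \<in> ideal_of \<tau>" using inv Lat_mem unfolding L by blast
    then have "\<epsilon> * u \<in> quad_field D" using ideal_of_subset_O O_subset_field by blast
    then have "(\<epsilon> * u) / u \<in> quad_field D" using u0 quad_field_divide by blast
    then show ?thesis using u0 by simp
  qed
  ultimately have "\<epsilon> \<in> quad_integers D" by (simp add: quad_integers_def)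
  then obtain x y where xy: "\<epsilon> = pt x y" by (rule O_memE)
  have "real_of_int (x\<^sup>2 + x * y + int m * y\<^sup>2) = real_of_int 1" using norm1 cmod_pt[of x y] xy by simp
  then have n1: "x\<^sup>2 + x * y + int m * y\<^sup>2 = 1" by (simp only: of_int_eq_iff)
  have "4 * (x\<^sup>2 + x * y + int m * y\<^sup>2) = (2 * x + y)\<^sup>2 + (4 * int m - 1) * y\<^sup>2"
    by (simp add: power2_eq_square algebra_simps)
  then have f: "(2 * x + y)\<^sup>2 + (4 * int m - 1) * y\<^sup>2 = 4" unfolding n1 by simp
  have "y = 0"
  proof (rule ccontr)
    assume "y \<noteq> 0"
    then have "1 \<le> y\<^sup>2" by (simp add: int_one_le_iff_zero_less)
    then have "7 * 1 \<le> (4 * int m - 1) * y\<^sup>2" using m_ge_2 by (intro mult_mono) simp_all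
    moreover have "0 \<le> (2 * x + y)\<^sup>2" by simp
    ultimately show False using f by linarith
  qed
  then have "x\<^sup>2 = 1" using n1 by simp
  then have "x = 1 \<or> x = -1" by (simp add: power2_eq_1_iff)
  then have "\<epsilon> = 1 \<or> \<epsilon> = -1" using xy \<open>y = 0\<close> by (auto simp: pt_def)
  then show ?thesis using nz by (auto simp: \<epsilon>_def field_simps)
qed

text \<open>The inverse ideal of \<open>ideal_of \<tau>\<close>: its nonzero elements parametrise the integral ideals in the class.\<close>

definition multipliers :: "nat \<times> nat \<times> nat \<Rightarrow> complex set" where
  "multipliers \<tau> = {\<alpha>. (*) \<alpha> ` ideal_of \<tau> \<subseteq> quad_integers D}"

text \<open>Multiplied by a positive integer \<open>e\<close> of the ideal, the multipliers form an integral ideal,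
whose shape is known.\<close>

lemma multipliers_lattice:
  assumes \<tau>: "\<tau> \<in> triples m"
  shows "\<exists>u v. Im (cnj u * v) \<noteq> 0 \<and> multipliers \<tau> = Lat u v" and "multipliers \<tau> \<subseteq> quad_field D"
proof -
  obtain k a b where t: "\<tau> = (k, a, b)" by (cases \<tau>)
  define e where "e = (of_nat (k * a) :: complex)"
  have e: "e \<in> ideal_of \<tau>" "e \<noteq> 0" using ideal_of_contains_int \<tau> unfolding t e_def by blast+
  have eO: "e \<in> quad_integers D" using e(1) ideal_of_subset_O by blast
  have eM: "e * \<alpha> \<in> quad_integers D" if "\<alpha> \<in> multipliers \<tau>" for \<alpha>
    using that e(1) by (auto simp: multipliers_def mult.commute)
  show "multipliers \<tau> \<subseteq> quad_field D"
  proof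
    fix \<alpha> assume "\<alpha> \<in> multipliers \<tau>"
    then have "(e * \<alpha>) / e \<in> quad_field D" using eM eO O_subset_field by (intro quad_field_divide) auto
    then show "\<alpha> \<in> quad_field D" using e(2) by simp
  qed
  let ?J = "(*) e ` multipliers \<tau>"
  have M01: "0 \<in> multipliers \<tau>" "1 \<in> multipliers \<tau>"
    using int_in_O[of 0] ideal_of_subset_O by (auto simp: multipliers_def)
  have add: "x + y \<in> multipliers \<tau>" if "x \<in> multipliers \<tau>" "y \<in> multipliers \<tau>" for x y
    using that by (auto simp: multipliers_def distrib_right image_subset_iff intro: O_add)
  have mult: "z * x \<in> multipliers \<tau>" if "z \<in> quad_integers D" "x \<in> multipliers \<tau>" for z x
    using that O_mult by (auto simp: multipliers_def mult.assoc image_subset_iff)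
  have "?J \<subseteq> quad_integers D" using eM by blast
  with M01 one_neq_zero add mult e(2) have "int_ideal ?J" by (rule int_ideal_scale)
  then obtain \<tau>' where \<tau>': "\<tau>' \<in> triples m" "?J = ideal_of \<tau>'" using int_ideal_structure by blast
  obtain k' a' b' where t': "\<tau>' = (k', a', b')" by (cases \<tau>')
  define u v where "u = (1 / e) * of_nat (k' * a')" and "v = (1 / e) * (of_nat k' * (of_nat b' + \<omega>))"
  have "multipliers \<tau> = (*) (1 / e) ` ?J" unfolding image_image using e(2) by simp
  also have "\<dots> = Lat u v" unfolding \<tau>'(2) t' ideal_of.simps Lat_scale u_def v_def ..
  finally have M: "multipliers \<tau> = Lat u v" .
  have "covol u v = (cmod (1 / e))\<^sup>2 * covol_ideal_of \<tau>'"
    unfolding u_def v_def covol_scale t' by simp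
  moreover have "0 < triple_norm \<tau>'" using \<tau>'(1) by (auto simp: t' triples_def triple_norm_def)
  ultimately have "covol u v \<noteq> 0" using e(2) Im_omega by (simp add: covol_ideal_of)
  then have "Im (cnj u * v) \<noteq> 0" by (simp add: covol_def)
  then show "\<exists>u v. Im (cnj u * v) \<noteq> 0 \<and> multipliers \<tau> = Lat u v" using M by blast
qed

text \<open>Each ideal of the class is \<open>\<alpha>\<close> times the given one for exactly two multipliers \<open>\<plusminus>\<alpha>\<close>, whence the
factor \<open>1 / 2\<close>, and its norm is \<open>\<bar>\<alpha>\<bar>\<^sup>2\<close> times the norm of the given ideal.\<close>

lemma class_theta_sum:
  assumes \<tau>: "\<tau> \<in> triples m"
  shows "\<exists>u v. Im (cnj u * v) \<noteq> 0 \<and> (\<forall>t>0.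
    ((\<lambda>\<sigma>. exp (- t * real (triple_norm \<sigma>))) has_sum (theta u v (real (triple_norm \<tau>) * t) / 2))
      {\<sigma>\<in>triples m. triple_class \<sigma> = triple_class \<tau>})"
proof -
  obtain u v where uv: "Im (cnj u * v) \<noteq> 0" and M: "multipliers \<tau> = Lat u v"
    using multipliers_lattice(1)[OF \<tau>] by blast
  define n where "n = real (triple_norm \<tau>)"
  have n: "0 < n" using \<tau> by (auto simp: n_def triples_def triple_norm_def)
  let ?T = "{\<sigma>\<in>triples m. triple_class \<sigma> = triple_class \<tau>}"
  define F where "F \<sigma> = {\<alpha>\<in>multipliers \<tau> - {0}. (*) \<alpha> ` ideal_of \<tau> = ideal_of \<sigma>}" for \<sigma>
  have norm: "real (triple_norm \<sigma>) = n * (cmod \<alpha>)\<^sup>2" if "\<sigma> \<in> ?T" "\<alpha> \<in> F \<sigma>" for \<sigma> \<alpha>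
    using ideal_of_norm_scale[OF \<tau>, of \<sigma> \<alpha>] that by (simp add: F_def n_def mult.commute)
  have F2: "\<exists>\<alpha>. \<alpha> \<noteq> 0 \<and> F \<sigma> = {\<alpha>, - \<alpha>}" if \<sigma>: "\<sigma> \<in> ?T" for \<sigma>
  proof -
    have "triple_class \<tau> = triple_class \<sigma>" using \<sigma> by simp
    from triple_class_eqD[OF this] obtain \<alpha> where \<alpha>: "\<alpha> \<in> quad_field D" "\<alpha> \<noteq> 0" "(*) \<alpha> ` ideal_of \<tau> = ideal_of \<sigma>" by blast
    have neg: "(*) (- \<alpha>) ` ideal_of \<tau> = (*) \<alpha> ` ideal_of \<tau>" for \<alpha>
    proof -
      have uminus: "- x \<in> ideal_of \<tau>" if "x \<in> ideal_of \<tau>" for x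
      proof -
        obtain k a b where t: "\<tau> = (k, a, b)" by (cases \<tau>)
        have "int_ideal (ideal_of \<tau>)" using ideal_of_int_ideal \<tau> unfolding t by blast
        then have "(-1) * x \<in> ideal_of \<tau>" using that int_in_O[of "-1"] unfolding int_ideal_def by (metis of_int_1 of_int_minus)
        then show ?thesis by simp
      qed
      have sub: "(*) (- \<alpha>) ` ideal_of \<tau> \<subseteq> (*) \<alpha> ` ideal_of \<tau>" for \<alpha>
      proof
        fix z assume "z \<in> (*) (- \<alpha>) ` ideal_of \<tau>"
        then obtain x where "x \<in> ideal_of \<tau>" "z = \<alpha> * (- x)" by auto
        then show "z \<in> (*) \<alpha> ` ideal_of \<tau>" using uminus by blast
      qed
      show ?thesis using sub[of \<alpha>] sub[of "- \<alpha>"] by simp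
    qed
    have "\<alpha> \<in> F \<sigma>" "- \<alpha> \<in> F \<sigma>"
      using \<alpha> neg ideal_of_subset_O by (auto simp: F_def multipliers_def)
    moreover have "\<beta> = \<alpha> \<or> \<beta> = - \<alpha>" if "\<beta> \<in> F \<sigma>" for \<beta>
      using that \<alpha> by (intro multiplier_eq_unit[OF \<tau>]) (auto simp: F_def)
    ultimately have "F \<sigma> = {\<alpha>, - \<alpha>}" by blast
    then show ?thesis using \<alpha>(2) by blast
  qed
  have surj: "\<exists>\<sigma>\<in>?T. \<alpha> \<in> F \<sigma>" if \<alpha>: "\<alpha> \<in> multipliers \<tau> - {0}" for \<alpha>
  proof -
    obtain k a b where t: "\<tau> = (k, a, b)" by (cases \<tau>)
    have I: "int_ideal (ideal_of \<tau>)" using ideal_of_int_ideal \<tau> unfolding t by blast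
    have I': "0 \<in> ideal_of \<tau>" "\<And>x y. x \<in> ideal_of \<tau> \<Longrightarrow> y \<in> ideal_of \<tau> \<Longrightarrow> x + y \<in> ideal_of \<tau>"
      "\<And>z x. z \<in> quad_integers D \<Longrightarrow> x \<in> ideal_of \<tau> \<Longrightarrow> z * x \<in> ideal_of \<tau>"
      using I unfolding int_ideal_def by blast+
    obtain x where x: "x \<in> ideal_of \<tau>" "x \<noteq> 0" using I unfolding int_ideal_def by blast
    have "\<alpha> \<noteq> 0" "(*) \<alpha> ` ideal_of \<tau> \<subseteq> quad_integers D" using \<alpha> by (auto simp: multipliers_def)
    with I'(1) x I'(2,3) have "int_ideal ((*) \<alpha> ` ideal_of \<tau>)" by (rule int_ideal_scale)
    then obtain \<sigma> where \<sigma>: "\<sigma> \<in> triples m" "(*) \<alpha> ` ideal_of \<tau> = ideal_of \<sigma>" using int_ideal_structure by blast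
    have "\<alpha> \<in> quad_field D" "\<alpha> \<noteq> 0" using \<alpha> multipliers_lattice(2)[OF \<tau>] by blast+
    then have "triple_class \<sigma> = triple_class \<tau>" using triple_class_eqI \<sigma>(2) by blast
    moreover have "\<alpha> \<in> F \<sigma>" using \<sigma>(2) \<alpha> by (simp add: F_def)
    ultimately show ?thesis using \<sigma>(1) by blast
  qed
  have inj: "\<sigma> = \<sigma>'" if "\<sigma> \<in> ?T" "\<sigma>' \<in> ?T" "\<alpha> \<in> F \<sigma>" "\<alpha> \<in> F \<sigma>'" for \<sigma> \<sigma>' \<alpha>
  proof -
    have "ideal_of \<sigma> = ideal_of \<sigma>'" using that by (simp add: F_def)
    then show ?thesis using ideal_of_inj that by (cases \<sigma>; cases \<sigma>') blast
  qed
  have bij1: "bij_betw snd (Sigma ?T F) (multipliers \<tau> - {0})"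
    unfolding bij_betw_def
  proof
    show "inj_on snd (Sigma ?T F)" using inj by (auto simp: inj_on_def)
    show "snd ` Sigma ?T F = multipliers \<tau> - {0}"
    proof (intro subset_antisym subsetI)
      fix \<alpha> assume "\<alpha> \<in> multipliers \<tau> - {0}"
      from surj[OF this] obtain \<sigma> where "(\<sigma>, \<alpha>) \<in> Sigma ?T F" by blast
      then show "\<alpha> \<in> snd ` Sigma ?T F" by force
    qed (auto simp: F_def)
  qed
  have indep: "x = 0 \<and> y = 0" if "of_int x * u + of_int y * v = 0" for x y
  proof -
    have "Im (cnj u * (of_int x * u + of_int y * v)) = of_int y * Im (cnj u * v)" by (simp add: algebra_simps)
    then have y: "y = 0" using that uv by simp
    moreover have "u \<noteq> 0" using uv by auto
    ultimately show ?thesis using that by simp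
  qed
  have bij2: "bij_betw (\<lambda>(x, y). of_int x * u + of_int y * v) (UNIV - {(0, 0)}) (multipliers \<tau> - {0})"
    unfolding bij_betw_def
  proof
    show "inj_on (\<lambda>(x, y). of_int x * u + of_int y * v) (UNIV - {(0, 0)})"
    proof (rule inj_onI, clarsimp)
      fix x y x' y' :: int assume "of_int x * u + of_int y * v = of_int x' * u + of_int y' * v"
      then have "of_int (x - x') * u + of_int (y - y') * v = 0" by (simp add: algebra_simps)
      from indep[OF this] show "x = x' \<and> y = y'" by simp
    qed
    show "(\<lambda>(x, y). of_int x * u + of_int y * v) ` (UNIV - {(0, 0)}) = multipliers \<tau> - {0}"
    proof (intro subset_antisym subsetI)
      fix z assume "z \<in> (\<lambda>(x, y). of_int x * u + of_int y * v) ` (UNIV - {(0, 0)})"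
      then obtain x y where "(x, y) \<noteq> (0, 0)" "z = of_int x * u + of_int y * v" by auto
      then show "z \<in> multipliers \<tau> - {0}" unfolding M using indep by (auto simp: Lat_def)
    next
      fix z assume "z \<in> multipliers \<tau> - {0}"
      then obtain x y where "z = of_int x * u + of_int y * v" "z \<noteq> 0" unfolding M by (auto simp: Lat_def)
      then show "z \<in> (\<lambda>(x, y). of_int x * u + of_int y * v) ` (UNIV - {(0, 0)})"
        by (intro image_eqI[of _ _ "(x, y)"]) auto
    qed
  qed
  have "((\<lambda>\<sigma>. exp (- t * real (triple_norm \<sigma>))) has_sum (theta u v (n * t) / 2)) ?T" if t: "0 < t" for t
  proof -
    have "theta_term u v (n * t) summable_on (UNIV - {(0, 0)})"
      by (rule summable_on_subset[OF summable_theta_term[OF uv]]) (use n t in simp_all)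
    then have "(theta_term u v (n * t) has_sum theta u v (n * t)) (UNIV - {(0, 0)})"
      by (simp add: theta_def has_sum_infsum)
    moreover have "theta_term u v (n * t) = (\<lambda>z. exp (- (n * t) * (cmod ((\<lambda>(x, y). of_int x * u + of_int y * v) z))\<^sup>2))"
      by (auto simp: theta_term_def fun_eq_iff)
    ultimately have "((\<lambda>\<alpha>. exp (- (n * t) * (cmod \<alpha>)\<^sup>2)) has_sum theta u v (n * t)) (multipliers \<tau> - {0})"
      using has_sum_reindex_bij_betw[OF bij2, of "\<lambda>\<alpha>. exp (- (n * t) * (cmod \<alpha>)\<^sup>2)"] by simp
    then have S: "((\<lambda>z. exp (- (n * t) * (cmod (snd z))\<^sup>2)) has_sum theta u v (n * t)) (Sigma ?T F)"
      using has_sum_reindex_bij_betw[OF bij1, of "\<lambda>\<alpha>. exp (- (n * t) * (cmod \<alpha>)\<^sup>2)"] by simp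
    have "((\<lambda>\<sigma>. 2 * exp (- t * real (triple_norm \<sigma>))) has_sum theta u v (n * t)) ?T"
    proof (rule has_sum_SigmaD[OF S])
      fix \<sigma> assume \<sigma>: "\<sigma> \<in> ?T"
      obtain \<alpha> where \<alpha>: "\<alpha> \<noteq> 0" "F \<sigma> = {\<alpha>, - \<alpha>}" using F2[OF \<sigma>] by blast
      have nn: "real (triple_norm \<sigma>) = n * (cmod \<alpha>)\<^sup>2"
        using norm[OF \<sigma>, of \<alpha>] \<alpha>(2) by blast
      have nm: "exp (- (n * t) * (cmod \<alpha>)\<^sup>2) = exp (- t * real (triple_norm \<sigma>))"
        unfolding nn by (simp add: mult_ac)
      show "((\<lambda>\<alpha>. exp (- (n * t) * (cmod (snd (\<sigma>, \<alpha>)))\<^sup>2)) has_sum 2 * exp (- t * real (triple_norm \<sigma>))) (F \<sigma>)"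
        unfolding \<alpha>(2) snd_conv
      proof (rule has_sum_finiteI)
        have "\<alpha> \<noteq> - \<alpha>" using \<alpha>(1) by simp
        then show "2 * exp (- t * real (triple_norm \<sigma>)) = (\<Sum>\<alpha>\<in>{\<alpha>, - \<alpha>}. exp (- (n * t) * (cmod \<alpha>)\<^sup>2))"
          unfolding nm[symmetric] by simp
      qed simp
    qed
    from has_sum_cmult_right[OF this, of "1 / 2"] show ?thesis by simp
  qed
  then show ?thesis using uv unfolding n_def by blast
qed

text \<open>Each of the finitely many classes contributes \<open>3 / 2\<close> to the limit of \<open>F(t) - 4 F(4t)\<close>.\<close>

theorem class_number_eq_L0:
  assumes "periodic_splitting_character m X N"
  shows "real (class_number D) = periodic_splitting_character.L0 X N"
proof -
  interpret periodic_splitting_character m X N by fact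
  let ?C = "triple_class ` triples m"
  define Q where "Q c z \<longleftrightarrow> (case z of (u, v, n) \<Rightarrow> Im (cnj u * v) \<noteq> 0 \<and> 0 < n \<and> (\<forall>t>0.
    ((\<lambda>\<sigma>. exp (- t * real (triple_norm \<sigma>))) has_sum (theta u v (n * t) / 2)) {\<sigma>\<in>triples m. triple_class \<sigma> = c}))"
    for c and z :: "complex \<times> complex \<times> real"
  have "\<exists>z. Q c z" if "c \<in> ?C" for c
  proof -
    obtain \<tau> where \<tau>: "\<tau> \<in> triples m" "c = triple_class \<tau>" using \<open>c \<in> ?C\<close> by blast
    obtain u v where "Im (cnj u * v) \<noteq> 0" "\<forall>t>0.
      ((\<lambda>\<sigma>. exp (- t * real (triple_norm \<sigma>))) has_sum (theta u v (real (triple_norm \<tau>) * t) / 2))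
      {\<sigma>\<in>triples m. triple_class \<sigma> = triple_class \<tau>}"
      using class_theta_sum[OF \<tau>(1)] by blast
    moreover have "0 < real (triple_norm \<tau>)" using \<tau>(1) by (auto simp: triples_def triple_norm_def)
    ultimately have "Q c (u, v, real (triple_norm \<tau>))" unfolding Q_def \<tau>(2) by simp
    then show ?thesis by blast
  qed
  then obtain f where f: "\<And>c. c \<in> ?C \<Longrightarrow> Q c (f c)" by metis
  define u v n where "u c = fst (f c)" and "v c = fst (snd (f c))" and "n c = snd (snd (f c))" for c
  have uvn: "Im (cnj (u c) * v c) \<noteq> 0 \<and> 0 < n c \<and> (\<forall>t>0.
    ((\<lambda>\<sigma>. exp (- t * real (triple_norm \<sigma>))) has_sum (theta (u c) (v c) (n c * t) / 2)) {\<sigma>\<in>triples m. triple_class \<sigma> = c})"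
    if "c \<in> ?C" for c
    using f[OF that] by (simp add: Q_def u_def v_def n_def case_prod_unfold)
  have decomp: "ideal_sum t = (\<Sum>c\<in>?C. theta (u c) (v c) (n c * t) / 2)" if t: "0 < t" for t
  proof -
    have "((\<lambda>\<sigma>. exp (- t * real (triple_norm \<sigma>))) has_sum (\<Sum>c\<in>?C. theta (u c) (v c) (n c * t) / 2))
        (\<Union>c\<in>?C. {\<sigma>\<in>triples m. triple_class \<sigma> = c})"
      using uvn t finite_classes by (intro sum_has_sum) auto
    also have "(\<Union>c\<in>?C. {\<sigma>\<in>triples m. triple_class \<sigma> = c}) = triples m" by blast
    finally show ?thesis using ideal_sum_conv_pairs(1)[OF t] has_sum_unique by blast
  qed
  have lim: "((\<lambda>t. theta (u c) (v c) (n c * t) - 4 * theta (u c) (v c) (n c * (4 * t))) \<longlongrightarrow> 3) (at_right 0)"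
    if c: "c \<in> ?C" for c
  proof -
    have n: "0 < n c" using uvn[OF c] by blast
    have "filterlim (\<lambda>t. n c * t) (at_right 0) (at_right 0)"
      unfolding filterlim_at
    proof
      show "((\<lambda>t. n c * t) \<longlongrightarrow> 0) (at_right 0)" by (auto intro!: tendsto_eq_intros)
      show "\<forall>\<^sub>F x in at_right 0. n c * x \<in> {0<..} \<and> n c * x \<noteq> 0"
        using eventually_at_right_less[of 0] by (rule eventually_mono) (use n in simp)
    qed
    from filterlim_compose[OF theta_constant_term this] uvn[OF c]
    show ?thesis by (simp add: mult.left_commute)
  qed
  have "((\<lambda>t. \<Sum>c\<in>?C. (theta (u c) (v c) (n c * t) - 4 * theta (u c) (v c) (n c * (4 * t))) / 2)
      \<longlongrightarrow> (\<Sum>c\<in>?C. 3 / 2)) (at_right 0)"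
    by (intro tendsto_sum tendsto_divide lim tendsto_const) simp_all
  moreover have "\<forall>\<^sub>F t in at_right 0. (\<Sum>c\<in>?C. (theta (u c) (v c) (n c * t) - 4 * theta (u c) (v c) (n c * (4 * t))) / 2)
      = ideal_sum t - 4 * ideal_sum (4 * t)"
    using eventually_at_right_less[of 0]
  proof (rule eventually_mono)
    fix t :: real assume t: "0 < t"
    then have t4: "0 < 4 * t" by simp
    show "(\<Sum>c\<in>?C. (theta (u c) (v c) (n c * t) - 4 * theta (u c) (v c) (n c * (4 * t))) / 2)
      = ideal_sum t - 4 * ideal_sum (4 * t)"
      unfolding decomp[OF t] decomp[OF t4] sum_distrib_left sum_subtractf[symmetric]
      by (intro sum.cong refl) (simp add: field_simps)
  qed
  ultimately have "((\<lambda>t. ideal_sum t - 4 * ideal_sum (4 * t)) \<longlongrightarrow> (\<Sum>c\<in>?C. 3 / 2)) (at_right 0)"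
    by (simp only: tendsto_cong)
  from tendsto_unique[OF _ this ideal_sum_constant_term]
  have "(\<Sum>c\<in>?C. 3 / 2) = 3 / 2 * L0" by (simp add: trivial_limit_at_right_real)
  then have "real (card ?C) = L0" by simp
  then show ?thesis using class_number_homothety_class classes_eq_image_triples by simp
qed

end

section \<open>Sums of an odd character over sixths\<close>

locale odd_character =
  fixes N :: int and X :: "int \<Rightarrow> int"
  assumes N_gt_1: "1 < N"
    and X_mult: "X (a * b) = X a * X b"
    and X_cong: "[a = b] (mod N) \<Longrightarrow> X a = X b"
    and X_range: "X a \<in> {-1, 0, 1}"
    and X_eq_0_iff: "X a = 0 \<longleftrightarrow> \<not> coprime a N"
    and X_minus_one: "X (-1) = -1"
begin

text \<open>By the class number formula, this equals \<open>- N h\<close> when \<open>X\<close> is the character of the field.\<close>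

definition moment :: int where
  "moment = (\<Sum>x\<in>{1..<N}. x * X x)"

text \<open>The map \<open>x \<mapsto> r x mod N\<close> permutes the residues and multiplies \<open>X\<close> by \<open>X r = \<plusminus>1\<close>; moreover
\<open>r x mod N = r x - N \<lfloor>r x / N\<rfloor>\<close>.\<close>

lemma floor_sum:
  assumes r: "coprime r N"
  shows "N * (\<Sum>x\<in>{1..<N}. ((r * x) div N) * X x) = (r - X r) * moment"
proof -
  have range: "(r * x) mod N \<in> {1..<N}" if "x \<in> {1..<N}" for x
  proof -
    have "\<not> N dvd x" using that by (auto dest: zdvd_imp_le)
    then have "\<not> N dvd r * x"
      using r by (simp add: coprime_commute coprime_dvd_mult_right_iff)
    then have "(r * x) mod N \<noteq> 0" by (simp add: dvd_eq_mod_eq_0)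
    moreover have "0 \<le> (r * x) mod N" "(r * x) mod N < N" using N_gt_1 by simp_all
    ultimately show ?thesis by simp
  qed
  have "inj_on (\<lambda>x. (r * x) mod N) {1..<N}"
  proof (rule inj_onI)
    fix x y assume xy: "x \<in> {1..<N}" "y \<in> {1..<N}" "(r * x) mod N = (r * y) mod N"
    then have "[r * x = r * y] (mod N)" by (simp add: Cong.cong_def)
    then have "[x = y] (mod N)" using r by (simp add: cong_mult_lcancel)
    then show "x = y" using xy by (simp add: Cong.cong_def)
  qed
  moreover have "(\<lambda>x. (r * x) mod N) ` {1..<N} \<subseteq> {1..<N}" using range by blast
  ultimately have bij: "bij_betw (\<lambda>x. (r * x) mod N) {1..<N} {1..<N}"
    by (simp add: bij_betw_def endo_inj_surj)
  have "moment = (\<Sum>x\<in>{1..<N}. ((r * x) mod N) * X ((r * x) mod N))"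
    unfolding moment_def by (rule sum.reindex_bij_betw[OF bij, symmetric])
  also have "\<dots> = (\<Sum>x\<in>{1..<N}. X r * (((r * x) mod N) * X x))"
  proof (rule sum.cong[OF refl])
    fix x
    have "X ((r * x) mod N) = X (r * x)" by (rule X_cong) (simp add: Cong.cong_def)
    then show "((r * x) mod N) * X ((r * x) mod N) = X r * (((r * x) mod N) * X x)"
      by (simp add: X_mult)
  qed
  also have "\<dots> = X r * (\<Sum>x\<in>{1..<N}. ((r * x) mod N) * X x)"
    by (simp add: sum_distrib_left)
  also have "(\<Sum>x\<in>{1..<N}. ((r * x) mod N) * X x)
      = (\<Sum>x\<in>{1..<N}. r * (x * X x) - N * (((r * x) div N) * X x))"
    by (intro sum.cong refl) (simp add: minus_mult_div_eq_mod[symmetric] algebra_simps)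
  also have "\<dots> = r * moment - N * (\<Sum>x\<in>{1..<N}. ((r * x) div N) * X x)"
    by (simp add: sum_subtractf sum_distrib_left moment_def)
  finally have eq: "moment = X r * (r * moment - N * (\<Sum>x\<in>{1..<N}. ((r * x) div N) * X x))" .
  have "X r = 1 \<or> X r = -1" using X_eq_0_iff[of r] X_range[of r] r by auto
  then show ?thesis
  proof
    assume "X r = 1"
    then show ?thesis using eq by (simp only: left_diff_distrib mult_1)
  next
    assume "X r = -1"
    then show ?thesis using eq by (simp only: left_diff_distrib mult_minus1)
  qed
qed

lemma X_reflect: "X (N - x) = - X x"
proof -
  have "X (N - x) = X ((-1) * x)" by (rule X_cong) (simp add: cong_iff_dvd_diff)
  then show ?thesis unfolding X_mult X_minus_one by simp
qed

lemma X_sum_zero: "(\<Sum>x\<in>{1..<N}. X x) = 0"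
proof -
  have "(\<Sum>x\<in>{1..<N}. X x) = (\<Sum>x\<in>{1..<N}. X (N - x))"
    by (rule sum.reindex_bij_witness[of _ "\<lambda>x. N - x" "\<lambda>x. N - x"]) auto
  then show ?thesis by (simp add: X_reflect sum_negf)
qed

end

locale odd_character_coprime_6 = odd_character +
  assumes coprime_6: "coprime 6 N"
begin

text \<open>The sum of \<open>X\<close> over the open interval from \<open>j N / 6\<close> to \<open>(j + 1) N / 6\<close>.  No multiple of \<open>N / 6\<close> strictly between
0 and \<open>N\<close> is an integer, so the condition on \<open>\<lfloor>6 x / N\<rfloor>\<close> describes the open interval.\<close>

definition sixth :: "int \<Rightarrow> int" where
  "sixth j = (\<Sum>x\<in>{x\<in>{1..<N}. (6 * x) div N = j}. X x)"

lemma six_times_mod_nonzero: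
  assumes "x \<in> {1..<N}"
  shows "(6 * x) mod N \<noteq> 0"
proof -
  have "\<not> N dvd x" using assms by (auto dest: zdvd_imp_le)
  then have "\<not> N dvd 6 * x"
    using coprime_6 by (simp add: coprime_commute coprime_dvd_mult_right_iff)
  then show ?thesis by (simp add: dvd_eq_mod_eq_0)
qed

lemma six_times_div_range:
  assumes "x \<in> {1..<N}"
  shows "(6 * x) div N \<in> {0, 1, 2, 3, 4, 5}"
proof -
  have "0 \<le> (6 * x) div N" using assms by (simp add: pos_imp_zdiv_nonneg_iff)
  moreover have "(6 * x) div N < 6"
  proof (rule ccontr)
    assume "\<not> (6 * x) div N < 6"
    then have "6 * N \<le> ((6 * x) div N) * N" using N_gt_1 by (intro mult_right_mono) auto
    also have "\<dots> \<le> 6 * x" using N_gt_1 by (simp add: minus_mod_eq_div_mult[symmetric])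
    finally show False using assms by simp
  qed
  ultimately show ?thesis by auto
qed

lemma sum_by_sixths:
  "(\<Sum>x\<in>{1..<N}. g ((6 * x) div N) * X x) = (\<Sum>j\<in>{0, 1, 2, 3, 4, 5}. g j * sixth j)"
proof -
  have "(\<Sum>x\<in>{1..<N}. g ((6 * x) div N) * X x)
      = (\<Sum>j\<in>{0, 1, 2, 3, 4, 5}. \<Sum>x\<in>{x\<in>{1..<N}. (6 * x) div N = j}. g ((6 * x) div N) * X x)"
    using six_times_div_range by (intro sum.group[symmetric] image_subsetI) simp_all
  also have "\<dots> = (\<Sum>j\<in>{0, 1, 2, 3, 4, 5}. g j * sixth j)"
    unfolding sixth_def sum_distrib_left by (intro sum.cong refl) auto
  finally show ?thesis .
qed

text \<open>The reflection \<open>x \<mapsto> N - x\<close> exchanges the sixths and changes the sign of \<open>X\<close>.\<close>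

lemma sixth_reflect: "sixth (5 - j) = - sixth j"
proof -
  have refl: "(6 * (N - x)) div N = 5 - (6 * x) div N" if "x \<in> {1..<N}" for x
  proof -
    have m: "0 < (6 * x) mod N" "(6 * x) mod N < N"
      using six_times_mod_nonzero[OF that] N_gt_1 pos_mod_sign[of N "6 * x"] pos_mod_bound[of N "6 * x"] by linarith+
    have "6 * (N - x) = (5 - (6 * x) div N) * N + (N - (6 * x) mod N)"
      using div_mult_mod_eq[of "6 * x" N] by (simp add: algebra_simps)
    also have "\<dots> div N = (5 - (6 * x) div N) + (N - (6 * x) mod N) div N"
      using N_gt_1 by simp
    also have "(N - (6 * x) mod N) div N = 0" using m by (intro div_pos_pos_trivial) linarith+
    finally show ?thesis by simp
  qed
  have "sixth (5 - j) = (\<Sum>x\<in>{x\<in>{1..<N}. (6 * x) div N = j}. X (N - x))"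
    unfolding sixth_def
    by (rule sum.reindex_bij_witness[of _ "\<lambda>x. N - x" "\<lambda>x. N - x"])
       (auto simp: refl simp del: right_diff_distrib_numeral)
  then show ?thesis by (simp add: sixth_def sum_negf X_reflect)
qed

text \<open>\<open>floor_sum\<close> for \<open>r = 2, 3, 6\<close>, with the floors evaluated on the sixths.\<close>

lemma sixth_sums:
  assumes h: "moment = - N * h"
  shows "2 * sixth 0 = (1 + X 2 + X 3 - X 2 * X 3) * h"
    and "2 * (sixth 0 + sixth 1) = (3 - X 3) * h"
    and "sixth 0 + sixth 1 + sixth 2 = (2 - X 2) * h"
proof -
  have 0: "sixth 3 = - sixth 2" "sixth 4 = - sixth 1" "sixth 5 = - sixth 0"
    using sixth_reflect[of 2] sixth_reflect[of 1] sixth_reflect[of 0] by simp_all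
  have cop: "coprime 2 N" "coprime 3 N"
    using coprime_6 coprime_mult_left_iff[of 2 3 N] by (simp_all del: coprime_left_2_iff_odd coprime_right_2_iff_odd)
  have fl: "(\<Sum>x\<in>{1..<N}. ((r * x) div N) * X x) = - (r - X r) * h" if "coprime r N" for r
  proof -
    have "N * (\<Sum>x\<in>{1..<N}. ((r * x) div N) * X x) = N * (- (r - X r) * h)"
      using floor_sum[OF that] by (simp add: h algebra_simps)
    then show ?thesis using N_gt_1 by simp
  qed
  have 6: "(\<Sum>x\<in>{1..<N}. ((6 * x) div N) * X x) = sixth 1 + 2 * sixth 2 + 3 * sixth 3 + 4 * sixth 4 + 5 * sixth 5"
    using sum_by_sixths[of "\<lambda>j. j"] by simp
  have d2: "(2 * x) div N = ((6 * x) div N) div 3" for x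
  proof -
    have "((6 * x) div N) div 3 = (3 * (2 * x)) div (3 * N)"
      by (simp add: zdiv_zmult2_eq[symmetric] mult.commute)
    then show ?thesis by simp
  qed
  have d3: "(3 * x) div N = ((6 * x) div N) div 2" for x
  proof -
    have "((6 * x) div N) div 2 = (2 * (3 * x)) div (2 * N)"
      by (simp add: zdiv_zmult2_eq[symmetric] mult.commute)
    then show ?thesis by simp
  qed
  have 2: "(\<Sum>x\<in>{1..<N}. ((2 * x) div N) * X x) = sixth 3 + sixth 4 + sixth 5"
    unfolding d2 using sum_by_sixths[of "\<lambda>j. j div 3"] by simp
  have 3: "(\<Sum>x\<in>{1..<N}. ((3 * x) div N) * X x) = sixth 2 + sixth 3 + 2 * sixth 4 + 2 * sixth 5"
    unfolding d3 using sum_by_sixths[of "\<lambda>j. j div 2"] by simp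
  have X6: "X 6 = X 2 * X 3" using X_mult[of 2 3] by simp
  show "sixth 0 + sixth 1 + sixth 2 = (2 - X 2) * h"
    using fl[OF cop(1)] 2 0 by (simp add: algebra_simps)
  moreover show "2 * (sixth 0 + sixth 1) = (3 - X 3) * h"
    using fl[OF cop(2)] 3 0 by (simp add: algebra_simps)
  moreover have "sixth 2 + 3 * sixth 1 + 5 * sixth 0 = (6 - X 6) * h"
    using fl[OF coprime_6] 6 0 by (simp add: algebra_simps)
  ultimately show "2 * sixth 0 = (1 + X 2 + X 3 - X 2 * X 3) * h"
    by (simp add: algebra_simps X6)
qed

end

lemma E_conv_sixths:
  assumes "odd_character_coprime_6 \<bar>D\<bar> (chi D)"
  shows "E D 6 k = odd_character_coprime_6.sixth \<bar>D\<bar> (chi D) (int k)"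
proof -
  interpret odd_character_coprime_6 "\<bar>D\<bar>" "chi D" by fact
  let ?N = "\<bar>D\<bar>"
  have cond: "(real k * of_int ?N / real 6 < of_int x \<and> of_int x < real (k + 1) * of_int ?N / real 6)
      \<longleftrightarrow> (6 * x) div ?N = int k" if x: "1 \<le> x" "x \<le> ?N" "coprime x ?N" for x
  proof -
    have "x \<noteq> ?N" using x N_gt_1 by auto
    then have xr: "x \<in> {1..<?N}" using x by auto
    define q m where "q = (6 * x) div ?N" and "m = (6 * x) mod ?N"
    have qm: "6 * x = q * ?N + m" by (simp add: q_def m_def)
    have m: "0 < m" "m < ?N"
      using six_times_mod_nonzero[OF xr] N_gt_1 pos_mod_sign[of ?N "6 * x"] pos_mod_bound[of ?N "6 * x"]
      unfolding m_def by linarith+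
    have "(real k * of_int ?N / real 6 < of_int x \<and> of_int x < real (k + 1) * of_int ?N / real 6)
      \<longleftrightarrow> (real_of_int (int k * ?N) < real_of_int (6 * x) \<and> real_of_int (6 * x) < real_of_int ((int k + 1) * ?N))"
      by (simp add: field_simps)
    also have "\<dots> \<longleftrightarrow> int k * ?N < 6 * x \<and> 6 * x < (int k + 1) * ?N"
      by (simp only: of_int_less_iff)
    also have "\<dots> \<longleftrightarrow> q = int k"
    proof
      assume a: "int k * ?N < 6 * x \<and> 6 * x < (int k + 1) * ?N"
      have "int k * ?N < (q + 1) * ?N" using a m unfolding qm by (simp add: algebra_simps)
      then have "int k < q + 1" using N_gt_1 by (simp add: mult_less_cancel_right)
      moreover have "q * ?N < (int k + 1) * ?N" using a m unfolding qm by linarith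
      then have "q < int k + 1" using N_gt_1 by (simp add: mult_less_cancel_right)
      ultimately show "q = int k" by simp
    next
      assume "q = int k" then show "int k * ?N < 6 * x \<and> 6 * x < (int k + 1) * ?N"
        using m unfolding qm by (simp add: algebra_simps)
    qed
    finally show ?thesis by (simp add: q_def)
  qed
  have "E D 6 k = sum (chi D) {x \<in> {1..<?N}. coprime x ?N \<and> (6 * x) div ?N = int k}"
    unfolding E_def
  proof (rule sum.cong)
    show "{x. 1 \<le> x \<and> x \<le> ?N \<and> coprime x ?N \<and> real k * of_int ?N / real 6 < of_int x \<and>
           of_int x < real (k + 1) * of_int ?N / real 6} = {x \<in> {1..<?N}. coprime x ?N \<and> (6 * x) div ?N = int k}"
      (is "?L = ?R")
    proof (intro Set.set_eqI iffI)
      fix x assume "x \<in> ?L"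
      then show "x \<in> ?R" using cond[of x] N_gt_1 by (cases "x = ?N") auto
    next
      fix x assume "x \<in> ?R" then show "x \<in> ?L" using cond[of x] by auto
    qed
  qed simp
  also have "\<dots> = sum (chi D) {x \<in> {1..<?N}. (6 * x) div ?N = int k}"
    by (rule sum.mono_neutral_left, rule finite_subset[of _ "{1..<?N}"]) (auto simp: X_eq_0_iff)
  finally show ?thesis unfolding sixth_def .
qed

section \<open>The class number formula and its consequence\<close>

locale negative_discriminant =
  fixes D :: int
  assumes D_less: "D < -4" and squarefree_D: "squarefree D" and D_mod_4: "D mod 4 = 1"
begin

definition N :: int where "N = \<bar>D\<bar>"
definition m :: nat where "m = nat ((N + 1) div 4)"

lemma N_eq: "N = - D"
  using D_less by (simp add: N_def)

lemma D_conv_m: "D = 1 - 4 * int m"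
proof -
  have "(N + 1) mod 4 = 0" unfolding N_eq using D_mod_4 by presburger
  then have "4 * ((N + 1) div 4) = N + 1" by presburger
  moreover have "0 \<le> (N + 1) div 4" using D_less by (simp add: N_eq)
  ultimately show ?thesis by (simp add: m_def N_eq)
qed

lemma m_ge_2: "2 \<le> m"
  using D_conv_m D_less by linarith

lemma N_conv_m: "N = 4 * int m - 1"
  using D_conv_m by (simp add: N_eq)

lemma N_odd: "odd N" and N_gt_1: "1 < N" and N_pos: "0 < N"
  using m_ge_2 by (simp_all add: N_conv_m)

lemma chi4_N: "chi4 N = -1"
proof -
  have "N mod 4 = 3" unfolding N_conv_m by presburger
  then show ?thesis by (simp add: chi4_def)
qed

lemma chi_conv_Jacobi: "chi D x = Jacobi x N"
  by (simp add: chi_def N_def)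

lemma chi_odd_prime:
  assumes "prime p" "2 < p"
  shows "chi D (int p) = Legendre D (int p)"
  unfolding chi_conv_Jacobi Jacobi_reciprocity[OF N_odd N_pos assms] chi4_N by (simp add: N_eq)

lemma quad_roots_empty_iff:
  assumes p: "prime p" "2 < p"
  shows "quad_roots m p \<noteq> {} \<longleftrightarrow> QuadRes (int p) D"
proof
  assume "quad_roots m p \<noteq> {}"
  then obtain b where "int p dvd (int b)\<^sup>2 + int b + int m" by (auto simp: quad_roots_def quad_roots_int)
  then have "int p dvd 4 * ((int b)\<^sup>2 + int b + int m)" by (rule dvd_mult)
  then have "int p dvd (2 * int b + 1)\<^sup>2 - D" unfolding quad_complete_square D_conv_m[symmetric] .
  then show "QuadRes (int p) D" unfolding QuadRes_def cong_iff_dvd_diff by blast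
next
  assume "QuadRes (int p) D"
  then obtain y where y: "int p dvd y\<^sup>2 - D" unfolding QuadRes_def cong_iff_dvd_diff by blast
  have odd: "odd (int p)" using p prime_odd_nat by simp
  define x where "x = (if odd y then (y - 1) div 2 else (y + int p - 1) div 2)"
  have "int p dvd (2 * x + 1) - y" using odd by (auto simp: x_def)
  then have "[2 * x + 1 = y] (mod int p)" by (simp add: cong_iff_dvd_diff)
  then have "[(2 * x + 1)\<^sup>2 - D = y\<^sup>2 - D] (mod int p)" by (intro cong_diff cong_pow cong_refl)
  then have "int p dvd (2 * x + 1)\<^sup>2 - D" using y by (simp add: cong_dvd_iff)
  then have "int p dvd 2 * (2 * (x\<^sup>2 + x + int m))"
    using quad_complete_square[of x "int m"] D_conv_m by simp
  moreover have "coprime (int p) 2" using odd by simp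
  ultimately have "int p dvd x\<^sup>2 + x + int m" by (simp only: coprime_dvd_mult_right_iff)
  from quad_roots_mod[OF _ this] p show "quad_roots m p \<noteq> {}" by auto
qed

lemma chi_two: "chi D 2 = (if even m then 1 else -1)"
proof -
  have "N mod 8 = (if even m then 7 else 3)"
    unfolding N_conv_m by (cases "even m") (auto elim!: evenE oddE simp: mod_eq_dvd_iff, presburger+)
  then show ?thesis by (simp add: chi_conv_Jacobi Jacobi_two[OF N_odd N_pos] chi8_def)
qed

text \<open>For odd \<open>p\<close>, quadratic reciprocity translates the symbol modulo \<open>N\<close> into the symbol of \<open>D\<close> modulo
\<open>p\<close>.  For \<open>p = 2\<close>, the polynomial \<open>b\<^sup>2 + b + m\<close> has the constant parity of \<open>m\<close>, and this parity decides between
\<open>N = 7\<close> and \<open>N = 3\<close> modulo 8.\<close>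

lemma chi_unramified:
  assumes p: "prime p" and unram: "\<not> int p dvd D"
  shows "chi D (int p) = (if quad_roots m p = {} then -1 else 1)"
proof (cases "p = 2")
  case True
  have "2 dvd b\<^sup>2 + b + m \<longleftrightarrow> even m" for b by simp
  then have "quad_roots m 2 = (if even m then {..<2} else {})" by (auto simp: quad_roots_def)
  moreover have "{..<2::nat} \<noteq> {}" by (metis lessThan_iff empty_iff zero_less_numeral)
  ultimately show ?thesis using True chi_two by simp
next
  case False
  then have p2: "2 < p" using prime_ge_2_nat[OF p] by simp
  show ?thesis
    using chi_odd_prime[OF p p2] quad_roots_empty_iff[OF p p2] unram
    by (auto simp: Legendre_def cong_0_iff)
qed

lemma imaginary_quadratic: "imaginary_quadratic D m"
  by unfold_locales (rule D_conv_m, rule m_ge_2, rule squarefree_D)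

lemma chi_odd_character: "odd_character N (chi D)"
proof
  show "1 < N" by (rule N_gt_1)
  show "chi D (a * b) = chi D a * chi D b" for a b
    unfolding chi_conv_Jacobi by (rule Jacobi_mult[OF N_odd N_pos])
  show "chi D a = chi D b" if "[a = b] (mod N)" for a b
    unfolding chi_conv_Jacobi using that by (rule Jacobi_cong[OF N_odd N_pos])
  show "chi D a \<in> {-1, 0, 1}" for a
    unfolding chi_conv_Jacobi by (rule Jacobi_range[OF N_odd N_pos])
  show "chi D a = 0 \<longleftrightarrow> \<not> coprime a N" for a
    unfolding chi_conv_Jacobi by (rule Jacobi_eq_0_iff[OF N_odd N_pos])
  show "chi D (- 1) = - 1"
    unfolding chi_conv_Jacobi Jacobi_minus_one[OF N_odd N_pos] by (rule chi4_N)
qed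

lemma chi_odd_character_coprime_6:
  assumes "\<not> 3 dvd D"
  shows "odd_character_coprime_6 N (chi D)"
proof -
  interpret odd_character N "chi D" by (rule chi_odd_character)
  have "coprime 2 N" using N_odd by simp
  moreover have "coprime 3 N"
    using assms by (intro prime_imp_coprime) (simp_all add: N_eq)
  ultimately have "coprime (2 * 3) N" by (simp only: coprime_mult_left_iff)
  then show ?thesis by unfold_locales simp
qed

lemma sum_nat_conv_int:
  fixes f :: "int \<Rightarrow> 'a :: comm_monoid_add"
  assumes "f 0 = 0"
  shows "(\<Sum>i<nat N. f (int i)) = (\<Sum>x\<in>{1..<N}. f x)"
proof -
  have "(\<Sum>i<nat N. f (int i)) = (\<Sum>i\<in>{1..<nat N}. f (int i))"
    using assms by (intro sum.mono_neutral_right) (auto simp: Suc_le_eq)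
  also have "\<dots> = (\<Sum>x\<in>{1..<N}. f x)"
    by (rule sum.reindex_bij_witness[of _ nat int]) auto
  finally show ?thesis .
qed

lemma chi_splitting_character:
  "periodic_splitting_character m (\<lambda>n. chi D (int n)) (nat N)"
proof -
  interpret odd_character N "chi D" by (rule chi_odd_character)
  have X0: "chi D 0 = 0" using X_eq_0_iff[of 0] N_gt_1 by simp
  show ?thesis
  proof
    show "squarefree (1 - 4 * int m)" using squarefree_D D_conv_m by simp
    show "chi D (int 1) = 1" by (simp add: chi_conv_Jacobi Jacobi_one[OF N_odd N_pos])
    show "chi D (int (a * b)) = chi D (int a) * chi D (int b)" for a b by (simp add: X_mult)
    show "chi D (int p) = 0" if "prime p" "int p dvd 1 - 4 * int m" for p
    proof -
      have "int p dvd N" using that(2) unfolding D_conv_m[symmetric] by (simp add: N_eq)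
      then have "\<not> coprime (int p) N" using that(1)
        by (metis coprime_common_divisor dvd_refl not_prime_unit prime_int_nat_transfer nat_int of_nat_0_le_iff)
      then show ?thesis by (simp add: X_eq_0_iff)
    qed
    show "chi D (int p) = (if quad_roots m p = {} then -1 else 1)"
      if "prime p" "\<not> int p dvd 1 - 4 * int m" for p
      using chi_unramified that unfolding D_conv_m[symmetric] by blast
    show "1 < nat N" using N_gt_1 by simp
    show "chi D (int (n + nat N)) = chi D (int n)" for n
      using N_gt_1 by (intro X_cong) (simp add: cong_iff_dvd_diff)
    show "(\<Sum>i<nat N. chi D (int i)) = 0"
      using sum_nat_conv_int[of "chi D", OF X0] X_sum_zero by simp
    show "chi D (int 0) = 0" using X0 by simp
    show "\<bar>chi D (int n)\<bar> \<le> 1" for n using X_range[of "int n"] by auto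
  qed
qed

theorem class_number_formula:
  "odd_character.moment N (chi D) = - N * int (class_number D)"
proof -
  interpret odd_character N "chi D" by (rule chi_odd_character)
  interpret P: periodic_splitting_character m "\<lambda>n. chi D (int n)" "nat N"
    by (rule chi_splitting_character)
  have "real (class_number D) = P.L0"
    by (rule imaginary_quadratic.class_number_eq_L0[OF imaginary_quadratic]) unfold_locales
  also have "P.L0 = - (\<Sum>i<nat N. real_of_int (int i * chi D (int i))) / real_of_int N"
    using N_gt_1 by (simp add: P.L0_def)
  also have "(\<Sum>i<nat N. real_of_int (int i * chi D (int i))) = real_of_int moment"
    using sum_nat_conv_int[of "\<lambda>x. real_of_int (x * chi D x)"] by (simp add: moment_def)
  finally have "real_of_int (N * int (class_number D)) = real_of_int (- moment)"
    using N_gt_1 by (simp add: field_simps)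
  then have "N * int (class_number D) = - moment" by (simp only: of_int_eq_iff)
  then show ?thesis by simp
qed

lemma chi_three:
  assumes "\<not> 3 dvd D"
  shows "chi D 3 = (if N mod 3 = 2 then 1 else -1)"
proof -
  have p3: "prime (3::nat)" by simp
  have c: "chi D 3 = Legendre D 3" using chi_odd_prime[OF p3] by simp
  have l: "Legendre 1 3 = 1" by (rule Legendre_one) simp
  have l': "Legendre (-1) 3 = -1" using Legendre_minus_one[OF p3] by (simp add: chi4_def)
  show ?thesis
  proof (cases "N mod 3 = 2")
    case True
    then have "D mod 3 = 1 mod 3" unfolding N_eq by presburger
    then have "[D = 1] (mod 3)" by (simp only: Cong.cong_def)
    then show ?thesis using c l True Legendre_cong by metis
  next
    case False
    then have "D mod 3 = (-1) mod 3" using assms unfolding N_eq by presburger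
    then have "[D = -1] (mod 3)" by (simp only: Cong.cong_def)
    then show ?thesis using c l' False Legendre_cong by metis
  qed
qed

end

theorem theorem4p2:
  fixes D N h :: int
  assumes "D < -4" and "squarefree D" and "[D = 1] (mod 4)" and "\<not> 3 dvd D"
    and "N = \<bar>D\<bar>" and "h = int (class_number D)"
  shows
    "([N = 23] (mod 24) \<longrightarrow> E D 6 0 = h \<and> E D 6 1 = 0 \<and> E D 6 2 = 0) \<and>
     ([N = 11] (mod 24) \<longrightarrow> E D 6 0 = h \<and> E D 6 1 = 0 \<and> E D 6 2 = 2 * h) \<and>
     ([N = 7] (mod 24) \<longrightarrow> E D 6 0 = h \<and> E D 6 1 = h \<and> E D 6 2 = - h) \<and>
     ([N = 19] (mod 24) \<longrightarrow> E D 6 0 = - h \<and> E D 6 1 = 3 * h \<and> E D 6 2 = h)"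
proof -
  interpret nd: negative_discriminant D
    using assms(1-3) by unfold_locales (simp_all add: Cong.cong_def)
  interpret oc: odd_character_coprime_6 "\<bar>D\<bar>" "chi D"
    using nd.chi_odd_character_coprime_6[OF assms(4)] by (simp add: nd.N_def)
  have N: "nd.N = N" "\<bar>D\<bar> = N" by (simp_all add: nd.N_def assms(5))
  have E: "E D 6 0 = oc.sixth 0" "E D 6 1 = oc.sixth 1" "E D 6 2 = oc.sixth 2"
    using E_conv_sixths[OF oc.odd_character_coprime_6_axioms] by simp_all
  have "oc.moment = - \<bar>D\<bar> * h"
    using nd.class_number_formula by (simp add: nd.N_def assms(6))
  note sums = oc.sixth_sums[OF this, folded E]
  have 2: "chi D 2 = (if N mod 8 = 7 then 1 else -1)"
  proof -
    have "N mod 8 = 7 \<longleftrightarrow> even nd.m"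
      using nd.N_conv_m unfolding N by presburger
    then show ?thesis by (simp add: nd.chi_two)
  qed
  have 3: "chi D 3 = (if N mod 3 = 2 then 1 else -1)"
    using nd.chi_three[OF assms(4)] unfolding N .
  have mods: "N mod 8 = c mod 8" "N mod 3 = c mod 3" if "[N = c] (mod 24)" for c
    using cong_dvd_modulus[OF that, of 8] cong_dvd_modulus[OF that, of 3]
    by (simp_all add: Cong.cong_def)
  show ?thesis
  proof (intro conjI[where P = "_ \<longrightarrow> _"] impI)
    assume "[N = 23] (mod 24)"
    then show "E D 6 0 = h \<and> E D 6 1 = 0 \<and> E D 6 2 = 0"
      using sums mods[of 23] by (simp add: 2 3)
  next
    assume "[N = 11] (mod 24)"
    then show "E D 6 0 = h \<and> E D 6 1 = 0 \<and> E D 6 2 = 2 * h"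
      using sums mods[of 11] by (simp add: 2 3)
  next
    assume "[N = 7] (mod 24)"
    then show "E D 6 0 = h \<and> E D 6 1 = h \<and> E D 6 2 = - h"
      using sums mods[of 7] by (simp add: 2 3)
  next
    assume "[N = 19] (mod 24)"
    then show "E D 6 0 = - h \<and> E D 6 1 = 3 * h \<and> E D 6 2 = h"
      using sums mods[of 19] by (simp add: 2 3)
  qed
qed

end
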